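(* Let $(M,\mathcal{H},\langle\cdot,\cdot\rangle)$ be a $d$-dimensional sub-Riemannian manifold of rank $m$, complete with respect to the Carnot–Carathéodory metric $d_{CC}$, let $\mathcal{V}$ be a vertical distribution, let $(\cdot,\cdot)$ be any Riemannian metric on $M$ extending $\langle\cdot,\cdot\rangle$ for which $\mathcal{V}$ is the orthogonal complement of $\mathcal{H}$, let $g:TM\to T^*M$ be the induced bundle isomorphism, and let $\mathscr{P}=\beta\circ g$. Suppose that $M$ is oriented. There exists a volume form $\omega$ on $M$, locally written $\omega=\tau\,dx^1\wedge\cdots\wedge dx^d$, such that $\mathcal{L}^{\mathcal{V}}=\frac1m\operatorname{div}^{\omega}\operatorname{grad}_{\mathcal{H}}$ if and only if there is a volume form $\omega$, locally $\omega=\tau\,dx^1\wedge\cdots\wedge dx^d$, such that in local coordinates, for every $k=1,\dots,d$, $$\sum_{l=1}^d\left[-\frac12\beta^{lk}\sum_{i,j=1}^d[g^{\mathcal{V}}]_{ij}\frac{\partial\beta^{ij}}{\partial x^l}+\sum_{j=1}^d{\mathscr{P}^l}_j\frac{\partial\beta^{jk}}{\partial x^l}\right]=\sum_{l=1}^d\left[\beta^{lk}\Big(\frac1\tau\frac{\partial\tau}{\partial x^l}\Big)+\frac{\partial\beta^{lk}}{\partial x^l}\right]$$ (a volume form $\omega$ satisfying the equality of operators being the same as one satisfying this system). In particular, for the equality $\mathcal{L}^{\mathcal{V}}=\frac1m\operatorname{div}^{\omega}\operatorname{grad}_{\mathcal{H}}$ it is sufficient that, in local coordinates, both $$-\frac12\sum_{i,j,l=1}^d[g^{\mathcal{V}}]_{ij}\frac{\partial\beta^{ij}}{\partial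 x^l}=\frac1\tau\sum_{l=1}^d\frac{\partial\tau}{\partial x^l}$$ and $$\sum_{j,l=1}^d{\mathscr{P}^l}_j\frac{\partial\beta^{jk}}{\partial x^l}=\sum_{l=1}^d\frac{\partial\beta^{lk}}{\partial x^l}\quad\text{for every } k=1,\dots,d.$$
   Context: A sub-Riemannian manifold of rank $m$ is a triple $(M,\mathcal{H},\langle\cdot,\cdot\rangle)$ where $M$ is a connected smooth $d$-dimensional manifold, $\mathcal{H}\subset TM$ is a smooth sub-bundle of rank $m$ whose sections (horizontal vector fields) together with their iterated Lie brackets span $T_pM$ at every $p\in M$ (Hörmander's condition), and $\langle\cdot,\cdot\rangle$ is a smoothly varying inner product on the fibers of $\mathcal{H}$. The Carnot–Carathéodory metric is $d_{CC}(x,y)=\inf\big(\int_0^1|\sigma'(t)|^2dt\big)^{1/2}$ over curves $\sigma$ tangent to $\mathcal{H}$ with $\sigma(0)=x$, $\sigma(1)=y$. $\beta:T^*M\to TM$ is the unique symmetric positive semi-definite bundle homomorphism with image $\mathcal{H}$ and $\langle\beta(p),X\rangle=p(X)$ for all covectors $p$ and horizontal vectors $X$ at the same point. In a local chart $(x^1,\dots,x^d)$, $\beta^{ij}=\langle\beta(dx^i),\beta(dx^j)\rangle=dx^i(\beta(dx^j))$. A vertical distribution $\mathcal{V}$ is a smooth sub-bundle of $TM$ with $TM=\mathcal{H}\oplus\mathcal{V}$. $g^{\mathcal{V}}:TM\to T^*M$ is the unique symmetric, positive semi-definite bundle homomorphism with $\beta\circ g^{\mathcal{V}}(X)=X$ for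 $X\in\mathcal{H}$ and $g^{\mathcal{V}}(Y)=0$ for $Y\in\mathcal{V}$; $[g^{\mathcal{V}}]_{ij}=g^{\mathcal{V}}(\partial_{x^j})(\partial_{x^i})$. The bundle isomorphism induced by a Riemannian metric $(\cdot,\cdot)$ is $g(X)=(\cdot,X)$. The components of $\mathscr{P}$ are given by $\mathscr{P}(\partial_{x^j})=\sum_l{\mathscr{P}^l}_j\,\partial_{x^l}$. The Hamiltonian on $T^*M$ is $H(x,p)=\frac12\langle\beta(p),\beta(p)\rangle_x=\frac12\sum_{i,j}\beta^{ij}(x)p_ip_j$; $\Phi_t(x,p)=(x(t),p(t))$ is the solution of $\dot x^i=\partial H/\partial p_i$, $\dot p_i=-\partial H/\partial x^i$ with $x(0)=x$, $p(0)=p$ (defined for all $t\ge0$ when $M$ is complete for $d_{CC}$), and $f(\Phi_t(x,p))$ means $f(x(t))$. With $\mathcal{S}^{\mathcal{H}}_x=\{X\in\mathcal{H}_x:\langle X,X\rangle_x=1\}$ and $\mathbb{U}_x$ the rotationally invariant probability measure on it, $$\mathcal{L}^{\mathcal{V}}f(x)=\int_{\mathcal{S}^{\mathcal{H}}_x}\frac{d^2}{dt^2}\Big|_{t=0}f\big(\Phi_t(x,g^{\mathcal{V}}(X))\big)\,\mathbb{U}_x(dX).$$ The horizontal gradient $\operatorname{grad}_{\mathcal{H}}f$ is the horizontal vector field with $\langle\operatorname{grad}_{\mathcal{H}}f,X\rangle=X(f)$ for all $X\in\mathcal{H}$. For a volume form $\omega$ locally $\omega=\tau\,dx^1\wedge\cdots\wedge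 dx^d$ with $\tau>0$ smooth (positively oriented charts), $\operatorname{div}^{\omega}(X)=\sum_i\big(\frac{X^i}{\tau}\frac{\partial\tau}{\partial x^i}+\frac{\partial X^i}{\partial x^i}\big)$, i.e. $\mathscr{L}_X\omega=\operatorname{div}^{\omega}(X)\,\omega$, where $\mathscr{L}_X$ is the Lie derivative along $X$.
   Formalization: The final sufficient condition is required in a covering family of positively oriented coordinates closed under linear changes of positive determinant; in one fixed coordinate system it fails (Euclidean plane, ω = e^{x−y} dx∧dy). *)

theory Defs
  imports "HOL-Analysis.Analysis"
begin

section \<open>Smooth maps between Euclidean spaces\<close>

text \<open>Continuous differentiability of order \<open>k\<close> on an open set, through iterated directional
  derivatives.\<close>

primrec Ck_on :: "nat \<Rightarrow> 'a::real_normed_vector set \<Rightarrow> ('a \<Rightarrow> 'b::real_normed_vector) \<Rightarrow> bool" where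
  "Ck_on 0 S f \<longleftrightarrow> continuous_on S f"
| "Ck_on (Suc k) S f \<longleftrightarrow>
     (\<forall>x\<in>S. f differentiable (at x)) \<and> (\<forall>v. Ck_on k S (\<lambda>x. frechet_derivative f (at x) v))"

definition smooth_on :: "'a::real_normed_vector set \<Rightarrow> ('a \<Rightarrow> 'b::real_normed_vector) \<Rightarrow> bool" where
  "smooth_on S f \<longleftrightarrow> (\<forall>k. Ck_on k S f)"


section \<open>Smooth manifolds\<close>

text \<open>A manifold is a whole type with a maximal smooth atlas; its dimension is
  \<open>CARD('n)\<close>. A chart is an open domain together with a coordinate map, whose values off the
  domain are irrelevant.\<close>

type_synonym ('a, 'n) chart = "'a set \<times> ('a \<Rightarrow> real ^ 'n)"

abbreviation cdom :: "('a, 'n) chart \<Rightarrow> 'a set" where "cdom \<equiv> fst"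
abbreviation cmap :: "('a, 'n) chart \<Rightarrow> 'a \<Rightarrow> real ^ 'n" where "cmap \<equiv> snd"

definition cinv :: "('a, 'n) chart \<Rightarrow> real ^ 'n \<Rightarrow> 'a" where
  "cinv c = inv_into (cdom c) (cmap c)"

definition is_chart :: "('a::topological_space, 'n::finite) chart \<Rightarrow> bool" where
  "is_chart c \<longleftrightarrow> open (cdom c) \<and> open (cmap c ` cdom c) \<and>
     homeomorphism (cdom c) (cmap c ` cdom c) (cmap c) (cinv c)"

definition compatible :: "('a, 'n::finite) chart \<Rightarrow> ('a, 'n) chart \<Rightarrow> bool" where
  "compatible c c' \<longleftrightarrow>
     smooth_on (cmap c ` (cdom c \<inter> cdom c')) (cmap c' \<circ> cinv c) \<and>
     smooth_on (cmap c' ` (cdom c \<inter> cdom c')) (cmap c \<circ> cinv c')"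

definition smooth_structure :: "('a::topological_space, 'n::finite) chart set \<Rightarrow> bool" where
  "smooth_structure A \<longleftrightarrow>
     (\<forall>c\<in>A. is_chart c) \<and> (\<Union>c\<in>A. cdom c) = UNIV \<and> (\<forall>c\<in>A. \<forall>c'\<in>A. compatible c c') \<and>
     (\<forall>c. is_chart c \<and> (\<forall>c'\<in>A. compatible c c') \<longrightarrow> c \<in> A)"

definition smooth_fun_on :: "('a, 'n::finite) chart set \<Rightarrow> 'a set \<Rightarrow> ('a \<Rightarrow> real) \<Rightarrow> bool" where
  "smooth_fun_on A U f \<longleftrightarrow> (\<forall>c\<in>A. smooth_on (cmap c ` (U \<inter> cdom c)) (f \<circ> cinv c))"

definition pdiff :: "('a, 'n::finite) chart \<Rightarrow> 'n \<Rightarrow> ('a \<Rightarrow> real) \<Rightarrow> 'a \<Rightarrow> real" where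
  "pdiff c l f q = frechet_derivative (f \<circ> cinv c) (at (cmap c q)) (axis l 1)"

text \<open>A tangent vector at \<open>q\<close> is a family of components, one tuple for each chart around \<open>q\<close>, that
  transform into each other by the Jacobians of the coordinate changes. Such a family is determined
  by, and may be prescribed freely at, one chart around \<open>q\<close>. We therefore fix a reference chart
  around every point and let a vector of \<open>T\<^sub>qM\<close> be given by its components in the reference chart
  at \<open>q\<close>, so that \<open>T\<^sub>qM\<close> is the type \<open>real ^ 'n\<close> with its vector space structure.
  All geometric notions below are read off through \<open>tcomp\<close>, \<open>tbasis\<close> and \<open>dcoord\<close>.
  A covector at \<open>q\<close> is a linear functional on \<open>T\<^sub>qM\<close>.\<close>

type_synonym 'n covec = "(real ^ 'n) \<Rightarrow>\<^sub>L real"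

definition ref_chart :: "('a, 'n) chart set \<Rightarrow> 'a \<Rightarrow> ('a, 'n) chart" where
  "ref_chart A q = (SOME c. c \<in> A \<and> q \<in> cdom c)"

definition tcomp :: "('a, 'n::finite) chart set \<Rightarrow> ('a, 'n) chart \<Rightarrow> 'a \<Rightarrow> real ^ 'n \<Rightarrow> real ^ 'n" where
  \<comment> \<open>components in the chart \<open>c\<close> of the tangent vector \<open>v\<close> at \<open>q\<close>\<close>
  "tcomp A c q v =
     frechet_derivative (cmap c \<circ> cinv (ref_chart A q)) (at (cmap (ref_chart A q) q)) v"

definition tbasis :: "('a, 'n::finite) chart set \<Rightarrow> ('a, 'n) chart \<Rightarrow> 'n \<Rightarrow> 'a \<Rightarrow> real ^ 'n" where
  \<comment> \<open>the coordinate vector \<open>\<partial>/\<partial>x\<^sup>i\<close> at \<open>q\<close>\<close>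
  "tbasis A c i q =
     frechet_derivative (cmap (ref_chart A q) \<circ> cinv c) (at (cmap c q)) (axis i 1)"

definition dcoord :: "('a, 'n::finite) chart set \<Rightarrow> ('a, 'n) chart \<Rightarrow> 'n \<Rightarrow> 'a \<Rightarrow> 'n covec" where
  \<comment> \<open>the covector \<open>dx\<^sup>i\<close> at \<open>q\<close>\<close>
  "dcoord A c i q = Blinfun (\<lambda>v. tcomp A c q v $ i)"

definition ccomp :: "('a, 'n::finite) chart set \<Rightarrow> ('a, 'n) chart \<Rightarrow> 'a \<Rightarrow> 'n covec \<Rightarrow> real ^ 'n" where
  \<comment> \<open>components \<open>p\<^sub>i\<close> of a covector at \<open>q\<close>\<close>
  "ccomp A c q p = (\<chi> i. blinfun_apply p (tbasis A c i q))"

definition ddir :: "('a, 'n::finite) chart set \<Rightarrow> ('a \<Rightarrow> real) \<Rightarrow> 'a \<Rightarrow> real ^ 'n \<Rightarrow> real" where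
  \<comment> \<open>\<open>v(f)\<close> for a tangent vector \<open>v\<close> at \<open>q\<close>\<close>
  "ddir A f q v = frechet_derivative (f \<circ> cinv (ref_chart A q)) (at (cmap (ref_chart A q) q)) v"

definition smooth_vf_on :: "('a, 'n::finite) chart set \<Rightarrow> 'a set \<Rightarrow> ('a \<Rightarrow> real ^ 'n) \<Rightarrow> bool" where
  "smooth_vf_on A U X \<longleftrightarrow>
     (\<forall>c\<in>A. smooth_on (cmap c ` (U \<inter> cdom c)) (\<lambda>y. tcomp A c (cinv c y) (X (cinv c y))))"

definition lie_bracket ::
  "('a, 'n::finite) chart set \<Rightarrow> ('a \<Rightarrow> real ^ 'n) \<Rightarrow> ('a \<Rightarrow> real ^ 'n) \<Rightarrow> 'a \<Rightarrow> real ^ 'n" where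
  \<comment> \<open>\<open>\<Sum>\<^sub>j X\<^sup>j \<partial>\<^sub>jY\<^sup>i - Y\<^sup>j \<partial>\<^sub>jX\<^sup>i\<close>, in the reference chart at \<open>q\<close>\<close>
  "lie_bracket A X Y q =
     (let c = ref_chart A q; y = cmap c q;
          Xc = (\<lambda>y. tcomp A c (cinv c y) (X (cinv c y)));
          Yc = (\<lambda>y. tcomp A c (cinv c y) (Y (cinv c y)))
      in frechet_derivative Yc (at y) (Xc y) - frechet_derivative Xc (at y) (Yc y))"


section \<open>Sub-bundles, metrics, sub-Riemannian manifolds\<close>

definition subbundle ::
  "('a::topological_space, 'n::finite) chart set \<Rightarrow> nat \<Rightarrow> ('a \<Rightarrow> (real ^ 'n) set) \<Rightarrow> bool" where
  "subbundle A m H \<longleftrightarrow>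
     (\<forall>q. subspace (H q) \<and> dim (H q) = m) \<and>
     (\<forall>q. \<exists>U X. open U \<and> q \<in> U \<and> (\<forall>i<m. smooth_vf_on A U (X i)) \<and>
        (\<forall>q'\<in>U. H q' = span ((\<lambda>i. X i q') ` {..<m})))"

text \<open>An inner product on the fibres of \<open>H\<close>; only the values on \<open>H q\<close> matter.\<close>

definition fibre_metric ::
  "('a::topological_space, 'n::finite) chart set \<Rightarrow> ('a \<Rightarrow> (real ^ 'n) set) \<Rightarrow>
     ('a \<Rightarrow> real ^ 'n \<Rightarrow> real ^ 'n \<Rightarrow> real) \<Rightarrow> bool" where
  "fibre_metric A H ip \<longleftrightarrow>
     (\<forall>q. \<forall>u\<in>H q. \<forall>v\<in>H q. \<forall>w\<in>H q. \<forall>a b.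
        ip q (a *\<^sub>R u + b *\<^sub>R v) w = a * ip q u w + b * ip q v w) \<and>
     (\<forall>q. \<forall>u\<in>H q. \<forall>v\<in>H q. ip q u v = ip q v u) \<and>
     (\<forall>q. \<forall>u\<in>H q. u \<noteq> 0 \<longrightarrow> ip q u u > 0) \<and>
     (\<forall>U X Y. open U \<and> smooth_vf_on A U X \<and> smooth_vf_on A U Y \<and>
        (\<forall>q\<in>U. X q \<in> H q \<and> Y q \<in> H q) \<longrightarrow> smooth_fun_on A U (\<lambda>q. ip q (X q) (Y q)))"

abbreviation riemannian_metric ::
  "('a::topological_space, 'n::finite) chart set \<Rightarrow>
     ('a \<Rightarrow> real ^ 'n \<Rightarrow> real ^ 'n \<Rightarrow> real) \<Rightarrow> bool" where
  "riemannian_metric A G \<equiv> fibre_metric A (\<lambda>_. UNIV) G"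

inductive_set iterated_brackets ::
  "('a, 'n::finite) chart set \<Rightarrow> ('a \<Rightarrow> (real ^ 'n) set) \<Rightarrow> ('a \<Rightarrow> real ^ 'n) set"
  for A H where
  horizontal: "smooth_vf_on A UNIV X \<Longrightarrow> (\<And>q. X q \<in> H q) \<Longrightarrow> X \<in> iterated_brackets A H"
| bracket: "X \<in> iterated_brackets A H \<Longrightarrow> Y \<in> iterated_brackets A H \<Longrightarrow>
    lie_bracket A X Y \<in> iterated_brackets A H"

definition hoermander :: "('a, 'n::finite) chart set \<Rightarrow> ('a \<Rightarrow> (real ^ 'n) set) \<Rightarrow> bool" where
  "hoermander A H \<longleftrightarrow> (\<forall>q. span {X q |X. X \<in> iterated_brackets A H} = UNIV)"

text \<open>Since \<open>CARD('n) > 0\<close>, Hoermander's condition forces \<open>m > 0\<close>.\<close>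

definition sub_riemannian ::
  "('a::{t2_space,second_countable_topology}, 'n::finite) chart set \<Rightarrow>
     ('a \<Rightarrow> (real ^ 'n) set) \<Rightarrow> ('a \<Rightarrow> real ^ 'n \<Rightarrow> real ^ 'n \<Rightarrow> real) \<Rightarrow> nat \<Rightarrow> bool" where
  "sub_riemannian A H ip m \<longleftrightarrow>
     smooth_structure A \<and> connected (UNIV :: 'a set) \<and>
     subbundle A m H \<and> hoermander A H \<and> fibre_metric A H ip"

definition vertical_distribution ::
  "('a::topological_space, 'n::finite) chart set \<Rightarrow> ('a \<Rightarrow> (real ^ 'n) set) \<Rightarrow>
     ('a \<Rightarrow> (real ^ 'n) set) \<Rightarrow> bool" where
  "vertical_distribution A H V \<longleftrightarrow>
     (\<exists>k. subbundle A k V) \<and>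
     (\<forall>q. H q \<inter> V q = {0} \<and> {u + v |u v. u \<in> H q \<and> v \<in> V q} = UNIV)"


section \<open>The Carnot-Caratheodory metric\<close>

definition velocity :: "('a, 'n::finite) chart set \<Rightarrow> (real \<Rightarrow> 'a) \<Rightarrow> real \<Rightarrow> real ^ 'n" where
  "velocity A \<sigma> t = vector_derivative (cmap (ref_chart A (\<sigma> t)) \<circ> \<sigma>) (at t)"

text \<open>Continuous, piecewise continuously differentiable curves, tangent to \<open>H\<close> off the
  break points (as in \<open>piecewise_C1_differentiable_on\<close>), with finite energy.\<close>

definition horizontal_curve ::
  "('a::topological_space, 'n::finite) chart set \<Rightarrow> ('a \<Rightarrow> (real ^ 'n) set) \<Rightarrow>
     ('a \<Rightarrow> real ^ 'n \<Rightarrow> real ^ 'n \<Rightarrow> real) \<Rightarrow> (real \<Rightarrow> 'a) \<Rightarrow> bool" where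
  "horizontal_curve A H ip \<sigma> \<longleftrightarrow>
     continuous_on {0..1} \<sigma> \<and>
     (\<exists>S. finite S \<and>
        (\<forall>c\<in>A. (cmap c \<circ> \<sigma>) C1_differentiable_on {t \<in> {0<..<1} - S. \<sigma> t \<in> cdom c}) \<and>
        (\<forall>t\<in>{0<..<1} - S. velocity A \<sigma> t \<in> H (\<sigma> t))) \<and>
     (\<lambda>t. ip (\<sigma> t) (velocity A \<sigma> t) (velocity A \<sigma> t)) integrable_on {0..1}"

definition cc_dist ::
  "('a::topological_space, 'n::finite) chart set \<Rightarrow> ('a \<Rightarrow> (real ^ 'n) set) \<Rightarrow>
     ('a \<Rightarrow> real ^ 'n \<Rightarrow> real ^ 'n \<Rightarrow> real) \<Rightarrow> 'a \<Rightarrow> 'a \<Rightarrow> real" where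
  "cc_dist A H ip x y =
     Inf {sqrt (integral {0..1} (\<lambda>t. ip (\<sigma> t) (velocity A \<sigma> t) (velocity A \<sigma> t))) |\<sigma>.
            horizontal_curve A H ip \<sigma> \<and> \<sigma> 0 = x \<and> \<sigma> 1 = y}"


section \<open>The bundle maps and their components\<close>

definition cometric ::
  "('a \<Rightarrow> (real ^ 'n::finite) set) \<Rightarrow> ('a \<Rightarrow> real ^ 'n \<Rightarrow> real ^ 'n \<Rightarrow> real) \<Rightarrow>
     'a \<Rightarrow> 'n covec \<Rightarrow> real ^ 'n" where
  "cometric H ip q =
     (THE \<beta>. linear \<beta> \<and>
        (\<forall>p p'. blinfun_apply p (\<beta> p') = blinfun_apply p' (\<beta> p)) \<and>
        (\<forall>p. blinfun_apply p (\<beta> p) \<ge> 0) \<and>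
        range \<beta> = H q \<and>
        (\<forall>p. \<forall>X\<in>H q. ip q (\<beta> p) X = blinfun_apply p X))"

definition vertical_cometric ::
  "('a \<Rightarrow> (real ^ 'n::finite) set) \<Rightarrow> ('a \<Rightarrow> real ^ 'n \<Rightarrow> real ^ 'n \<Rightarrow> real) \<Rightarrow>
     ('a \<Rightarrow> (real ^ 'n) set) \<Rightarrow> 'a \<Rightarrow> real ^ 'n \<Rightarrow> 'n covec" where
  \<comment> \<open>the bundle map \<open>g\<^sup>V\<close>\<close>
  "vertical_cometric H ip V q =
     (THE \<gamma>. linear \<gamma> \<and>
        (\<forall>X Y. blinfun_apply (\<gamma> X) Y = blinfun_apply (\<gamma> Y) X) \<and>
        (\<forall>X. blinfun_apply (\<gamma> X) X \<ge> 0) \<and>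
        (\<forall>X\<in>H q. cometric H ip q (\<gamma> X) = X) \<and>
        (\<forall>Y\<in>V q. \<gamma> Y = 0))"

definition flat :: "('a \<Rightarrow> real ^ 'n \<Rightarrow> real ^ 'n \<Rightarrow> real) \<Rightarrow> 'a \<Rightarrow> real ^ 'n::finite \<Rightarrow> 'n covec" where
  \<comment> \<open>the bundle isomorphism \<open>g\<close> induced by a Riemannian metric\<close>
  "flat G q X = Blinfun (\<lambda>Y. G q Y X)"

definition \<beta>_comp ::
  "('a, 'n::finite) chart set \<Rightarrow> ('a \<Rightarrow> (real ^ 'n) set) \<Rightarrow>
     ('a \<Rightarrow> real ^ 'n \<Rightarrow> real ^ 'n \<Rightarrow> real) \<Rightarrow> ('a, 'n) chart \<Rightarrow> 'n \<Rightarrow> 'n \<Rightarrow> 'a \<Rightarrow> real" where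
  "\<beta>_comp A H ip c i j q =
     blinfun_apply (dcoord A c i q) (cometric H ip q (dcoord A c j q))"

definition gV_comp ::
  "('a, 'n::finite) chart set \<Rightarrow> ('a \<Rightarrow> (real ^ 'n) set) \<Rightarrow>
     ('a \<Rightarrow> real ^ 'n \<Rightarrow> real ^ 'n \<Rightarrow> real) \<Rightarrow> ('a \<Rightarrow> (real ^ 'n) set) \<Rightarrow>
     ('a, 'n) chart \<Rightarrow> 'n \<Rightarrow> 'n \<Rightarrow> 'a \<Rightarrow> real" where
  "gV_comp A H ip V c i j q =
     blinfun_apply (vertical_cometric H ip V q (tbasis A c j q)) (tbasis A c i q)"

definition P_comp ::
  "('a, 'n::finite) chart set \<Rightarrow> ('a \<Rightarrow> (real ^ 'n) set) \<Rightarrow>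
     ('a \<Rightarrow> real ^ 'n \<Rightarrow> real ^ 'n \<Rightarrow> real) \<Rightarrow> ('a \<Rightarrow> real ^ 'n \<Rightarrow> real ^ 'n \<Rightarrow> real) \<Rightarrow>
     ('a, 'n) chart \<Rightarrow> 'n \<Rightarrow> 'n \<Rightarrow> 'a \<Rightarrow> real" where
  \<comment> \<open>\<open>P\<^sup>l\<^sub>j\<close> for \<open>P = \<beta> \<circ> g\<close>\<close>
  "P_comp A H ip G c l j q =
     blinfun_apply (dcoord A c l q) (cometric H ip q (flat G q (tbasis A c j q)))"


section \<open>Hamiltonian flow and the operator of the vertical distribution\<close>

definition hamiltonian ::
  "('a \<Rightarrow> (real ^ 'n::finite) set) \<Rightarrow> ('a \<Rightarrow> real ^ 'n \<Rightarrow> real ^ 'n \<Rightarrow> real) \<Rightarrow>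
     'a \<Rightarrow> 'n covec \<Rightarrow> real" where
  "hamiltonian H ip q p = ip q (cometric H ip q p) (cometric H ip q p) / 2"

definition hamiltonian_in_chart ::
  "('a, 'n::finite) chart set \<Rightarrow> ('a \<Rightarrow> (real ^ 'n) set) \<Rightarrow>
     ('a \<Rightarrow> real ^ 'n \<Rightarrow> real ^ 'n \<Rightarrow> real) \<Rightarrow> ('a, 'n) chart \<Rightarrow>
     real ^ 'n \<Rightarrow> real ^ 'n \<Rightarrow> real" where
  "hamiltonian_in_chart A H ip c y \<eta> =
     hamiltonian H ip (cinv c y) (\<Sum>i\<in>UNIV. \<eta> $ i *\<^sub>R dcoord A c i (cinv c y))"

definition hamilton_solution ::
  "('a::topological_space, 'n::finite) chart set \<Rightarrow> ('a \<Rightarrow> (real ^ 'n) set) \<Rightarrow>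
     ('a \<Rightarrow> real ^ 'n \<Rightarrow> real ^ 'n \<Rightarrow> real) \<Rightarrow> real set \<Rightarrow> (real \<Rightarrow> 'a \<times> 'n covec) \<Rightarrow> bool" where
  "hamilton_solution A H ip I \<gamma> \<longleftrightarrow>
     continuous_on I (\<lambda>s. fst (\<gamma> s)) \<and>
     (\<forall>t\<in>I. \<forall>c\<in>A. fst (\<gamma> t) \<in> cdom c \<longrightarrow>
        (let y = cmap c (fst (\<gamma> t)); \<eta> = ccomp A c (fst (\<gamma> t)) (snd (\<gamma> t)) in
          ((\<lambda>s. cmap c (fst (\<gamma> s))) has_vector_derivative
             (\<chi> i. frechet_derivative (\<lambda>\<eta>'. hamiltonian_in_chart A H ip c y \<eta>') (at \<eta>) (axis i 1)))
             (at t) \<and>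
          ((\<lambda>s. ccomp A c (fst (\<gamma> s)) (snd (\<gamma> s))) has_vector_derivative
             (\<chi> i. - frechet_derivative (\<lambda>y'. hamiltonian_in_chart A H ip c y' \<eta>) (at y) (axis i 1)))
             (at t)))"

text \<open>\<open>\<Phi>\<^sub>t(x,p)\<close>, the value at time \<open>t\<close> of the solution starting at \<open>(x,p)\<close>. Solutions are taken on
  open intervals around \<open>0\<close>, so that derivatives at \<open>t = 0\<close> are two-sided.\<close>

definition hamilton_flow ::
  "('a::topological_space, 'n::finite) chart set \<Rightarrow> ('a \<Rightarrow> (real ^ 'n) set) \<Rightarrow>
     ('a \<Rightarrow> real ^ 'n \<Rightarrow> real ^ 'n \<Rightarrow> real) \<Rightarrow> real \<Rightarrow> 'a \<times> 'n covec \<Rightarrow> 'a \<times> 'n covec" where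
  "hamilton_flow A H ip t w =
     (THE z. \<exists>a b \<gamma>. a < 0 \<and> 0 < b \<and> a < t \<and> t < b \<and>
        hamilton_solution A H ip {a<..<b} \<gamma> \<and> \<gamma> 0 = w \<and> \<gamma> t = z)"

definition unit_sphere ::
  "('a \<Rightarrow> (real ^ 'n) set) \<Rightarrow> ('a \<Rightarrow> real ^ 'n \<Rightarrow> real ^ 'n \<Rightarrow> real) \<Rightarrow> 'a \<Rightarrow> (real ^ 'n) set" where
  "unit_sphere H ip q = {X \<in> H q. ip q X X = 1}"

text \<open>Invariance is required under all linear isometries of \<open>H q\<close>; orientation preserving ones would
  not single out a measure when \<open>dim (H q) = 1\<close>.\<close>

definition rotation_invariant ::
  "('a \<Rightarrow> (real ^ 'n::finite) set) \<Rightarrow> ('a \<Rightarrow> real ^ 'n \<Rightarrow> real ^ 'n \<Rightarrow> real) \<Rightarrow> 'a \<Rightarrow>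
     (real ^ 'n) measure \<Rightarrow> bool" where
  "rotation_invariant H ip q \<mu> \<longleftrightarrow>
     (\<forall>R. linear R \<and> R ` H q = H q \<and> (\<forall>u\<in>H q. \<forall>v\<in>H q. ip q (R u) (R v) = ip q u v) \<longrightarrow>
        distr \<mu> \<mu> R = \<mu>)"

text \<open>There is exactly one such measure.\<close>

definition uniform_measure ::
  "('a \<Rightarrow> (real ^ 'n::finite) set) \<Rightarrow> ('a \<Rightarrow> real ^ 'n \<Rightarrow> real ^ 'n \<Rightarrow> real) \<Rightarrow> 'a \<Rightarrow>
     (real ^ 'n) measure" where
  "uniform_measure H ip q =
     (SOME \<mu>. space \<mu> = unit_sphere H ip q \<and>
        sets \<mu> = sets (restrict_space borel (unit_sphere H ip q)) \<and>
        emeasure \<mu> (space \<mu>) = 1 \<and> rotation_invariant H ip q \<mu>)"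

definition L_vertical ::
  "('a::topological_space, 'n::finite) chart set \<Rightarrow> ('a \<Rightarrow> (real ^ 'n) set) \<Rightarrow>
     ('a \<Rightarrow> real ^ 'n \<Rightarrow> real ^ 'n \<Rightarrow> real) \<Rightarrow> ('a \<Rightarrow> (real ^ 'n) set) \<Rightarrow>
     ('a \<Rightarrow> real) \<Rightarrow> 'a \<Rightarrow> real" where
  "L_vertical A H ip V f x =
     (\<integral>X. (deriv ^^ 2) (\<lambda>t. f (fst (hamilton_flow A H ip t (x, vertical_cometric H ip V x X)))) 0
        \<partial>uniform_measure H ip x)"


section \<open>Gradient, volume forms, divergence\<close>

definition grad_hor ::
  "('a, 'n::finite) chart set \<Rightarrow> ('a \<Rightarrow> (real ^ 'n) set) \<Rightarrow>
     ('a \<Rightarrow> real ^ 'n \<Rightarrow> real ^ 'n \<Rightarrow> real) \<Rightarrow> ('a \<Rightarrow> real) \<Rightarrow> 'a \<Rightarrow> real ^ 'n" where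
  "grad_hor A H ip f q = (THE v. v \<in> H q \<and> (\<forall>X\<in>H q. ip q v X = ddir A f q X))"

text \<open>An orientation is given by the set of all positively oriented charts.\<close>

definition same_orientation :: "('a, 'n::finite) chart \<Rightarrow> ('a, 'n) chart \<Rightarrow> bool" where
  "same_orientation c c' \<longleftrightarrow>
     (\<forall>q\<in>cdom c \<inter> cdom c'. det (jacobian (cmap c' \<circ> cinv c) (at (cmap c q))) > 0)"

definition orientation :: "('a, 'n::finite) chart set \<Rightarrow> ('a, 'n) chart set \<Rightarrow> bool" where
  "orientation A ori \<longleftrightarrow>
     ori \<subseteq> A \<and> (\<Union>c\<in>ori. cdom c) = UNIV \<and> (\<forall>c\<in>ori. \<forall>c'\<in>ori. same_orientation c c') \<and>
     (\<forall>c\<in>A. (\<forall>c'\<in>ori. same_orientation c c') \<longrightarrow> c \<in> ori)"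

text \<open>A form of top degree on \<open>real ^ 'n\<close> takes \<open>CARD('n)\<close> vectors, passed as the rows of a matrix.\<close>

definition top_form :: "(real ^ 'n ^ 'n::finite \<Rightarrow> real) \<Rightarrow> bool" where
  "top_form F \<longleftrightarrow>
     (\<forall>M i. linear (\<lambda>v. F (\<chi> k. if k = i then v else M $ k))) \<and>
     (\<forall>M i j. i \<noteq> j \<and> M $ i = M $ j \<longrightarrow> F M = 0)"

definition vol_density ::
  "('a, 'n::finite) chart set \<Rightarrow> ('a \<Rightarrow> real ^ 'n ^ 'n \<Rightarrow> real) \<Rightarrow> ('a, 'n) chart \<Rightarrow> 'a \<Rightarrow> real" where
  \<comment> \<open>the \<open>\<tau>\<close> with \<open>\<omega> = \<tau> dx\<^sup>1 \<and> \<dots> \<and> dx\<^sup>d\<close>\<close>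
  "vol_density A \<omega> c q = \<omega> q (\<chi> i. tbasis A c i q)"

definition volume_form ::
  "('a, 'n::finite) chart set \<Rightarrow> ('a, 'n) chart set \<Rightarrow> ('a \<Rightarrow> real ^ 'n ^ 'n \<Rightarrow> real) \<Rightarrow> bool" where
  "volume_form A ori \<omega> \<longleftrightarrow>
     (\<forall>q. top_form (\<omega> q)) \<and>
     (\<forall>c\<in>ori. smooth_on (cmap c ` cdom c) (vol_density A \<omega> c \<circ> cinv c) \<and>
        (\<forall>q\<in>cdom c. vol_density A \<omega> c q > 0))"

text \<open>The value of the local expression is the same in all positively oriented charts.\<close>

definition divergence ::
  "('a, 'n::finite) chart set \<Rightarrow> ('a, 'n) chart set \<Rightarrow> ('a \<Rightarrow> real ^ 'n ^ 'n \<Rightarrow> real) \<Rightarrow>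
     ('a \<Rightarrow> real ^ 'n) \<Rightarrow> 'a \<Rightarrow> real" where
  "divergence A ori \<omega> X q =
     (THE r. \<forall>c\<in>ori. q \<in> cdom c \<longrightarrow>
        r = (\<Sum>i\<in>UNIV. tcomp A c q (X q) $ i / vol_density A \<omega> c q * pdiff c i (vol_density A \<omega> c) q
               + pdiff c i (\<lambda>q'. tcomp A c q' (X q') $ i) q))"


section \<open>The conditions of the theorem\<close>

definition L_is_div_grad ::
  "('a::topological_space, 'n::finite) chart set \<Rightarrow> ('a, 'n) chart set \<Rightarrow>
     ('a \<Rightarrow> (real ^ 'n) set) \<Rightarrow> ('a \<Rightarrow> real ^ 'n \<Rightarrow> real ^ 'n \<Rightarrow> real) \<Rightarrow>
     ('a \<Rightarrow> (real ^ 'n) set) \<Rightarrow> nat \<Rightarrow> ('a \<Rightarrow> real ^ 'n ^ 'n \<Rightarrow> real) \<Rightarrow> bool" where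
  "L_is_div_grad A ori H ip V m \<omega> \<longleftrightarrow>
     (\<forall>f. smooth_fun_on A UNIV f \<longrightarrow>
        (\<forall>x. L_vertical A H ip V f x = 1 / real m * divergence A ori \<omega> (grad_hor A H ip f) x))"

text \<open>A family of positively oriented local coordinate systems that covers the manifold and contains
  with a coordinate system all those obtained from it by linear changes of positive determinant.
  The set of all positively oriented charts is one such family.

  The condition \<open>-1/2 \<Sum>\<^sub>i\<^sub>j\<^sub>l g\<^sub>i\<^sub>j \<partial>\<^sub>l\<beta>\<^sup>i\<^sup>j = 1/\<tau> \<Sum>\<^sub>l \<partial>\<^sub>l\<tau>\<close> only equates the sums of the components of two
  tuples that transform as covectors under linear changes of coordinates. Imposed in a single
  coordinate system it does not give equality of operators (on the Euclidean plane it holds for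
  \<open>\<omega> = exp (x - y) dx \<and> dy\<close> in the standard coordinates); imposed in all linearly related
  coordinate systems it equates the tuples themselves.\<close>

definition linearly_closed_coordinates ::
  "('a, 'n::finite) chart set \<Rightarrow> ('a, 'n) chart set \<Rightarrow> bool" where
  "linearly_closed_coordinates ori C \<longleftrightarrow>
     C \<subseteq> ori \<and> (\<Union>c\<in>C. cdom c) = UNIV \<and>
     (\<forall>c\<in>C. \<forall>B :: real ^ 'n ^ 'n. det B > 0 \<longrightarrow> (cdom c, \<lambda>q. B *v cmap c q) \<in> C)"

end

theory Submission
  imports Defs
begin

text \<open>In a chart the second derivative of \<open>f\<close> along the Hamiltonian curve issued from \<open>g\<^sup>V(X)\<close> is a
  quadratic form in \<open>X\<close>, because the position moves with velocity \<open>X\<close> and Hamilton's equations express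
  the acceleration by \<open>\<beta>\<close>, its derivatives and the momentum \<open>g\<^sup>V(X)\<close>. Reflections of the unit sphere show
  that the average of \<open>p(X) p'(X)\<close> is \<open>p(\<beta>(p')) / m\<close>. So \<open>m L\<^sup>V\<close> has the principal part
  \<open>\<Sum>\<^sub>i\<^sub>j \<beta>\<^sup>i\<^sup>j \<partial>\<^sub>i\<partial>\<^sub>j\<close> and a drift equal to the left-hand side of the system, while \<open>div grad\<close> has
  the same principal part and a drift equal to the right-hand side. Cut-off functions with arbitrary
  differential at a point turn the equality of operators into the equality of the drifts.

  The flow is only needed for small times, where existence and uniqueness follow from the
  Picard-Lindeloef theorem. Hamilton's equations have to be verified in
  all charts at once: this, like the independence of the divergence of the chart, rests on the symmetry of
  second derivatives of coordinate changes. For the sufficient condition, diagonal changes of coordinates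
  already separate the summands of the first equation.\<close>


section \<open>Calculus of smooth maps\<close>

text \<open>The cometric, \<open>vertical_cometric\<close>, the flow, the gradient and the
  divergence are definite descriptions, and the measure on the sphere is a choice. No formula for
  them is available before existence, and for the definite descriptions uniqueness, has been proved;
  most of the work goes into this. A second obstacle is the encoding of tangent vectors: the
  components stored at \<open>q\<close> refer to a reference chart chosen separately at each point,
  so a vector or covector field has no regularity as a raw function. Differentiation therefore
  always acts on components in one fixed chart. Two constructions are auxiliary. Local orthogonal
  frames turn the pointwise description of \<beta> into a formula from which smoothness can be read
  off. The measure on the unit sphere of a fibre of \<open>H\<close>, whose dimension
  \<open>m\<close> is not that of the ambient type, comes from Lebesgue measure on a ball of
  \<open>G\<close> by projecting to \<open>H\<close> and normalising; its invariance then reduces to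
  the fact that a linear map preserving a ball preserves Lebesgue measure.\<close>

lemma differentiable_has_frechet_derivative:
  "f differentiable (at x) \<Longrightarrow> (f has_derivative frechet_derivative f (at x)) (at x)"
  using frechet_derivative_works by blast

lemma Ck_on_cong:
  assumes "open S" "\<And>x. x \<in> S \<Longrightarrow> f x = g x" "Ck_on k S f"
  shows "Ck_on k S g"
  using assms(2,3)
proof (induction k arbitrary: f g)
  case 0
  then show ?case by (simp cong: continuous_on_cong)
next
  case (Suc k)
  have d: "f differentiable (at x)" if "x \<in> S" for x using Suc.prems(2) that by simp
  have e: "(g has_derivative frechet_derivative f (at x)) (at x)" if "x \<in> S" for x
    by (rule has_derivative_transform_within_open[OF
          differentiable_has_frechet_derivative[OF d[OF that]] \<open>open S\<close> that Suc.prems(1)])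
  have "frechet_derivative f (at x) = frechet_derivative g (at x)" if "x \<in> S" for x
    using e[OF that] frechet_derivative_at by blast
  then have "Ck_on k S (\<lambda>x. frechet_derivative g (at x) v)" for v
    using Suc.IH[of "\<lambda>x. frechet_derivative f (at x) v" "\<lambda>x. frechet_derivative g (at x) v"]
      Suc.prems(2) by simp
  then show ?case using e differentiableI by (metis Ck_on.simps(2))
qed

lemma Ck_on_Suc_imp: "Ck_on (Suc k) S f \<Longrightarrow> Ck_on k S f"
proof (induction k arbitrary: f)
  case 0
  then show ?case
    by (auto intro!: continuous_at_imp_continuous_on differentiable_imp_continuous_within)
next
  case (Suc k)
  then show ?case by (metis Ck_on.simps(2))
qed

text \<open>Derivatives are taken in the ambient space and not within \<open>S\<close>, so every
  order is a condition at single points; openness of \<open>T\<close> serves the continuity at order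
  zero.\<close>

lemma Ck_on_local:
  "(\<And>x. x \<in> S \<Longrightarrow> \<exists>T. open T \<and> x \<in> T \<and> Ck_on k T f) \<Longrightarrow> Ck_on k S f"
proof (induction k arbitrary: f)
  case 0
  then show ?case
    by (metis Ck_on.simps(1) continuous_at_imp_continuous_on continuous_on_eq_continuous_at)
next
  case (Suc k)
  have "f differentiable at x" if "x \<in> S" for x using Suc.prems[OF that] by auto
  moreover have "Ck_on k S (\<lambda>x. frechet_derivative f (at x) v)" for v
  proof (rule Suc.IH)
    show "\<exists>T. open T \<and> x \<in> T \<and> Ck_on k T (\<lambda>x. frechet_derivative f (at x) v)" if "x \<in> S" for x
      using Suc.prems[OF that] by auto
  qed
  ultimately show ?case by simp
qed

lemma Ck_on_const: "Ck_on k S (\<lambda>x. a)"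
  by (induction k arbitrary: a) auto

lemma Ck_on_bounded_linear_comp:
  assumes "open S" "bounded_linear L" "Ck_on k S f"
  shows "Ck_on k S (\<lambda>x. L (f x))"
  using assms(3)
proof (induction k arbitrary: f)
  case 0
  then show ?case
    using bounded_linear.continuous_on[OF assms(2), of S f] by simp
next
  case (Suc k)
  have e: "((\<lambda>x. L (f x)) has_derivative (\<lambda>v. L (frechet_derivative f (at x) v))) (at x)"
    if "x \<in> S" for x
    using Suc.prems that
    by (auto intro!: bounded_linear.has_derivative[OF assms(2)] differentiable_has_frechet_derivative)
  show ?case
  proof (simp, intro conjI ballI allI)
    fix v
    show "Ck_on k S (\<lambda>x. frechet_derivative (\<lambda>x. L (f x)) (at x) v)"
      by (rule Ck_on_cong[OF assms(1) _ Suc.IH[of "\<lambda>x. frechet_derivative f (at x) v"]])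
         (use Suc.prems in \<open>simp_all add: frechet_derivative_at[OF e, symmetric]\<close>)
  qed (use e differentiableI in blast)
qed

lemma Ck_on_add:
  assumes "open S" "Ck_on k S f" "Ck_on k S g"
  shows "Ck_on k S (\<lambda>x. f x + g x)"
  using assms(2,3)
proof (induction k arbitrary: f g)
  case 0
  then show ?case by (auto intro: continuous_on_add)
next
  case (Suc k)
  have e: "((\<lambda>x. f x + g x) has_derivative
      (\<lambda>v. frechet_derivative f (at x) v + frechet_derivative g (at x) v)) (at x)"
    if "x \<in> S" for x
    using Suc.prems that
    by (auto intro!: has_derivative_add differentiable_has_frechet_derivative)
  show ?case
  proof (simp, intro conjI ballI allI)
    fix v
    show "Ck_on k S (\<lambda>x. frechet_derivative (\<lambda>x. f x + g x) (at x) v)"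
      by (rule Ck_on_cong[OF assms(1) _
            Suc.IH[of "\<lambda>x. frechet_derivative f (at x) v" "\<lambda>x. frechet_derivative g (at x) v"]])
         (use Suc.prems in \<open>simp_all add: frechet_derivative_at[OF e, symmetric]\<close>)
  qed (use e differentiableI in blast)
qed

lemma Ck_on_bilinear:
  assumes "open S" "bounded_bilinear pr" "Ck_on k S f" "Ck_on k S g"
  shows "Ck_on k S (\<lambda>x. pr (f x) (g x))"
  using assms(3,4)
proof (induction k arbitrary: f g)
  case 0
  then show ?case using bounded_bilinear.continuous_on[OF assms(2), of S f g] by simp
next
  case (Suc k)
  have e: "((\<lambda>x. pr (f x) (g x)) has_derivative
      (\<lambda>v. pr (f x) (frechet_derivative g (at x) v) + pr (frechet_derivative f (at x) v) (g x))) (at x)"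
    if "x \<in> S" for x
    using Suc.prems that
    by (auto intro!: bounded_bilinear.FDERIV[OF assms(2)] differentiable_has_frechet_derivative)
  show ?case
  proof (simp, intro conjI ballI allI)
    fix v
    have "Ck_on k S (\<lambda>x. pr (f x) (frechet_derivative g (at x) v) + pr (frechet_derivative f (at x) v) (g x))"
      using Suc.prems Suc.prems[THEN Ck_on_Suc_imp]
      by (intro Ck_on_add[OF assms(1)] Suc.IH) auto
    then show "Ck_on k S (\<lambda>x. frechet_derivative (\<lambda>x. pr (f x) (g x)) (at x) v)"
      by (rule Ck_on_cong[OF assms(1), rotated])
         (use Suc.prems in \<open>simp_all add: frechet_derivative_at[OF e, symmetric]\<close>)
  qed (use e differentiableI in blast)
qed

lemma Ck_on_sum:
  assumes "open S" "\<And>i. i \<in> I \<Longrightarrow> Ck_on k S (f i)"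
  shows "Ck_on k S (\<lambda>x. \<Sum>i\<in>I. f i x)"
  using assms(2)
  by (induction I rule: infinite_finite_induct)
     (auto simp: Ck_on_const intro!: Ck_on_add[OF assms(1)])

lemma frechet_derivative_euclidean_sum:
  fixes g :: "'a::euclidean_space \<Rightarrow> 'b::real_normed_vector"
  assumes "g differentiable (at x)"
  shows "frechet_derivative g (at x) v = (\<Sum>b\<in>Basis. (v \<bullet> b) *\<^sub>R frechet_derivative g (at x) b)"
proof -
  have l: "linear (frechet_derivative g (at x))" using linear_frechet_derivative[OF assms] .
  have "frechet_derivative g (at x) v = frechet_derivative g (at x) (\<Sum>b\<in>Basis. (v \<bullet> b) *\<^sub>R b)"
    by (simp add: euclidean_representation)
  also have "\<dots> = (\<Sum>b\<in>Basis. (v \<bullet> b) *\<^sub>R frechet_derivative g (at x) b)"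
    using l by (simp add: linear_sum linear_cmul)
  finally show ?thesis .
qed

text \<open>\<open>Ck_on\<close> controls derivatives in fixed directions only, while the chain rule
  evaluates the derivative of \<open>g\<close> in the moving direction given by the derivative of
  \<open>f\<close>. Expanding this direction in the finite basis of the middle space leaves fixed
  directions, and the induction hypothesis applies to the partial derivatives of \<open>g\<close>
  with the same \<open>f\<close>.\<close>

lemma Ck_on_compose:
  fixes f :: "'a::real_normed_vector \<Rightarrow> 'b::euclidean_space" and g :: "'b \<Rightarrow> 'c::real_normed_vector"
  assumes "open S" "open T" "f ` S \<subseteq> T" "Ck_on k S f" "Ck_on k T g"
  shows "Ck_on k S (\<lambda>x. g (f x))"
  using assms(4,5)
proof (induction k arbitrary: g)
  case 0
  then show ?case using continuous_on_compose2[OF _ _ assms(3)] by auto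
next
  case (Suc k)
  have gd: "g differentiable (at (f x))" if "x \<in> S" for x using Suc.prems(2) assms(3) that by auto
  have e: "((\<lambda>x. g (f x)) has_derivative
      (\<lambda>v. frechet_derivative g (at (f x)) (frechet_derivative f (at x) v))) (at x)"
    if "x \<in> S" for x
    using diff_chain_at[of f "frechet_derivative f (at x)" x g] gd[OF that] Suc.prems(1) that
    by (simp add: differentiable_has_frechet_derivative o_def)
  show ?case
  proof (simp, intro conjI ballI allI)
    fix v
    have "Ck_on k S (\<lambda>x. \<Sum>b\<in>Basis. (frechet_derivative f (at x) v \<bullet> b) *\<^sub>R
        frechet_derivative g (at (f x)) b)"
    proof (intro Ck_on_sum assms(1) Ck_on_bilinear[OF assms(1) bounded_bilinear_scaleR])
      fix b :: 'b
      show "Ck_on k S (\<lambda>x. frechet_derivative f (at x) v \<bullet> b)"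
        using Suc.prems(1) by (intro Ck_on_bounded_linear_comp[OF assms(1) bounded_linear_inner_left]) auto
      show "Ck_on k S (\<lambda>x. frechet_derivative g (at (f x)) b)"
        by (rule Suc.IH) (use Suc.prems Ck_on_Suc_imp in auto)
    qed
    then show "Ck_on k S (\<lambda>x. frechet_derivative (\<lambda>x. g (f x)) (at x) v)"
      by (rule Ck_on_cong[OF assms(1), rotated])
        (simp add: frechet_derivative_at[OF e, symmetric] frechet_derivative_euclidean_sum[OF gd, symmetric])
  qed (use e differentiableI in blast)
qed

text \<open>The derivative of 1/f contains 1/f itself as a factor, so the induction hypothesis for
  the same \<open>f\<close> closes the step.\<close>

lemma Ck_on_inverse:
  fixes f :: "'a::real_normed_vector \<Rightarrow> real"
  assumes "open S" "Ck_on k S f" "\<And>x. x \<in> S \<Longrightarrow> f x \<noteq> 0"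
  shows "Ck_on k S (\<lambda>x. inverse (f x))"
  using assms(2)
proof (induction k)
  case 0
  then show ?case using assms(3) by (auto intro: continuous_on_inverse)
next
  case (Suc k)
  have e: "((\<lambda>x. inverse (f x)) has_derivative
      (\<lambda>v. - (inverse (f x) * frechet_derivative f (at x) v * inverse (f x)))) (at x)"
    if "x \<in> S" for x
    using Suc.prems that
    by (intro Deriv.has_derivative_inverse[where f = f and x = x] assms(3)[OF that] differentiable_has_frechet_derivative) auto
  show ?case
  proof (simp, intro conjI ballI allI)
    fix v
    have "Ck_on k S (\<lambda>x. inverse (f x) * frechet_derivative f (at x) v * inverse (f x))"
      using Suc.prems Suc.IH Ck_on_Suc_imp
      by (intro Ck_on_bilinear[OF assms(1) bounded_bilinear_mult]) auto
    then have "Ck_on k S (\<lambda>x. - (inverse (f x) * frechet_derivative f (at x) v * inverse (f x)))"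
      by (intro Ck_on_bounded_linear_comp[OF assms(1) bounded_linear_minus[OF bounded_linear_ident]])
    then show "Ck_on k S (\<lambda>x. frechet_derivative (\<lambda>x. inverse (f x)) (at x) v)"
      by (rule Ck_on_cong[OF assms(1), rotated])
         (use Suc.prems in \<open>simp_all add: frechet_derivative_at[OF e, symmetric]\<close>)
  qed (use e differentiableI in blast)
qed

lemma Ck_on_bounded_linear:
  assumes "bounded_linear L"
  shows "Ck_on k S L"
proof (cases k)
  case 0
  then show ?thesis using bounded_linear.continuous_on[OF assms continuous_on_id] by simp
next
  case (Suc j)
  then show ?thesis
    using frechet_derivative_at[OF bounded_linear_imp_has_derivative[OF assms], symmetric]
      differentiableI[OF bounded_linear_imp_has_derivative[OF assms]]
    by (simp add: Ck_on_const)
qed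

lemma smooth_on_cong: "open S \<Longrightarrow> (\<And>x. x \<in> S \<Longrightarrow> f x = g x) \<Longrightarrow> smooth_on S f \<Longrightarrow> smooth_on S g"
  unfolding smooth_on_def using Ck_on_cong by blast

lemma smooth_on_local:
  "(\<And>x. x \<in> S \<Longrightarrow> \<exists>T. open T \<and> x \<in> T \<and> smooth_on T f) \<Longrightarrow> smooth_on S f"
  unfolding smooth_on_def by (intro allI Ck_on_local) blast

lemma smooth_on_const: "smooth_on S (\<lambda>x. a)"
  unfolding smooth_on_def by (simp add: Ck_on_const)

lemma smooth_on_bounded_linear: "bounded_linear L \<Longrightarrow> smooth_on S L"
  unfolding smooth_on_def by (simp add: Ck_on_bounded_linear)

lemma smooth_on_bounded_linear_comp:
  "open S \<Longrightarrow> bounded_linear L \<Longrightarrow> smooth_on S f \<Longrightarrow> smooth_on S (\<lambda>x. L (f x))"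
  unfolding smooth_on_def by (simp add: Ck_on_bounded_linear_comp)

lemma smooth_on_add: "open S \<Longrightarrow> smooth_on S f \<Longrightarrow> smooth_on S g \<Longrightarrow> smooth_on S (\<lambda>x. f x + g x)"
  unfolding smooth_on_def by (simp add: Ck_on_add)

lemma smooth_on_minus: "open S \<Longrightarrow> smooth_on S f \<Longrightarrow> smooth_on S (\<lambda>x. - f x)"
  by (rule smooth_on_bounded_linear_comp[OF _ bounded_linear_minus[OF bounded_linear_ident]])

lemma smooth_on_diff: "open S \<Longrightarrow> smooth_on S f \<Longrightarrow> smooth_on S g \<Longrightarrow> smooth_on S (\<lambda>x. f x - g x)"
  using smooth_on_add[OF _ _ smooth_on_minus, of S f g] by simp

lemma smooth_on_scaleR:
  "open S \<Longrightarrow> smooth_on S f \<Longrightarrow> smooth_on S g \<Longrightarrow> smooth_on S (\<lambda>x. f x *\<^sub>R g x)"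
  unfolding smooth_on_def by (simp add: Ck_on_bilinear[OF _ bounded_bilinear_scaleR])

lemma smooth_on_mult:
  fixes f g :: "'a::real_normed_vector \<Rightarrow> real"
  shows "open S \<Longrightarrow> smooth_on S f \<Longrightarrow> smooth_on S g \<Longrightarrow> smooth_on S (\<lambda>x. f x * g x)"
  unfolding smooth_on_def by (simp add: Ck_on_bilinear[OF _ bounded_bilinear_mult])

lemma smooth_on_sum:
  "open S \<Longrightarrow> (\<And>i. i \<in> I \<Longrightarrow> smooth_on S (f i)) \<Longrightarrow> smooth_on S (\<lambda>x. \<Sum>i\<in>I. f i x)"
  unfolding smooth_on_def by (simp add: Ck_on_sum)

lemma smooth_on_divide:
  fixes f g :: "'a::real_normed_vector \<Rightarrow> real"
  assumes "open S" "smooth_on S f" "smooth_on S g" "\<And>x. x \<in> S \<Longrightarrow> g x \<noteq> 0"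
  shows "smooth_on S (\<lambda>x. f x / g x)"
  using assms unfolding smooth_on_def divide_inverse
  by (simp add: Ck_on_bilinear[OF _ bounded_bilinear_mult] Ck_on_inverse)

lemma smooth_on_compose:
  fixes f :: "'a::real_normed_vector \<Rightarrow> 'b::euclidean_space" and g :: "'b \<Rightarrow> 'c::real_normed_vector"
  assumes "open S" "open T" "f ` S \<subseteq> T" "smooth_on S f" "smooth_on T g"
  shows "smooth_on S (\<lambda>x. g (f x))"
  using assms unfolding smooth_on_def by (simp add: Ck_on_compose[of S T])

lemma smooth_on_differentiable: "smooth_on S f \<Longrightarrow> x \<in> S \<Longrightarrow> f differentiable (at x)"
  unfolding smooth_on_def by (metis Ck_on.simps(2))

lemma smooth_on_has_derivative:
  "smooth_on S f \<Longrightarrow> x \<in> S \<Longrightarrow> (f has_derivative frechet_derivative f (at x)) (at x)"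
  using smooth_on_differentiable frechet_derivative_works by blast

lemma smooth_on_frechet_derivative: "smooth_on S f \<Longrightarrow> smooth_on S (\<lambda>x. frechet_derivative f (at x) v)"
  unfolding smooth_on_def by (metis Ck_on.simps(2))

lemma smooth_on_continuous_on: "smooth_on S f \<Longrightarrow> continuous_on S f"
  unfolding smooth_on_def by (metis Ck_on.simps(1))

subsection \<open>Symmetry of second derivatives\<close>

text \<open>The second difference over a parallelogram, evaluated by the mean value theorem once in
  each direction. The bound on \<open>y\<close> makes the intermediate point tend to
  \<open>x\<close> with \<open>h\<close>.\<close>

lemma second_derivative_mvt:
  fixes f :: "'a::real_normed_vector \<Rightarrow> real"
  assumes "cball x r \<subseteq> S" "smooth_on S f" "0 < h" "h * (norm v + norm w) \<le> r"
  obtains y where "norm (y - x) \<le> h * (norm v + norm w)"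
    "f (x + h *\<^sub>R v + h *\<^sub>R w) - f (x + h *\<^sub>R v) - f (x + h *\<^sub>R w) + f x =
      h * h * frechet_derivative (\<lambda>z. frechet_derivative f (at z) v) (at y) w"
proof -
  let ?D = "\<lambda>z. frechet_derivative f (at z) v"
  have inS: "x + s *\<^sub>R v + t *\<^sub>R w \<in> S" and nrm: "norm (s *\<^sub>R v + t *\<^sub>R w) \<le> h * (norm v + norm w)"
    if "0 \<le> s" "s \<le> h" "0 \<le> t" "t \<le> h" for s t
  proof -
    have "norm (s *\<^sub>R v + t *\<^sub>R w) \<le> s * norm v + t * norm w"
      using norm_triangle_ineq[of "s *\<^sub>R v" "t *\<^sub>R w"] that by simp
    also have "\<dots> \<le> h * norm v + h * norm w"
      using that by (intro add_mono mult_right_mono) auto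
    finally show a: "norm (s *\<^sub>R v + t *\<^sub>R w) \<le> h * (norm v + norm w)" by (simp add: algebra_simps)
    have "dist x (x + s *\<^sub>R v + t *\<^sub>R w) = norm (s *\<^sub>R v + t *\<^sub>R w)"
      by (metis add.assoc add_diff_cancel_left' dist_commute dist_norm)
    then show "x + s *\<^sub>R v + t *\<^sub>R w \<in> S" using a assms(1,4) by (auto simp: subset_iff)
  qed
  \<comment> \<open>The zero multiple of \<open>w\<close> is kept so that both terms are instances
    of the two-parameter expression whose derivative is \<open>d1\<close>.\<close>
  define \<phi> where "\<phi> s = f (x + s *\<^sub>R v + h *\<^sub>R w) - f (x + s *\<^sub>R v + 0 *\<^sub>R w)" for s
  have d1: "((\<lambda>s. f (x + s *\<^sub>R v + t *\<^sub>R w)) has_real_derivative ?D (x + s *\<^sub>R v + t *\<^sub>R w)) (at s)"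
    if "0 \<le> s" "s \<le> h" "0 \<le> t" "t \<le> h" for s t
  proof -
    have "((\<lambda>s. x + s *\<^sub>R v + t *\<^sub>R w) has_derivative (\<lambda>d. d *\<^sub>R v)) (at s)"
      by (auto intro!: derivative_eq_intros)
    from diff_chain_at[OF this smooth_on_has_derivative[OF assms(2) inS[OF that]]]
    have "((\<lambda>s. f (x + s *\<^sub>R v + t *\<^sub>R w)) has_derivative
        (\<lambda>d. frechet_derivative f (at (x + s *\<^sub>R v + t *\<^sub>R w)) (d *\<^sub>R v))) (at s)"
      by (simp add: o_def)
    moreover have "(\<lambda>d. frechet_derivative f (at (x + s *\<^sub>R v + t *\<^sub>R w)) (d *\<^sub>R v))
        = (*) (?D (x + s *\<^sub>R v + t *\<^sub>R w))"
      using linear_cmul[OF linear_frechet_derivative[OF smooth_on_differentiable[OF assms(2) inS[OF that]]]]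
      by (auto simp: mult.commute)
    ultimately show ?thesis by (simp add: has_field_derivative_def)
  qed
  have "\<exists>s>0. s < h \<and> \<phi> h - \<phi> 0 = (h - 0) * (?D (x + s *\<^sub>R v + h *\<^sub>R w) - ?D (x + s *\<^sub>R v + 0 *\<^sub>R w))"
    using assms(3) unfolding \<phi>_def
    by (intro MVT2) (auto intro!: DERIV_diff d1[of _ h] d1[of _ 0, simplified])
  then obtain s where s: "0 < s" "s < h"
    "\<phi> h - \<phi> 0 = h * (?D (x + s *\<^sub>R v + h *\<^sub>R w) - ?D (x + s *\<^sub>R v + 0 *\<^sub>R w))" by auto
  have sm: "smooth_on S ?D" using assms(2) by (rule smooth_on_frechet_derivative)
  have d2: "((\<lambda>t. ?D (x + s *\<^sub>R v + t *\<^sub>R w)) has_real_derivative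
      frechet_derivative ?D (at (x + s *\<^sub>R v + t *\<^sub>R w)) w) (at t)"
    if "0 \<le> t" "t \<le> h" for t
  proof -
    have i: "x + s *\<^sub>R v + t *\<^sub>R w \<in> S" using inS s that by auto
    have "((\<lambda>t. x + s *\<^sub>R v + t *\<^sub>R w) has_derivative (\<lambda>d. d *\<^sub>R w)) (at t)"
      by (auto intro!: derivative_eq_intros)
    from diff_chain_at[OF this smooth_on_has_derivative[OF sm i]]
    have "((\<lambda>t. ?D (x + s *\<^sub>R v + t *\<^sub>R w)) has_derivative
        (\<lambda>d. frechet_derivative ?D (at (x + s *\<^sub>R v + t *\<^sub>R w)) (d *\<^sub>R w))) (at t)"
      by (simp add: o_def)
    moreover have "(\<lambda>d. frechet_derivative ?D (at (x + s *\<^sub>R v + t *\<^sub>R w)) (d *\<^sub>R w))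
        = (*) (frechet_derivative ?D (at (x + s *\<^sub>R v + t *\<^sub>R w)) w)"
      using linear_cmul[OF linear_frechet_derivative[OF smooth_on_differentiable[OF sm i]]]
      by (auto simp: mult.commute)
    ultimately show ?thesis by (simp add: has_field_derivative_def)
  qed
  have "\<exists>t>0. t < h \<and> ?D (x + s *\<^sub>R v + h *\<^sub>R w) - ?D (x + s *\<^sub>R v + 0 *\<^sub>R w)
     = (h - 0) * frechet_derivative ?D (at (x + s *\<^sub>R v + t *\<^sub>R w)) w"
    using assms(3) by (intro MVT2) (auto intro!: d2)
  then obtain t where t: "0 < t" "t < h" "?D (x + s *\<^sub>R v + h *\<^sub>R w) - ?D (x + s *\<^sub>R v + 0 *\<^sub>R w)
     = h * frechet_derivative ?D (at (x + s *\<^sub>R v + t *\<^sub>R w)) w" by auto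
  show ?thesis
  proof (rule that)
    show "norm ((x + s *\<^sub>R v + t *\<^sub>R w) - x) \<le> h * (norm v + norm w)"
      using nrm[of s t] s t by (simp add: algebra_simps)
    show "f (x + h *\<^sub>R v + h *\<^sub>R w) - f (x + h *\<^sub>R v) - f (x + h *\<^sub>R w) + f x =
      h * h * frechet_derivative ?D (at (x + s *\<^sub>R v + t *\<^sub>R w)) w"
      using s(3) t(3) by (simp add: \<phi>_def algebra_simps)
  qed
qed

text \<open>The second difference is symmetric in \<open>v\<close> and \<open>w\<close>. Hence the
  two mixed derivatives agree at two points close to \<open>x\<close>, and continuity carries the
  equality to \<open>x\<close> up to an arbitrary error.\<close>

lemma symmetric_second_derivative_real:
  fixes f :: "'a::real_normed_vector \<Rightarrow> real"
  assumes "open S" "x \<in> S" "smooth_on S f"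
  shows "frechet_derivative (\<lambda>z. frechet_derivative f (at z) v) (at x) w =
    frechet_derivative (\<lambda>z. frechet_derivative f (at z) w) (at x) v"
proof -
  let ?A = "\<lambda>y. frechet_derivative (\<lambda>z. frechet_derivative f (at z) v) (at y) w"
  let ?B = "\<lambda>y. frechet_derivative (\<lambda>z. frechet_derivative f (at z) w) (at y) v"
  obtain r where r: "0 < r" "cball x r \<subseteq> S" using assms open_contains_cball by blast
  have cA: "isCont ?A x" and cB: "isCont ?B x"
    using smooth_on_continuous_on[OF smooth_on_frechet_derivative[OF smooth_on_frechet_derivative[OF assms(3)]]]
      assms(1,2) continuous_on_eq_continuous_at by blast+
  have "\<bar>?A x - ?B x\<bar> \<le> 2 * e" if e: "0 < e" for e
  proof -
    obtain d1 where d1: "d1 > 0" "\<And>y. norm (y - x) < d1 \<Longrightarrow> \<bar>?A y - ?A x\<bar> < e"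
      using cA e unfolding continuous_at_eps_delta dist_norm real_norm_def by (metis dist_norm real_norm_def)
    obtain d2 where d2: "d2 > 0" "\<And>y. norm (y - x) < d2 \<Longrightarrow> \<bar>?B y - ?B x\<bar> < e"
      using cB e unfolding continuous_at_eps_delta dist_norm real_norm_def by (metis dist_norm real_norm_def)
    \<comment> \<open>The summand 1 keeps \<open>N\<close> positive when both vectors vanish; the
      factor 2 in \<open>h\<close> makes the displacements strictly smaller than \<open>d1\<close>
      and \<open>d2\<close>.\<close>
    define N where "N = norm v + norm w + 1"
    define h where "h = min r (min d1 d2) / (2 * N)"
    have N: "N > 0" unfolding N_def by (smt (verit) norm_ge_zero)
    have h: "h > 0" using N r d1 d2 unfolding h_def by simp
    have hN: "h * N = min r (min d1 d2) / 2" using N unfolding h_def by simp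
    have le: "h * (norm v + norm w) \<le> h * N" using h unfolding N_def by simp
    have hr: "h * (norm v + norm w) \<le> r" using le hN r d1 d2 by linarith
    obtain y where y: "norm (y - x) \<le> h * (norm v + norm w)"
      "f (x + h *\<^sub>R v + h *\<^sub>R w) - f (x + h *\<^sub>R v) - f (x + h *\<^sub>R w) + f x = h * h * ?A y"
      using second_derivative_mvt[OF r(2) assms(3) h hr] by metis
    obtain z where z: "norm (z - x) \<le> h * (norm w + norm v)"
      "f (x + h *\<^sub>R w + h *\<^sub>R v) - f (x + h *\<^sub>R w) - f (x + h *\<^sub>R v) + f x = h * h * ?B z"
      using second_derivative_mvt[OF r(2) assms(3) h, of w v] hr by (metis add.commute)
    have "h * h * ?A y = h * h * ?B z" using y(2) z(2) by (simp add: algebra_simps)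
    then have "?A y = ?B z" using h by simp
    moreover have "\<bar>?A y - ?A x\<bar> < e" "\<bar>?B z - ?B x\<bar> < e"
      using y(1) z(1) le hN r d1 d2 by (auto simp: add.commute intro!: d1(2) d2(2))
    ultimately show ?thesis by linarith
  qed
  then have *: "\<bar>?A x - ?B x\<bar> \<le> 2 * (e / 2)" if "0 < e" for e
    using that half_gt_zero by blast
  have "\<bar>?A x - ?B x\<bar> \<le> 0"
    by (rule field_le_epsilon) (use * in simp)
  then show ?thesis by simp
qed

lemma frechet_derivative_inner_left:
  assumes "f differentiable (at x)"
  shows "frechet_derivative (\<lambda>z. f z \<bullet> b) (at x) v = frechet_derivative f (at x) v \<bullet> b"
  using assms has_derivative_inner_left[of f "frechet_derivative f (at x)" "at x" b]
    frechet_derivative_at frechet_derivative_works by metis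

lemma symmetric_second_derivative:
  fixes f :: "'a::real_normed_vector \<Rightarrow> 'b::euclidean_space"
  assumes "open S" "x \<in> S" "smooth_on S f"
  shows "frechet_derivative (\<lambda>z. frechet_derivative f (at z) v) (at x) w =
    frechet_derivative (\<lambda>z. frechet_derivative f (at z) w) (at x) v"
proof (rule euclidean_eqI)
  fix b :: 'b
  have sb: "smooth_on S (\<lambda>z. f z \<bullet> b)"
    by (rule smooth_on_bounded_linear_comp[OF assms(1) bounded_linear_inner_left assms(3)])
  have *: "frechet_derivative (\<lambda>z. frechet_derivative f (at z) v) (at x) w \<bullet> b
    = frechet_derivative (\<lambda>z. frechet_derivative (\<lambda>z. f z \<bullet> b) (at z) v) (at x) w" for v w
  proof -
    have sd: "smooth_on S (\<lambda>z. frechet_derivative f (at z) v)"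
      by (rule smooth_on_frechet_derivative[OF assms(3)])
    have "frechet_derivative (\<lambda>z. frechet_derivative f (at z) v) (at x) w \<bullet> b
        = frechet_derivative (\<lambda>z. frechet_derivative f (at z) v \<bullet> b) (at x) w"
      using frechet_derivative_inner_left smooth_on_differentiable[OF sd assms(2)] by metis
    also have "\<dots> = frechet_derivative (\<lambda>z. frechet_derivative (\<lambda>z. f z \<bullet> b) (at z) v) (at x) w"
    proof -
      have "(\<lambda>z. frechet_derivative f (at z) v \<bullet> b) differentiable (at x)"
        using smooth_on_differentiable[OF smooth_on_bounded_linear_comp[OF assms(1) bounded_linear_inner_left sd] assms(2)] .
      then show ?thesis
        by (subst frechet_derivative_transform_within_open[OF _ assms(1,2)])
           (auto simp: frechet_derivative_inner_left smooth_on_differentiable[OF assms(3)])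
    qed
    finally show ?thesis .
  qed
  show "frechet_derivative (\<lambda>z. frechet_derivative f (at z) v) (at x) w \<bullet> b =
    frechet_derivative (\<lambda>z. frechet_derivative f (at z) w) (at x) v \<bullet> b"
    unfolding * by (rule symmetric_second_derivative_real[OF assms(1,2) sb])
qed

section \<open>Charts, tangent vectors and covectors\<close>

definition dtrans :: "('a, 'n::finite) chart \<Rightarrow> ('a, 'n) chart \<Rightarrow> 'a \<Rightarrow> real ^ 'n \<Rightarrow> real ^ 'n" where
  "dtrans c c' q = frechet_derivative (cmap c' \<circ> cinv c) (at (cmap c q))"

text \<open>The inverse of \<open>tcomp\<close>: the tangent vector with prescribed components in
  the chart \<open>c\<close>.\<close>

definition tvec :: "('a, 'n::finite) chart set \<Rightarrow> ('a, 'n) chart \<Rightarrow> 'a \<Rightarrow> real ^ 'n \<Rightarrow> real ^ 'n" where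
  "tvec A c q = dtrans c (ref_chart A q) q"

definition cform :: "('a, 'n::finite) chart set \<Rightarrow> ('a, 'n) chart \<Rightarrow> 'a \<Rightarrow> real ^ 'n \<Rightarrow> 'n covec" where
  "cform A c q \<eta> = (\<Sum>i\<in>UNIV. \<eta> $ i *\<^sub>R dcoord A c i q)"

definition vf_in :: "('a, 'n::finite) chart set \<Rightarrow> ('a, 'n) chart \<Rightarrow> ('a \<Rightarrow> real ^ 'n) \<Rightarrow> real ^ 'n \<Rightarrow> real ^ 'n" where
  "vf_in A c X = (\<lambda>y. tcomp A c (cinv c y) (X (cinv c y)))"

lemma vec_axis_sum: "(\<Sum>i\<in>UNIV. v $ i *\<^sub>R axis i 1) = (v :: real ^ 'n)"
  using basis_expansion[of v] by (simp add: scalar_mult_eq_scaleR)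

lemma frechet_derivative_axis_sum:
  fixes g :: "real ^ 'n \<Rightarrow> real"
  assumes "g differentiable (at y)"
  shows "frechet_derivative g (at y) v = (\<Sum>i\<in>UNIV. v $ i * frechet_derivative g (at y) (axis i 1))"
proof -
  have l: "linear (frechet_derivative g (at y))" using linear_frechet_derivative[OF assms] .
  have "frechet_derivative g (at y) v = frechet_derivative g (at y) (\<Sum>i\<in>UNIV. v $ i *\<^sub>R axis i 1)"
    by (simp add: vec_axis_sum)
  then show ?thesis using l by (simp add: linear_sum linear_cmul)
qed

locale smooth_manifold =
  fixes A :: "('a::{t2_space,second_countable_topology}, 'n::finite) chart set"
  assumes smooth_structure: "smooth_structure A"
begin

lemma is_chart: "c \<in> A \<Longrightarrow> is_chart c"
  using smooth_structure by (simp add: smooth_structure_def)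

lemma open_cdom: "c \<in> A \<Longrightarrow> open (cdom c)"
  using is_chart by (simp add: is_chart_def)

lemma open_cmap_cdom: "c \<in> A \<Longrightarrow> open (cmap c ` cdom c)"
  using is_chart by (simp add: is_chart_def)

lemma cinv_cmap: "c \<in> A \<Longrightarrow> q \<in> cdom c \<Longrightarrow> cinv c (cmap c q) = q"
  using is_chart homeomorphism_apply1 unfolding is_chart_def by blast

lemma cmap_cinv: "c \<in> A \<Longrightarrow> y \<in> cmap c ` cdom c \<Longrightarrow> cmap c (cinv c y) = y"
  using is_chart homeomorphism_apply2 unfolding is_chart_def by blast

lemma cinv_in: "c \<in> A \<Longrightarrow> y \<in> cmap c ` cdom c \<Longrightarrow> cinv c y \<in> cdom c"
  by (auto simp: cinv_cmap)

lemma continuous_on_cinv: "c \<in> A \<Longrightarrow> continuous_on (cmap c ` cdom c) (cinv c)"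
  using is_chart homeomorphism_cont2 unfolding is_chart_def by blast

lemma cmap_image_Int:
  assumes "c \<in> A"
  shows "cmap c ` (U \<inter> cdom c) = cmap c ` cdom c \<inter> cinv c -` U"
  using cinv_cmap[OF assms] by auto

lemma open_cmap_image:
  assumes "c \<in> A" "open U"
  shows "open (cmap c ` (U \<inter> cdom c))"
  unfolding cmap_image_Int[OF assms(1)]
  by (rule continuous_open_preimage[OF continuous_on_cinv open_cmap_cdom]) (use assms in auto)

lemma open_overlap: "c \<in> A \<Longrightarrow> c' \<in> A \<Longrightarrow> open (cmap c ` (cdom c \<inter> cdom c'))"
  using open_cmap_image[OF _ open_cdom] by (metis inf_commute)

lemma smooth_on_transition:
  "c \<in> A \<Longrightarrow> c' \<in> A \<Longrightarrow> smooth_on (cmap c ` (cdom c \<inter> cdom c')) (cmap c' \<circ> cinv c)"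
  using smooth_structure unfolding smooth_structure_def compatible_def by blast

lemma has_derivative_transition:
  "c \<in> A \<Longrightarrow> c' \<in> A \<Longrightarrow> q \<in> cdom c \<Longrightarrow> q \<in> cdom c' \<Longrightarrow>
    ((cmap c' \<circ> cinv c) has_derivative dtrans c c' q) (at (cmap c q))"
  unfolding dtrans_def by (rule smooth_on_has_derivative[OF smooth_on_transition]) auto

lemma bounded_linear_dtrans:
  "c \<in> A \<Longrightarrow> c' \<in> A \<Longrightarrow> q \<in> cdom c \<Longrightarrow> q \<in> cdom c' \<Longrightarrow> bounded_linear (dtrans c c' q)"
  using has_derivative_transition has_derivative_bounded_linear by blast

text \<open>The chain rule through the transition map. Since \<open>cinv\<close> is meaningful only
  on the image of a chart, the two sides are compared on the image of the overlap, which is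
  open.\<close>

lemma has_derivative_change_chart:
  assumes "c \<in> A" "c' \<in> A" "q \<in> cdom c" "q \<in> cdom c'"
    and "((f \<circ> cinv c) has_derivative f') (at (cmap c q))"
  shows "((f \<circ> cinv c') has_derivative (\<lambda>v. f' (dtrans c' c q v))) (at (cmap c' q))"
proof -
  have "(((f \<circ> cinv c) \<circ> (cmap c \<circ> cinv c')) has_derivative (f' \<circ> dtrans c' c q)) (at (cmap c' q))"
    using assms by (intro diff_chain_at has_derivative_transition) (simp_all add: cinv_cmap)
  then have "((f \<circ> cinv c') has_derivative (f' \<circ> dtrans c' c q)) (at (cmap c' q))"
    by (rule has_derivative_transform_within_open[OF _ open_overlap[of c' c]])
       (use assms in \<open>auto simp: cinv_cmap\<close>)
  then show ?thesis by (simp add: o_def)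
qed

text \<open>The cocycle rule for Jacobians. With the reference chart as one of the three charts it
  yields all relations between \<open>tcomp\<close>, \<open>tvec\<close> and \<open>dtrans\<close>
  below.\<close>

lemma dtrans_dtrans:
  assumes "c \<in> A" "c' \<in> A" "c'' \<in> A" "q \<in> cdom c" "q \<in> cdom c'" "q \<in> cdom c''"
  shows "dtrans c' c'' q (dtrans c c' q v) = dtrans c c'' q v"
  using frechet_derivative_at[OF has_derivative_change_chart[OF assms(2,1,5,4)
        has_derivative_transition[OF assms(2,3,5,6)]]]
  unfolding dtrans_def[of c c''] by metis

lemma dtrans_same:
  assumes "c \<in> A" "q \<in> cdom c"
  shows "dtrans c c q v = v"
proof -
  have "((\<lambda>y. y) has_derivative (\<lambda>v. v)) (at (cmap c q))" by (rule has_derivative_ident)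
  then have "((cmap c \<circ> cinv c) has_derivative (\<lambda>v. v)) (at (cmap c q))"
    by (rule has_derivative_transform_within_open[OF _ open_cmap_cdom[OF assms(1)]])
       (use assms in \<open>auto simp: cmap_cinv cinv_cmap\<close>)
  then show ?thesis unfolding dtrans_def using frechet_derivative_at by metis
qed

lemma dtrans_inverse:
  assumes "c \<in> A" "c' \<in> A" "q \<in> cdom c" "q \<in> cdom c'"
  shows "dtrans c' c q (dtrans c c' q v) = v"
  using dtrans_dtrans[of c c' c q v] dtrans_same assms by simp

lemma linear_dtrans:
  "c \<in> A \<Longrightarrow> c' \<in> A \<Longrightarrow> q \<in> cdom c \<Longrightarrow> q \<in> cdom c' \<Longrightarrow> linear (dtrans c c' q)"
  using bounded_linear_dtrans bounded_linear.linear by blast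

lemma chart_around: "\<exists>c\<in>A. q \<in> cdom c"
  using smooth_structure unfolding smooth_structure_def by blast

lemma ref_chart_in: "ref_chart A q \<in> A" and ref_chart_dom: "q \<in> cdom (ref_chart A q)"
  using someI_ex[of "\<lambda>c. c \<in> A \<and> q \<in> cdom c"] chart_around[of q] unfolding ref_chart_def by blast+

lemma tcomp_dtrans: "tcomp A c q = dtrans (ref_chart A q) c q"
  by (auto simp: tcomp_def dtrans_def)

lemma tbasis_tvec: "tbasis A c i q = tvec A c q (axis i 1)"
  by (simp add: tbasis_def tvec_def dtrans_def)

lemma linear_tcomp: "c \<in> A \<Longrightarrow> q \<in> cdom c \<Longrightarrow> linear (tcomp A c q)"
  unfolding tcomp_dtrans by (rule linear_dtrans) (auto simp: ref_chart_in ref_chart_dom)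

lemma linear_tvec: "c \<in> A \<Longrightarrow> q \<in> cdom c \<Longrightarrow> linear (tvec A c q)"
  unfolding tvec_def by (rule linear_dtrans) (auto simp: ref_chart_in ref_chart_dom)

lemma tcomp_tvec: "c \<in> A \<Longrightarrow> q \<in> cdom c \<Longrightarrow> tcomp A c q (tvec A c q u) = u"
  unfolding tcomp_dtrans tvec_def by (rule dtrans_inverse) (auto simp: ref_chart_in ref_chart_dom)

lemma tvec_tcomp: "c \<in> A \<Longrightarrow> q \<in> cdom c \<Longrightarrow> tvec A c q (tcomp A c q v) = v"
  unfolding tcomp_dtrans tvec_def by (rule dtrans_inverse) (auto simp: ref_chart_in ref_chart_dom)

lemma dtrans_tcomp:
  "c \<in> A \<Longrightarrow> c' \<in> A \<Longrightarrow> q \<in> cdom c \<Longrightarrow> q \<in> cdom c' \<Longrightarrow>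
    dtrans c c' q (tcomp A c q v) = tcomp A c' q v"
  unfolding tcomp_dtrans by (rule dtrans_dtrans) (auto simp: ref_chart_in ref_chart_dom)

lemma tvec_dtrans:
  "c \<in> A \<Longrightarrow> c' \<in> A \<Longrightarrow> q \<in> cdom c \<Longrightarrow> q \<in> cdom c' \<Longrightarrow>
    tvec A c' q (dtrans c c' q u) = tvec A c q u"
  unfolding tvec_def by (rule dtrans_dtrans) (auto simp: ref_chart_in ref_chart_dom)

lemma dcoord_apply:
  assumes "c \<in> A" "q \<in> cdom c"
  shows "blinfun_apply (dcoord A c i q) v = tcomp A c q v $ i"
proof -
  have "bounded_linear (\<lambda>v. tcomp A c q v $ i)"
    using linear_tcomp[OF assms] bounded_linear_compose[OF bounded_linear_vec_nth]
    by (simp add: linear_conv_bounded_linear)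
  then show ?thesis by (simp add: dcoord_def bounded_linear_Blinfun_apply)
qed

lemma covec_tvec:
  assumes "c \<in> A" "q \<in> cdom c"
  shows "blinfun_apply p (tvec A c q u) = ccomp A c q p \<bullet> u"
proof -
  have "tvec A c q u = tvec A c q (\<Sum>i\<in>UNIV. u $ i *\<^sub>R axis i 1)"
    by (simp add: vec_axis_sum)
  also have "\<dots> = (\<Sum>i\<in>UNIV. u $ i *\<^sub>R tbasis A c i q)"
    using linear_tvec[OF assms] by (simp add: linear_sum linear_cmul tbasis_tvec)
  finally show ?thesis
    by (simp add: blinfun.sum_right blinfun.scaleR_right ccomp_def inner_vec_def mult.commute)
qed

lemma covec_apply:
  assumes "c \<in> A" "q \<in> cdom c"
  shows "blinfun_apply p v = ccomp A c q p \<bullet> tcomp A c q v"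
  using covec_tvec[OF assms, of p "tcomp A c q v"] tvec_tcomp[OF assms] by simp

lemma cform_apply:
  assumes "c \<in> A" "q \<in> cdom c"
  shows "blinfun_apply (cform A c q \<eta>) v = \<eta> \<bullet> tcomp A c q v"
  by (simp add: cform_def blinfun.sum_left blinfun.scaleR_left dcoord_apply[OF assms] inner_vec_def)

lemma cform_ccomp:
  assumes "c \<in> A" "q \<in> cdom c"
  shows "cform A c q (ccomp A c q p) = p"
  by (rule blinfun_eqI) (simp add: cform_apply[OF assms] covec_apply[OF assms, of p])

lemma ccomp_cform:
  assumes "c \<in> A" "q \<in> cdom c"
  shows "ccomp A c q (cform A c q \<eta>) = \<eta>"
  by (simp add: vec_eq_iff ccomp_def cform_apply[OF assms] tbasis_tvec tcomp_tvec[OF assms] inner_axis)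

lemma ccomp_dtrans:
  assumes "c \<in> A" "c' \<in> A" "q \<in> cdom c" "q \<in> cdom c'"
  shows "ccomp A c' q p \<bullet> dtrans c c' q u = ccomp A c q p \<bullet> u"
  using covec_tvec[OF assms(2,4), of p "dtrans c c' q u"] covec_tvec[OF assms(1,3), of p u]
    tvec_dtrans[OF assms, of u] by simp

lemma ddir_chart:
  assumes "c \<in> A" "q \<in> cdom c" "(f \<circ> cinv c) differentiable (at (cmap c q))"
  shows "ddir A f q v = frechet_derivative (f \<circ> cinv c) (at (cmap c q)) (tcomp A c q v)"
  using frechet_derivative_at[OF has_derivative_change_chart[OF assms(1) ref_chart_in assms(2)
        ref_chart_dom differentiable_has_frechet_derivative[OF assms(3)]]]
  unfolding ddir_def tcomp_dtrans by metis

section \<open>Closure properties of smooth fields and functions\<close>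

lemma smooth_vf_on_vf_in: "smooth_vf_on A U X \<longleftrightarrow> (\<forall>c\<in>A. smooth_on (cmap c ` (U \<inter> cdom c)) (vf_in A c X))"
  by (simp add: smooth_vf_on_def vf_in_def)

lemma smooth_vf_on_add:
  assumes "open U" "smooth_vf_on A U X" "smooth_vf_on A U Y"
  shows "smooth_vf_on A U (\<lambda>q. X q + Y q)"
  unfolding smooth_vf_on_def
proof (intro ballI)
  fix c assume c: "c \<in> A"
  have "smooth_on (cmap c ` (U \<inter> cdom c)) (\<lambda>y. vf_in A c X y + vf_in A c Y y)"
    using assms c by (intro smooth_on_add open_cmap_image) (auto simp: smooth_vf_on_vf_in)
  then show "smooth_on (cmap c ` (U \<inter> cdom c)) (\<lambda>y. tcomp A c (cinv c y) (X (cinv c y) + Y (cinv c y)))"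
    by (rule smooth_on_cong[OF open_cmap_image[OF c assms(1)], rotated])
       (auto simp: vf_in_def cinv_cmap[OF c] linear_add[OF linear_tcomp[OF c]])
qed

lemma smooth_vf_on_scale:
  assumes "open U" "smooth_fun_on A U f" "smooth_vf_on A U X"
  shows "smooth_vf_on A U (\<lambda>q. f q *\<^sub>R X q)"
  unfolding smooth_vf_on_def
proof (intro ballI)
  fix c assume c: "c \<in> A"
  have "smooth_on (cmap c ` (U \<inter> cdom c)) (\<lambda>y. (f \<circ> cinv c) y *\<^sub>R vf_in A c X y)"
    using assms c by (intro smooth_on_scaleR open_cmap_image) (auto simp: smooth_vf_on_vf_in smooth_fun_on_def o_def)
  then show "smooth_on (cmap c ` (U \<inter> cdom c)) (\<lambda>y. tcomp A c (cinv c y) (f (cinv c y) *\<^sub>R X (cinv c y)))"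
    by (rule smooth_on_cong[OF open_cmap_image[OF c assms(1)], rotated])
       (auto simp: vf_in_def cinv_cmap[OF c] linear_cmul[OF linear_tcomp[OF c]])
qed

lemma smooth_fun_on_const: "smooth_fun_on A U (\<lambda>q. a)"
  by (auto simp: smooth_fun_on_def o_def smooth_on_const)

lemma smooth_vf_on_zero: "smooth_vf_on A U (\<lambda>q. 0)"
  unfolding smooth_vf_on_def
proof (intro ballI)
  fix c assume c: "c \<in> A"
  \<comment> \<open>Here \<open>U\<close> may fail to be open, so the argument passes to the whole
    chart domain, whose image is open and on which the representative is constantly zero.\<close>
  show "smooth_on (cmap c ` (U \<inter> cdom c)) (\<lambda>y. tcomp A c (cinv c y) 0)"
    by (rule smooth_on_local, rule exI[of _ "cmap c ` cdom c"], intro conjI,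
        rule open_cmap_cdom[OF c], blast,
        rule smooth_on_cong[OF open_cmap_cdom[OF c] _ smooth_on_const[of _ 0]])
       (auto simp: cinv_cmap[OF c] linear_0[OF linear_tcomp[OF c]])
qed

lemma smooth_vf_on_sum:
  assumes "open U" "\<And>i. i \<in> I \<Longrightarrow> smooth_vf_on A U (X i)"
  shows "smooth_vf_on A U (\<lambda>q. \<Sum>i\<in>I. X i q)"
  using assms(2)
  by (induction I rule: infinite_finite_induct) (auto simp: smooth_vf_on_zero intro!: smooth_vf_on_add[OF assms(1)])

lemma smooth_fun_on_divide:
  assumes "open U" "smooth_fun_on A U f" "smooth_fun_on A U g" "\<And>q. q \<in> U \<Longrightarrow> g q \<noteq> 0"
  shows "smooth_fun_on A U (\<lambda>q. f q / g q)"
  unfolding smooth_fun_on_def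
proof (intro ballI)
  fix c assume c: "c \<in> A"
  have "smooth_on (cmap c ` (U \<inter> cdom c)) (\<lambda>y. (f \<circ> cinv c) y / (g \<circ> cinv c) y)"
    using assms c by (intro smooth_on_divide open_cmap_image) (auto simp: smooth_fun_on_def cinv_cmap o_def)
  then show "smooth_on (cmap c ` (U \<inter> cdom c)) ((\<lambda>q. f q / g q) \<circ> cinv c)" by (simp add: o_def)
qed

end

section \<open>The cometric and the vertical distribution\<close>

locale sub_riemannian_manifold = smooth_manifold A
  for A :: "('a::{t2_space,second_countable_topology}, 'n::finite) chart set" +
  fixes H :: "'a \<Rightarrow> (real ^ 'n) set"
    and ip :: "'a \<Rightarrow> real ^ 'n \<Rightarrow> real ^ 'n \<Rightarrow> real"
    and m :: nat
  assumes subbundle: "subbundle A m H"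
    and hoermander: "hoermander A H"
    and fibre_metric: "fibre_metric A H ip"
begin

section \<open>The fibre metric as an inner product on \<open>H q\<close>\<close>

lemma subspace_H: "subspace (H q)" and dim_H: "dim (H q) = m"
  using subbundle by (auto simp: subbundle_def)

lemma ip_linear:
  "u \<in> H q \<Longrightarrow> v \<in> H q \<Longrightarrow> w \<in> H q \<Longrightarrow>
    ip q (a *\<^sub>R u + b *\<^sub>R v) w = a * ip q u w + b * ip q v w"
  using fibre_metric[unfolded fibre_metric_def, THEN conjunct1] by blast

lemma ip_sym: "u \<in> H q \<Longrightarrow> v \<in> H q \<Longrightarrow> ip q u v = ip q v u"
  using fibre_metric[unfolded fibre_metric_def, THEN conjunct2, THEN conjunct1] by blast

lemma ip_pos: "u \<in> H q \<Longrightarrow> u \<noteq> 0 \<Longrightarrow> ip q u u > 0"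
  using fibre_metric[unfolded fibre_metric_def, THEN conjunct2, THEN conjunct2, THEN conjunct1] by blast

lemma ip_smooth:
  "open U \<Longrightarrow> smooth_vf_on A U X \<Longrightarrow> smooth_vf_on A U Y \<Longrightarrow> (\<And>q. q \<in> U \<Longrightarrow> X q \<in> H q) \<Longrightarrow>
    (\<And>q. q \<in> U \<Longrightarrow> Y q \<in> H q) \<Longrightarrow> smooth_fun_on A U (\<lambda>q. ip q (X q) (Y q))"
  using fibre_metric[unfolded fibre_metric_def, THEN conjunct2, THEN conjunct2, THEN conjunct2] by blast

lemma ip_add: "u \<in> H q \<Longrightarrow> v \<in> H q \<Longrightarrow> w \<in> H q \<Longrightarrow> ip q (u + v) w = ip q u w + ip q v w"
  using ip_linear[of u q v w 1 1] by simp

lemma ip_scale: "u \<in> H q \<Longrightarrow> w \<in> H q \<Longrightarrow> ip q (a *\<^sub>R u) w = a * ip q u w"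
  using ip_linear[of u q u w a 0] by simp

lemma ip_diff: "u \<in> H q \<Longrightarrow> v \<in> H q \<Longrightarrow> w \<in> H q \<Longrightarrow> ip q (u - v) w = ip q u w - ip q v w"
  using ip_linear[of u q v w 1 "-1"] by simp

lemma ip_zero: "w \<in> H q \<Longrightarrow> ip q 0 w = 0"
  using ip_scale[of 0 q w 0] subspace_0[OF subspace_H] by simp

lemma ip_sum:
  "(\<And>i. i \<in> I \<Longrightarrow> u i \<in> H q) \<Longrightarrow> w \<in> H q \<Longrightarrow> ip q (\<Sum>i\<in>I. u i) w = (\<Sum>i\<in>I. ip q (u i) w)"
  by (induction I rule: infinite_finite_induct)
     (auto simp: ip_zero ip_add subspace_sum[OF subspace_H])

lemma ip_scale_right: "u \<in> H q \<Longrightarrow> w \<in> H q \<Longrightarrow> ip q w (a *\<^sub>R u) = a * ip q w u"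
  using ip_scale ip_sym subspace_scale[OF subspace_H] by metis

lemma ip_zero_right: "w \<in> H q \<Longrightarrow> ip q w 0 = 0"
  using ip_scale_right[of 0 q w 0] subspace_0[OF subspace_H] by simp

lemma ip_add_right: "u \<in> H q \<Longrightarrow> v \<in> H q \<Longrightarrow> w \<in> H q \<Longrightarrow> ip q w (u + v) = ip q w u + ip q w v"
  using ip_add ip_sym subspace_add[OF subspace_H] by metis

lemma ip_cancel:
  assumes "u \<in> H q" "v \<in> H q" "\<And>X. X \<in> H q \<Longrightarrow> ip q u X = ip q v X"
  shows "u = v"
proof (rule ccontr)
  assume n: "u \<noteq> v"
  have d: "u - v \<in> H q" using assms subspace_diff[OF subspace_H] by blast
  have "ip q (u - v) (u - v) = 0" using ip_diff[OF assms(1,2) d] assms(3)[OF d] by simp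
  then show False using ip_pos[OF d] n by simp
qed

text \<open>The frame is orthogonal and not orthonormal: dividing by
  \<open>ip q (Y i q) (Y i q)\<close> in the expansions keeps all coefficients smooth without a
  statement on square roots.\<close>

definition orthogonal_frame :: "'a set \<Rightarrow> (nat \<Rightarrow> 'a \<Rightarrow> real ^ 'n) \<Rightarrow> bool" where
  "orthogonal_frame U Y \<longleftrightarrow> open U \<and> (\<forall>i<m. smooth_vf_on A U (Y i)) \<and>
    (\<forall>q\<in>U. H q = span ((\<lambda>i. Y i q) ` {..<m}) \<and> (\<forall>i<m. Y i q \<noteq> 0) \<and>
      (\<forall>i<m. \<forall>j<m. i \<noteq> j \<longrightarrow> ip q (Y i q) (Y j q) = 0))"

text \<open>If one of the \<open>m\<close> spanning vectors depended on others, fewer than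
  \<open>m\<close> vectors would span a fibre of dimension \<open>m\<close>.\<close>

lemma frame_independent:
  assumes "H q = span ((\<lambda>i. X i q) ` {..<m})" "k < m"
  shows "X k q \<notin> span ((\<lambda>i. X i q) ` {..<k})"
proof
  assume a: "X k q \<in> span ((\<lambda>i. X i q) ` {..<k})"
  let ?S = "(\<lambda>i. X i q) ` ({..<m} - {k})"
  have "(\<lambda>i. X i q) ` {..<k} \<subseteq> ?S" using assms(2) by auto
  then have "X k q \<in> span ?S" using a span_mono by blast
  then have "X i q \<in> span ?S" if "i < m" for i
    using that by (cases "i = k") (auto intro: span_base)
  then have "(\<lambda>i. X i q) ` {..<m} \<subseteq> span ?S" by blast
  then have "H q \<subseteq> span ?S" unfolding assms(1) by (rule span_minimal) simp
  then have "m \<le> card ?S" using dim_le_card[of "H q" ?S] dim_H by simp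
  also have "\<dots> \<le> card ({..<m} - {k})" by (rule card_image_le) simp
  finally show False using assms(2) by simp
qed

text \<open>Gram-Schmidt carried out on sections. The coefficients are quotients of inner products
  of smooth horizontal sections, hence smooth; that the new fields vanish nowhere belongs to the
  induction because it is what permits the division.\<close>

lemma Gram_Schmidt_step:
  assumes "open U" "\<And>i. i < m \<Longrightarrow> smooth_vf_on A U (X i)"
    "\<And>q. q \<in> U \<Longrightarrow> H q = span ((\<lambda>i. X i q) ` {..<m})" "k \<le> m"
  shows "\<exists>Y. (\<forall>i<k. smooth_vf_on A U (Y i)) \<and>
    (\<forall>q\<in>U. span ((\<lambda>i. Y i q) ` {..<k}) = span ((\<lambda>i. X i q) ` {..<k}) \<and> (\<forall>i<k. Y i q \<noteq> 0) \<and>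
      (\<forall>i<k. \<forall>j<k. i \<noteq> j \<longrightarrow> ip q (Y i q) (Y j q) = 0))"
  using assms(4)
proof (induction k)
  case 0
  then show ?case by simp
next
  case (Suc k)
  then have "k \<le> m" by simp
  from Suc.IH[OF this] obtain Y where
    "(\<forall>i<k. smooth_vf_on A U (Y i)) \<and>
    (\<forall>q\<in>U. span ((\<lambda>i. Y i q) ` {..<k}) = span ((\<lambda>i. X i q) ` {..<k}) \<and> (\<forall>i<k. Y i q \<noteq> 0) \<and>
      (\<forall>i<k. \<forall>j<k. i \<noteq> j \<longrightarrow> ip q (Y i q) (Y j q) = 0))" by (rule exE)
  then have Y: "\<And>i. i < k \<Longrightarrow> smooth_vf_on A U (Y i)"
    "\<And>q. q \<in> U \<Longrightarrow> span ((\<lambda>i. Y i q) ` {..<k}) = span ((\<lambda>i. X i q) ` {..<k})"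
    "\<And>q i. q \<in> U \<Longrightarrow> i < k \<Longrightarrow> Y i q \<noteq> 0"
    "\<And>q i j. q \<in> U \<Longrightarrow> i < k \<Longrightarrow> j < k \<Longrightarrow> i \<noteq> j \<Longrightarrow> ip q (Y i q) (Y j q) = 0"
    by simp_all
  have XH: "X i q \<in> H q" if "q \<in> U" "i < m" for i q
    unfolding assms(3)[OF that(1)] using that by (intro span_base) auto
  have YH: "Y i q \<in> H q" if "q \<in> U" "i < k" for i q
  proof -
    have "Y i q \<in> span ((\<lambda>i. X i q) ` {..<k})"
      unfolding Y(2)[OF that(1), symmetric] using that by (intro span_base) auto
    also have "\<dots> \<subseteq> span ((\<lambda>i. X i q) ` {..<m})" using Suc.prems by (intro span_mono) auto
    finally show ?thesis using assms(3)[OF that(1)] by simp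
  qed
  define p where "p i q = ip q (X k q) (Y i q) / ip q (Y i q) (Y i q)" for i q
  define Z where "Z q = (\<Sum>i<k. p i q *\<^sub>R Y i q)" for q
  \<comment> \<open>The difference is written as a sum with factor -1 to fit the closure lemmas for
    sums and multiples of fields.\<close>
  define W where "W q = X k q + (- 1) *\<^sub>R Z q" for q
  have pn: "ip q (Y i q) (Y i q) \<noteq> 0" if "q \<in> U" "i < k" for i q
    using ip_pos[OF YH[OF that] Y(3)[OF that]] by simp
  have smZ: "smooth_vf_on A U Z"
    unfolding Z_def
  proof (intro smooth_vf_on_sum smooth_vf_on_scale assms(1))
    fix i assume "i \<in> {..<k}"
    then have i: "i < k" by simp
    have k: "k < m" using Suc.prems by simp
    show "smooth_vf_on A U (Y i)" using Y(1)[OF i] .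
    show "smooth_fun_on A U (p i)"
      unfolding p_def
      by (rule smooth_fun_on_divide[OF assms(1) ip_smooth[OF assms(1) assms(2)[OF k] Y(1)[OF i]]
            ip_smooth[OF assms(1) Y(1)[OF i] Y(1)[OF i]]])
         (use pn[OF _ i] YH[OF _ i] XH[OF _ k] in auto)
  qed
  have smW: "smooth_vf_on A U W"
    unfolding W_def using Suc.prems assms(1,2) smZ
    by (intro smooth_vf_on_add smooth_vf_on_scale smooth_fun_on_const) auto
  have Zspan: "Z q \<in> span ((\<lambda>i. Y i q) ` {..<k})" for q
    unfolding Z_def by (intro span_sum span_scale span_base) auto
  have ZH: "Z q \<in> H q" if "q \<in> U" for q
    unfolding Z_def using YH that by (intro subspace_sum[OF subspace_H] subspace_scale[OF subspace_H]) auto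
  have W0: "W q \<noteq> 0" if "q \<in> U" for q
  proof
    assume "W q = 0"
    then have "X k q \<in> span ((\<lambda>i. X i q) ` {..<k})" using Zspan[of q] Y(2)[OF that] by (simp add: W_def)
    then show False using frame_independent[of q X k, OF assms(3)[OF that]] Suc.prems by simp
  qed
  have orth: "ip q (W q) (Y j q) = 0" if "q \<in> U" "j < k" for q j
  proof -
    have "ip q (Z q) (Y j q) = (\<Sum>i<k. p i q * ip q (Y i q) (Y j q))"
      unfolding Z_def using YH that
      by (subst ip_sum) (auto intro!: subspace_scale[OF subspace_H] sum.cong simp: ip_scale)
    also have "\<dots> = (\<Sum>i<k. if i = j then p j q * ip q (Y j q) (Y j q) else 0)"
      using Y(4) that by (intro sum.cong) auto
    also have "\<dots> = p j q * ip q (Y j q) (Y j q)" using that by simp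
    also have "\<dots> = ip q (X k q) (Y j q)"
      using pn that by (simp add: p_def)
    finally show ?thesis unfolding W_def
      using ip_diff[OF XH[OF that(1), of k] ZH[OF that(1)] YH[OF that]] Suc.prems by simp
  qed
  have WH: "W q \<in> H q" if "q \<in> U" for q
    unfolding W_def using XH[OF that, of k] ZH[OF that] Suc.prems
    by (simp add: subspace_diff[OF subspace_H])
  show ?case
  proof (intro exI[of _ "Y(k := W)"] conjI allI impI ballI)
    show "smooth_vf_on A U ((Y(k := W)) i)" if "i < Suc k" for i
      using that Y(1) smW by (auto simp: less_Suc_eq)
    fix q assume q: "q \<in> U"
    have im: "(\<lambda>i. (Y(k := W)) i q) ` {..<Suc k} = insert (W q) ((\<lambda>i. Y i q) ` {..<k})"
      by (auto simp: lessThan_Suc)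
    have "X k q - W q \<in> span ((\<lambda>i. Y i q) ` {..<k})" using Zspan by (simp add: W_def)
    then have "span (insert (W q) ((\<lambda>i. Y i q) ` {..<k})) = span (insert (X k q) ((\<lambda>i. Y i q) ` {..<k}))"
      using eq_span_insert_eq by metis
    also have "\<dots> = span (insert (X k q) ((\<lambda>i. X i q) ` {..<k}))"
      using Y(2)[OF q] by (simp add: span_insert)
    finally show "span ((\<lambda>i. (Y(k := W)) i q) ` {..<Suc k}) = span ((\<lambda>i. X i q) ` {..<Suc k})"
      unfolding im by (simp add: lessThan_Suc)
    show "(Y(k := W)) i q \<noteq> 0" if "i < Suc k" for i
      using that Y(3)[OF q] W0[OF q] by (auto simp: less_Suc_eq)
    show "ip q ((Y(k := W)) i q) ((Y(k := W)) j q) = 0" if "i < Suc k" "j < Suc k" "i \<noteq> j" for i j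
      using that Y(4)[OF q] orth[OF q] ip_sym[OF WH[OF q] YH[OF q]] by (auto simp: less_Suc_eq)
  qed
qed

lemma orthogonal_frame_exists: "\<exists>U Y. q \<in> U \<and> orthogonal_frame U Y"
proof -
  obtain U X where U: "open U" "q \<in> U" "\<And>i. i < m \<Longrightarrow> smooth_vf_on A U (X i)"
     "\<And>q. q \<in> U \<Longrightarrow> H q = span ((\<lambda>i. X i q) ` {..<m})"
    using subbundle unfolding subbundle_def by metis
  from Gram_Schmidt_step[OF U(1,3,4) order_refl] obtain Y where
    "\<forall>i<m. smooth_vf_on A U (Y i)"
    "\<forall>q\<in>U. span ((\<lambda>i. Y i q) ` {..<m}) = span ((\<lambda>i. X i q) ` {..<m}) \<and> (\<forall>i<m. Y i q \<noteq> 0) \<and>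
      (\<forall>i<m. \<forall>j<m. i \<noteq> j \<longrightarrow> ip q (Y i q) (Y j q) = 0)" by blast
  then have "orthogonal_frame U Y" unfolding orthogonal_frame_def using U by auto
  then show ?thesis using U by blast
qed

section \<open>Expansions in an orthogonal frame\<close>

context
  fixes U Y q
  assumes fr: "orthogonal_frame U Y" and q: "q \<in> U"
begin

lemma span_frame: "H q = span ((\<lambda>i. Y i q) ` {..<m})"
  using fr q by (simp add: orthogonal_frame_def)

lemma frame_in: "i < m \<Longrightarrow> Y i q \<in> H q"
  unfolding span_frame by (intro span_base) simp

lemma frame_ip_pos: "i < m \<Longrightarrow> ip q (Y i q) (Y i q) > 0"
  using fr q by (intro ip_pos frame_in) (simp_all add: orthogonal_frame_def)

lemma frame_ip_nonzero: "i < m \<Longrightarrow> ip q (Y i q) (Y i q) \<noteq> 0"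
  using frame_ip_pos by fastforce

lemma frame_combination_in: "(\<Sum>i<m. a i *\<^sub>R Y i q) \<in> H q"
  using frame_in by (intro subspace_sum[OF subspace_H] subspace_scale[OF subspace_H]) auto

lemma ip_frame_combination:
  assumes "j < m"
  shows "ip q (\<Sum>i<m. a i *\<^sub>R Y i q) (Y j q) = a j * ip q (Y j q) (Y j q)"
proof -
  have "ip q (\<Sum>i<m. a i *\<^sub>R Y i q) (Y j q) = (\<Sum>i<m. a i * ip q (Y i q) (Y j q))"
    using frame_in assms by (subst ip_sum) (auto intro!: subspace_scale[OF subspace_H] simp: ip_scale)
  also have "\<dots> = (\<Sum>i<m. if i = j then a j * ip q (Y j q) (Y j q) else 0)"
    using fr q assms unfolding orthogonal_frame_def by (intro sum.cong) auto
  finally show ?thesis using assms by simp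
qed

text \<open>By \<open>ip_cancel\<close> it suffices to compare inner products with horizontal
  vectors, and by linearity with the members of the frame, where orthogonality leaves a single
  term.\<close>

lemma frame_expansion:
  assumes "v \<in> H q"
  shows "(\<Sum>i<m. (ip q v (Y i q) / ip q (Y i q) (Y i q)) *\<^sub>R Y i q) = v"
proof (rule ip_cancel[OF frame_combination_in assms])
  fix X assume "X \<in> H q"
  then have "X \<in> span ((\<lambda>i. Y i q) ` {..<m})" by (simp add: span_frame)
  let ?s = "\<Sum>i<m. (ip q v (Y i q) / ip q (Y i q) (Y i q)) *\<^sub>R Y i q"
  \<comment> \<open>Membership in \<open>H q\<close> is carried through the induction because
    \<open>ip\<close> is bilinear on the fibre only.\<close>
  have "X \<in> H q \<and> ip q ?s X = ip q v X"
    using \<open>X \<in> span _\<close>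
  proof (induction rule: span_induct_alt)
    case base
    then show ?case
      using assms frame_combination_in by (simp add: ip_zero_right subspace_0[OF subspace_H])
  next
    case (step c x y)
    then obtain j where j: "j < m" "x = Y j q" by auto
    have "ip q ?s x = ip q v x"
      using ip_frame_combination[OF j(1)] frame_ip_nonzero[OF j(1)] j(2) by simp
    moreover have "x \<in> H q" using frame_in j by simp
    ultimately show ?case using step assms frame_combination_in
      by (simp add: ip_add_right ip_scale_right subspace_add[OF subspace_H] subspace_scale[OF subspace_H])
  qed
  then show "ip q ?s X = ip q v X" by simp
qed

lemma Riesz_frame:
  assumes X: "X \<in> H q"
  shows "ip q (\<Sum>i<m. (blinfun_apply p (Y i q) / ip q (Y i q) (Y i q)) *\<^sub>R Y i q) X = blinfun_apply p X"
proof -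
  let ?s = "\<Sum>i<m. (blinfun_apply p (Y i q) / ip q (Y i q) (Y i q)) *\<^sub>R Y i q"
  have "ip q ?s X = (\<Sum>i<m. blinfun_apply p (Y i q) / ip q (Y i q) (Y i q) * ip q (Y i q) X)"
    using frame_in X by (subst ip_sum) (auto intro!: subspace_scale[OF subspace_H] simp: ip_scale)
  also have "\<dots> = (\<Sum>i<m. blinfun_apply p (Y i q) / ip q (Y i q) (Y i q) * ip q X (Y i q))"
    by (intro sum.cong refl) (simp add: ip_sym[OF frame_in X])
  also have "\<dots> = blinfun_apply p (\<Sum>i<m. (ip q X (Y i q) / ip q (Y i q) (Y i q)) *\<^sub>R Y i q)"
    by (simp add: blinfun.sum_right blinfun.scaleR_right mult.commute)
  finally show ?thesis using frame_expansion[OF X] by simp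
qed

end

text \<open>Existence: \<beta>(p) is the horizontal vector representing the restriction of
  \<open>p\<close> to the fibre, written in a frame. Uniqueness: the last defining property fixes
  the inner products of \<beta>(p) with all horizontal vectors.\<close>

lemma cometric_unique_existence:
  "\<exists>\<beta>. linear \<beta> \<and>
        (\<forall>p p'. blinfun_apply p (\<beta> p') = blinfun_apply p' (\<beta> p)) \<and>
        (\<forall>p. blinfun_apply p (\<beta> p) \<ge> 0) \<and>
        range \<beta> = H q \<and>
        (\<forall>p. \<forall>X\<in>H q. ip q (\<beta> p) X = blinfun_apply p X) \<and> cometric H ip q = \<beta>"
proof -
  obtain U Y where fr: "orthogonal_frame U Y" "q \<in> U" using orthogonal_frame_exists by blast
  define \<beta> where "\<beta> p = (\<Sum>i<m. (blinfun_apply p (Y i q) / ip q (Y i q) (Y i q)) *\<^sub>R Y i q)"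
    for p :: "'n covec"
  have R: "ip q (\<beta> p) X = blinfun_apply p X" if "X \<in> H q" for p X
    unfolding \<beta>_def by (rule Riesz_frame[OF fr that])
  have inH: "\<beta> p \<in> H q" for p unfolding \<beta>_def by (rule frame_combination_in[OF fr])
  have lin: "linear \<beta>"
    by (rule linearI)
       (simp_all add: \<beta>_def blinfun.add_left blinfun.scaleR_left add_divide_distrib scaleR_add_left
          sum.distrib scaleR_sum_right)
  have sym: "blinfun_apply p (\<beta> p') = blinfun_apply p' (\<beta> p)" for p p'
    using R[OF inH] ip_sym[OF inH inH] by metis
  have pos: "blinfun_apply p (\<beta> p) \<ge> 0" for p
    using R[OF inH] ip_pos[OF inH] ip_zero[OF inH] by (metis less_eq_real_def)
  have ran: "H q \<subseteq> range \<beta>"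
  proof
    fix v assume v: "v \<in> H q"
      \<comment> \<open>Surjectivity onto the fibre: \<open>v\<close> should be the image of the
        functional \<open>ip q v\<close>. As \<open>ip\<close> is arbitrary off the fibre, this
        functional is first restricted to a basis of \<open>H q\<close> and then extended
        linearly.\<close>
      obtain g where g: "linear g" "\<And>X. X \<in> H q \<Longrightarrow> g X = ip q v X"
    proof -
      obtain B where B: "B \<subseteq> H q" "independent B" "H q = span B" "card B = dim (H q)"
        using basis_exists[of "H q"] by (metis span_subspace subspace_H)
      obtain g where g: "linear g" "\<forall>x\<in>B. g x = ip q v x"
        using linear_independent_extend[OF B(2), of "ip q v"] by blast
      have "X \<in> H q \<and> g X = ip q v X" if "X \<in> span B" for X
        using that
      proof (induction rule: span_induct_alt)
        case base
        then show ?case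
          using v by (simp add: linear_0[OF g(1)] ip_zero_right subspace_0[OF subspace_H])
      next
        case (step c x y)
        then show ?case using g B(1) v
          by (auto simp: linear_add linear_cmul ip_add_right ip_scale_right
              subspace_add[OF subspace_H] subspace_scale[OF subspace_H])
      qed
      then show ?thesis using that[of g] g B(3) by blast
    qed
    have "\<beta> (Blinfun g) = v"
      by (rule ip_cancel[OF inH v]) (use R g in \<open>simp add: bounded_linear_Blinfun_apply linear_conv_bounded_linear\<close>)
    then show "v \<in> range \<beta>" by blast
  qed
  have "cometric H ip q = \<beta>"
    unfolding cometric_def
  proof (rule the_equality)
    show "linear \<beta> \<and>
        (\<forall>p p'. blinfun_apply p (\<beta> p') = blinfun_apply p' (\<beta> p)) \<and>
        (\<forall>p. blinfun_apply p (\<beta> p) \<ge> 0) \<and> range \<beta> = H q \<and>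
        (\<forall>p. \<forall>X\<in>H q. ip q (\<beta> p) X = blinfun_apply p X)"
      using lin sym pos ran inH R by blast
  next
    fix \<gamma> assume g: "linear \<gamma> \<and>
        (\<forall>p p'. blinfun_apply p (\<gamma> p') = blinfun_apply p' (\<gamma> p)) \<and>
        (\<forall>p. blinfun_apply p (\<gamma> p) \<ge> 0) \<and> range \<gamma> = H q \<and>
        (\<forall>p. \<forall>X\<in>H q. ip q (\<gamma> p) X = blinfun_apply p X)"
    show "\<gamma> = \<beta>"
      by (rule ext, rule ip_cancel[OF _ inH]) (use g R in auto)
  qed
  then show ?thesis using lin sym pos ran inH R by blast
qed

lemma linear_cometric: "linear (cometric H ip q)"
  and cometric_sym: "blinfun_apply p (cometric H ip q p') = blinfun_apply p' (cometric H ip q p)"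
  and ip_cometric: "X \<in> H q \<Longrightarrow> ip q (cometric H ip q p) X = blinfun_apply p X"
  and range_cometric: "range (cometric H ip q) = H q"
  using cometric_unique_existence[of q] by blast+

lemma cometric_in: "cometric H ip q p \<in> H q"
  using range_cometric by blast

lemma cometric_eqI:
  "v \<in> H q \<Longrightarrow> (\<And>X. X \<in> H q \<Longrightarrow> ip q v X = blinfun_apply p X) \<Longrightarrow> cometric H ip q p = v"
  by (rule ip_cancel[OF cometric_in]) (auto simp: ip_cometric)

lemma cometric_frame:
  assumes "orthogonal_frame U Y" "q \<in> U"
  shows "cometric H ip q p = (\<Sum>i<m. (blinfun_apply p (Y i q) / ip q (Y i q) (Y i q)) *\<^sub>R Y i q)"
  by (rule cometric_eqI[OF frame_combination_in[OF assms] Riesz_frame[OF assms]])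

lemma \<beta>_comp_sym: "\<beta>_comp A H ip c i j q = \<beta>_comp A H ip c j i q"
  unfolding \<beta>_comp_def by (rule cometric_sym)

lemma tcomp_cometric:
  assumes "c \<in> A" "q \<in> cdom c"
  shows "tcomp A c q (cometric H ip q p) $ i = (\<Sum>j\<in>UNIV. \<beta>_comp A H ip c i j q * ccomp A c q p $ j)"
proof -
  have "cometric H ip q p = cometric H ip q (cform A c q (ccomp A c q p))"
    by (simp add: cform_ccomp[OF assms])
  also have "\<dots> = (\<Sum>j\<in>UNIV. ccomp A c q p $ j *\<^sub>R cometric H ip q (dcoord A c j q))"
    by (simp add: cform_def linear_sum[OF linear_cometric] linear_cmul[OF linear_cometric])
  finally show ?thesis
    by (simp add: linear_sum[OF linear_tcomp[OF assms]] linear_cmul[OF linear_tcomp[OF assms]]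
        \<beta>_comp_def dcoord_apply[OF assms] mult.commute)
qed

lemma covec_cometric:
  assumes "c \<in> A" "q \<in> cdom c"
  shows "blinfun_apply p (cometric H ip q p') =
    (\<Sum>i\<in>UNIV. \<Sum>j\<in>UNIV. \<beta>_comp A H ip c i j q * ccomp A c q p $ i * ccomp A c q p' $ j)"
  by (simp add: covec_apply[OF assms, of p] inner_vec_def tcomp_cometric[OF assms] sum_distrib_left mult_ac)

text \<open>In a local orthogonal frame \<beta>^{ij} is the sum over k of Y_k^i Y_k^j / <Y_k, Y_k>.
  Smoothness is local, so a frame near each point is enough.\<close>

lemma smooth_\<beta>_comp:
  assumes "c \<in> A"
  shows "smooth_on (cmap c ` cdom c) (\<beta>_comp A H ip c i j \<circ> cinv c)"
proof (rule smooth_on_local)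
  fix y assume "y \<in> cmap c ` cdom c"
  then obtain q where q: "q \<in> cdom c" "y = cmap c q" by blast
  obtain U Y where fr: "orthogonal_frame U Y" "q \<in> U" using orthogonal_frame_exists by blast
  let ?T = "cmap c ` (U \<inter> cdom c)"
  have oU: "open U" and oT: "open ?T" using fr open_cmap_image[OF assms] by (auto simp: orthogonal_frame_def)
  have sY: "smooth_on ?T (vf_in A c (Y k))" if "k < m" for k
    using fr assms that by (auto simp: orthogonal_frame_def smooth_vf_on_vf_in)
  have sI: "smooth_on ?T (\<lambda>y. ip (cinv c y) (Y k (cinv c y)) (Y k (cinv c y)))" if "k < m" for k
    using ip_smooth[of U "Y k" "Y k"] fr assms that frame_in[OF fr(1)] oU
    by (auto simp: orthogonal_frame_def smooth_fun_on_def o_def)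
  have comp: "smooth_on ?T (\<lambda>y. vf_in A c (Y k) y $ i)" if "k < m" for k i
    by (rule smooth_on_bounded_linear_comp[OF oT bounded_linear_vec_nth sY[OF that]])
  have "smooth_on ?T (\<lambda>y. \<Sum>k<m. vf_in A c (Y k) y $ j / ip (cinv c y) (Y k (cinv c y)) (Y k (cinv c y))
      * vf_in A c (Y k) y $ i)"
    using comp sI oT frame_ip_nonzero[OF fr(1)]
    by (intro smooth_on_sum smooth_on_mult smooth_on_divide) (auto simp: cinv_cmap[OF assms])
  then have "smooth_on ?T (\<beta>_comp A H ip c i j \<circ> cinv c)"
  proof (rule smooth_on_cong[OF oT, rotated])
    fix z assume "z \<in> ?T"
    then obtain q' where q': "q' \<in> U" "q' \<in> cdom c" "z = cmap c q'" by blast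
    have "\<beta>_comp A H ip c i j q' = (\<Sum>k<m. tcomp A c q' (Y k q') $ j / ip q' (Y k q') (Y k q')
      * tcomp A c q' (Y k q') $ i)"
      by (simp add: \<beta>_comp_def cometric_frame[OF fr(1) q'(1)] dcoord_apply[OF assms q'(2)]
          linear_sum[OF linear_tcomp[OF assms q'(2)]] linear_cmul[OF linear_tcomp[OF assms q'(2)]])
    then show "(\<Sum>k<m. vf_in A c (Y k) z $ j / ip (cinv c z) (Y k (cinv c z)) (Y k (cinv c z))
      * vf_in A c (Y k) z $ i) = (\<beta>_comp A H ip c i j \<circ> cinv c) z"
      using q' by (simp add: vf_in_def cinv_cmap[OF assms])
  qed
  then show "\<exists>T. open T \<and> y \<in> T \<and> smooth_on T (\<beta>_comp A H ip c i j \<circ> cinv c)"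
    using oT q fr by blast
qed

text \<open>In rank zero the zero field is the only horizontal one and brackets of it vanish, so
  nothing spans a tangent space of positive dimension. Positivity gives nonempty unit spheres and
  makes 1/m cancellable.\<close>

lemma rank_pos: "m > 0"
proof (rule ccontr)
  assume "\<not> m > 0"
  then have H0: "H q = {0}" for q using dim_H[of q] subspace_H[of q] by (metis dim_eq_0 gr0I subspace_0 subset_singletonD insert_not_empty empty_iff)
  have "X = (\<lambda>q. 0)" if "X \<in> iterated_brackets A H" for X
    using that
  proof induction
    case (horizontal X)
    then show ?case using H0 by auto
  next
    case (bracket X Y)
    \<comment> \<open>The components of the zero vector are known to vanish only over the chart
      domain, where \<open>tcomp\<close> is linear; its openness suffices for the
      derivative.\<close>
    have fd: "frechet_derivative (\<lambda>y. tcomp A c (cinv c y) 0) (at (cmap c q)) = (\<lambda>v. 0)"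
      if "c \<in> A" "q \<in> cdom c" for c q
    proof -
      have "((\<lambda>y. tcomp A c (cinv c y) 0) has_derivative (\<lambda>v. 0)) (at (cmap c q))"
        by (rule has_derivative_transform_within_open[OF has_derivative_const[of 0] open_cmap_cdom[OF that(1)]])
           (use that in \<open>auto simp: cinv_cmap linear_0[OF linear_tcomp]\<close>)
      then show ?thesis using frechet_derivative_at by metis
    qed
    show ?case unfolding bracket.IH lie_bracket_def Let_def
      by (simp add: fd[OF ref_chart_in ref_chart_dom])
  qed
  then have "{X q |X. X \<in> iterated_brackets A H} \<subseteq> {0}" for q by auto
  from span_mono[OF this] have "span {X q |X. X \<in> iterated_brackets A H} \<subseteq> {0}" for q
    by simp
  then have "(UNIV :: (real ^ 'n) set) \<subseteq> {0}" using hoermander by (simp add: hoermander_def)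
  then have "axis undefined 1 = (0 :: real ^ 'n)" by blast
  then show False by (simp add: axis_eq_0_iff)
qed

end

locale vertical_sub_riemannian = sub_riemannian_manifold A H ip m
  for A :: "('a::{t2_space,second_countable_topology}, 'n::finite) chart set" and H ip m +
  fixes V :: "'a \<Rightarrow> (real ^ 'n) set" and G :: "'a \<Rightarrow> real ^ 'n \<Rightarrow> real ^ 'n \<Rightarrow> real"
  assumes riemannian: "riemannian_metric A G"
    and G_extends: "u \<in> H q \<Longrightarrow> v \<in> H q \<Longrightarrow> G q u v = ip q u v"
    and V_orthogonal: "V q = {v. \<forall>u\<in>H q. G q u v = 0}"
begin

section \<open>The extending Riemannian metric and the projection along \<open>V\<close>\<close>

lemma G_linear: "G q (a *\<^sub>R u + b *\<^sub>R v) w = a * G q u w + b * G q v w"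
  using riemannian[unfolded fibre_metric_def, THEN conjunct1] by simp

lemma G_sym: "G q u v = G q v u"
  using riemannian[unfolded fibre_metric_def, THEN conjunct2, THEN conjunct1] by simp

lemma G_pos: "u \<noteq> 0 \<Longrightarrow> G q u u > 0"
  using riemannian[unfolded fibre_metric_def, THEN conjunct2, THEN conjunct2, THEN conjunct1] by simp

lemma linear_G_left: "linear (\<lambda>u. G q u w)"
proof (rule linearI)
  show "G q (u + v) w = G q u w + G q v w" for u v using G_linear[of q 1 u 1 v w] by simp
  show "G q (a *\<^sub>R u) w = a *\<^sub>R G q u w" for a u using G_linear[of q a u 0 u w] by simp
qed

lemma linear_G_right: "linear (\<lambda>u. G q w u)"
  using linear_G_left[of q w] G_sym[of q _ w] by simp

lemma flat_apply: "blinfun_apply (flat G q X) Y = G q Y X"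
  unfolding flat_def using linear_G_left
  by (simp add: bounded_linear_Blinfun_apply linear_conv_bounded_linear)

lemma linear_flat: "linear (flat G q)"
  by (intro linearI blinfun_eqI)
     (simp_all add: flat_apply blinfun.add_left blinfun.scaleR_left linear_add[OF linear_G_right] linear_cmul[OF linear_G_right])

text \<open>This is the bundle map \<beta> \<circ> g of the theorem. The lemmas that follow identify
  it as the \<open>G\<close>-orthogonal projection onto \<open>H q\<close> along
  \<open>V q\<close>.\<close>

definition proj :: "'a \<Rightarrow> real ^ 'n \<Rightarrow> real ^ 'n" where
  "proj q X = cometric H ip q (flat G q X)"

lemma linear_proj: "linear (proj q)"
  using linear_compose[OF linear_flat[of q] linear_cometric[of q]] by (simp add: proj_def[abs_def] o_def)

lemma proj_in: "proj q X \<in> H q"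
  unfolding proj_def by (rule cometric_in)

lemma ip_proj: "X \<in> H q \<Longrightarrow> ip q (proj q Y) X = G q X Y"
  unfolding proj_def by (simp add: ip_cometric flat_apply)

lemma proj_H: "X \<in> H q \<Longrightarrow> proj q X = X"
  unfolding proj_def by (rule cometric_eqI) (auto simp: flat_apply G_extends intro: ip_sym)

lemma proj_V: "Y \<in> V q \<Longrightarrow> proj q Y = 0"
  unfolding proj_def
  by (rule cometric_eqI) (auto simp: flat_apply V_orthogonal ip_zero subspace_0[OF subspace_H])

lemma diff_proj_V: "X - proj q X \<in> V q"
  by (auto simp: V_orthogonal linear_diff[OF linear_G_right] G_extends[OF _ proj_in]
      ip_sym[OF _ proj_in] ip_proj)

lemma G_proj: "G q Y (proj q X) = ip q (proj q Y) (proj q X)"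
  using ip_proj[OF proj_in] G_sym by metis

text \<open>Any candidate \<gamma> annihilates \<open>V q\<close> and is symmetric, so both
  arguments may be replaced by their projections; on horizontal vectors it is determined by
  \<beta>(\<gamma>(X)) = X.\<close>

lemma vertical_cometric_eq: "vertical_cometric H ip V q X = flat G q (proj q X)"
proof -
  have "vertical_cometric H ip V q = (\<lambda>X. flat G q (proj q X))"
    unfolding vertical_cometric_def
  proof (rule the_equality)
    have "linear (\<lambda>X. flat G q (proj q X))"
      using linear_compose[OF linear_proj[of q] linear_flat[of q]] by (simp add: o_def)
    moreover have "G q X (proj q X) \<ge> 0" for X
      unfolding G_proj using ip_pos[OF proj_in, of q X] ip_zero[OF proj_in, of q X] by (metis less_eq_real_def)
    moreover have "cometric H ip q (flat G q (proj q X)) = X" if "X \<in> H q" for X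
      using that proj_H unfolding proj_def by metis
    moreover have "flat G q (proj q Y) = 0" if "Y \<in> V q" for Y
      by (simp add: proj_V[OF that] linear_0[OF linear_flat])
    ultimately show "linear (\<lambda>X. flat G q (proj q X)) \<and>
        (\<forall>X Y. blinfun_apply (flat G q (proj q X)) Y = blinfun_apply (flat G q (proj q Y)) X) \<and>
        (\<forall>X. blinfun_apply (flat G q (proj q X)) X \<ge> 0) \<and>
        (\<forall>X\<in>H q. cometric H ip q (flat G q (proj q X)) = X) \<and>
        (\<forall>Y\<in>V q. flat G q (proj q Y) = 0)"
      using ip_sym[OF proj_in proj_in] by (auto simp: flat_apply G_proj)
  next
    fix \<gamma> assume g: "linear \<gamma> \<and>
        (\<forall>X Y. blinfun_apply (\<gamma> X) Y = blinfun_apply (\<gamma> Y) X) \<and>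
        (\<forall>X. blinfun_apply (\<gamma> X) X \<ge> 0) \<and>
        (\<forall>X\<in>H q. cometric H ip q (\<gamma> X) = X) \<and> (\<forall>Y\<in>V q. \<gamma> Y = 0)"
    have d: "\<gamma> X = \<gamma> (proj q X)" for X
      using g diff_proj_V[of X q] linear_diff[of \<gamma> X "proj q X"] by auto
    show "\<gamma> = (\<lambda>X. flat G q (proj q X))"
    proof (intro ext blinfun_eqI)
      fix X Y
      have "blinfun_apply (\<gamma> X) Y = blinfun_apply (\<gamma> (proj q X)) (proj q Y)"
        using g d by metis
      also have "\<dots> = ip q (cometric H ip q (\<gamma> (proj q X))) (proj q Y)"
        by (simp add: ip_cometric[OF proj_in])
      also have "\<dots> = ip q (proj q X) (proj q Y)" using g proj_in by metis
      finally show "blinfun_apply (\<gamma> X) Y = blinfun_apply (flat G q (proj q X)) Y"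
        using ip_sym[OF proj_in proj_in] by (simp add: flat_apply G_proj)
    qed
  qed
  then show ?thesis by simp
qed

lemma vertical_cometric_apply:
  "blinfun_apply (vertical_cometric H ip V q X) Y = ip q (proj q X) (proj q Y)"
  using ip_sym[OF proj_in proj_in] by (simp add: vertical_cometric_eq flat_apply G_proj)

lemma vertical_cometric_sym:
  "blinfun_apply (vertical_cometric H ip V q X) Y = blinfun_apply (vertical_cometric H ip V q Y) X"
  using ip_sym[OF proj_in proj_in] by (simp add: vertical_cometric_apply)

text \<open>For horizontal \<open>X\<close> this says that the Hamiltonian curve issued from g^V(X)
  starts with velocity \<open>X\<close>; for coordinate vectors it produces the components
  \<open>P_comp\<close>.\<close>

lemma cometric_vertical_cometric: "cometric H ip q (vertical_cometric H ip V q X) = proj q X"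
  unfolding vertical_cometric_eq using proj_H[OF proj_in] unfolding proj_def .

end

section \<open>Ordinary differential equations\<close>

text \<open>On a compact ball the derivatives in the basis directions are bounded. Their bounds add
  up to a bound for the operator norm, and the mean value inequality on the convex ball gives the
  constant.\<close>

lemma Ck_on_1_lipschitz:
  fixes F :: "'a::euclidean_space \<Rightarrow> 'b::real_normed_vector"
  assumes "open S" "x0 \<in> S" "Ck_on 1 S F"
  obtains r L where "r > 0" "L \<ge> 0" "cball x0 r \<subseteq> S"
    "\<And>x y. x \<in> cball x0 r \<Longrightarrow> y \<in> cball x0 r \<Longrightarrow> norm (F x - F y) \<le> L * norm (x - y)"
proof -
  obtain r where r: "r > 0" "cball x0 r \<subseteq> S" using assms open_contains_cball by blast
  have df: "F differentiable (at x)" if "x \<in> S" for x using assms(3) that by simp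
  have "\<exists>K. \<forall>y\<in>cball x0 r. norm (frechet_derivative F (at y) b) \<le> K" for b
  proof -
    have "continuous_on (cball x0 r) (\<lambda>y. frechet_derivative F (at y) b)"
      using assms(3) r(2) by (auto intro: continuous_on_subset)
    then have "bounded ((\<lambda>y. frechet_derivative F (at y) b) ` cball x0 r)"
      by (intro compact_imp_bounded compact_continuous_image) auto
    then show ?thesis by (auto simp: bounded_iff)
  qed
  then obtain K where K: "\<And>b y. y \<in> cball x0 r \<Longrightarrow> norm (frechet_derivative F (at y) b) \<le> K b"
    by metis
  have K0: "K b \<ge> 0" for b
    using order_trans[OF norm_ge_zero K[of x0 b]] r by simp
  define L where "L = (\<Sum>b\<in>Basis. K b)"
  have on: "onorm (frechet_derivative F (at y)) \<le> L" if "y \<in> cball x0 r" for y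
  proof (rule onorm_le)
    fix v
    have "norm (frechet_derivative F (at y) v) = norm (\<Sum>b\<in>Basis. (v \<bullet> b) *\<^sub>R frechet_derivative F (at y) b)"
      using frechet_derivative_euclidean_sum[OF df] that r(2) by (metis subsetD)
    also have "\<dots> \<le> (\<Sum>b\<in>Basis. norm v * K b)"
      using K[OF that] Basis_le_norm
      by (intro sum_norm_le) (auto intro!: mult_mono)
    finally show "norm (frechet_derivative F (at y) v) \<le> L * norm v"
      by (simp add: L_def sum_distrib_left mult.commute)
  qed
  show ?thesis
  proof (rule that[of r L])
    show "L \<ge> 0" unfolding L_def using K0 by (intro sum_nonneg)
    show "norm (F x - F y) \<le> L * norm (x - y)" if "x \<in> cball x0 r" "y \<in> cball x0 r" for x y
      by (rule differentiable_bound[OF convex_cball _ on that])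
         (use r(2) df differentiable_has_frechet_derivative in \<open>blast intro: has_derivative_at_withinI\<close>)
  qed (use r in auto)
qed

text \<open>The difference of two integrals from -\<delta> is the signed integral from 0 to
  \<open>s\<close>. An integral over {0..s} would be zero for negative \<open>s\<close>, so this
  form treats both time directions at once.\<close>

lemma integral_from_zero_bound:
  fixes g :: "real \<Rightarrow> 'a::euclidean_space"
  assumes "\<delta> \<ge> 0" "- \<delta> \<le> s" "s \<le> \<delta>" "continuous_on UNIV g" "\<And>t. norm (g t) \<le> B"
  shows "norm (integral {- \<delta>..s} g - integral {- \<delta>..0} g) \<le> B * \<delta>"
proof -
  have ct: "continuous_on X g" for X using assms(4) continuous_on_subset by blast
  have int: "g integrable_on {a..b}" for a b by (intro integrable_continuous_interval ct)
  have B: "B \<ge> 0" using assms(5)[of 0] norm_ge_zero order_trans by blast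
  show ?thesis
  proof (cases "s \<ge> 0")
    case True
    have "integral {- \<delta>..s} g - integral {- \<delta>..0} g = integral {0..s} g"
      using Henstock_Kurzweil_Integration.integral_combine[of "- \<delta>" 0 s g] assms True int by (simp add: algebra_simps)
    moreover have "norm (integral {0..s} g) \<le> B * (s - 0)"
      using True ct assms(5) by (intro integral_bound) auto
    moreover have "B * (s - 0) \<le> B * \<delta>" using assms B by (intro mult_left_mono) auto
    ultimately show ?thesis by simp
  next
    case False
    have "integral {- \<delta>..s} g - integral {- \<delta>..0} g = - integral {s..0} g"
      using Henstock_Kurzweil_Integration.integral_combine[of "- \<delta>" s 0 g] assms False int by (simp add: algebra_simps)
    moreover have "norm (integral {s..0} g) \<le> B * (0 - s)"
      using False ct assms(5) by (intro integral_bound) auto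
    moreover have "B * (0 - s) \<le> B * \<delta>" using assms B by (intro mult_left_mono) auto
    ultimately show ?thesis by simp
  qed
qed

text \<open>The integral equation of u' = F(u), solved by Banach's fixed point theorem: as \<delta>
  L is at most 1/2, the Picard operator contracts with factor 1/2 in the supremum norm.\<close>

lemma Picard_fixed_point:
  fixes F :: "'a::euclidean_space \<Rightarrow> 'a"
  assumes L: "L \<ge> 0" "\<And>x y. norm (F x - F y) \<le> L * norm (x - y)"
    and \<delta>: "\<delta> > 0" "\<delta> * L \<le> 1 / 2"
  obtains u where "continuous_on UNIV u"
    "\<And>t. t \<in> {- \<delta>..\<delta>} \<Longrightarrow> u t = x0 + (integral {- \<delta>..t} (\<lambda>s. F (u s)) - integral {- \<delta>..0} (\<lambda>s. F (u s)))"
proof -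
  have cF: "continuous_on UNIV F"
  proof (rule continuous_on_subset[OF lipschitz_on_continuous_on[of L UNIV F]])
    show "L-lipschitz_on UNIV F" using L by (auto simp: lipschitz_on_def dist_norm)
  qed simp
  \<comment> \<open>Clamping the time to [-\<delta>, \<delta>] makes Picard iterates bounded and
    continuous on the whole line, so they live in the complete type of bounded continuous
    functions.\<close>
  define cl where "cl t = max (- \<delta>) (min \<delta> t)" for t :: real
  have cl: "- \<delta> \<le> cl t" "cl t \<le> \<delta>" for t using \<delta>(1) by (auto simp: cl_def)
  define T where "T u t = x0 + (integral {- \<delta>..cl t} (\<lambda>s. F (u s)) - integral {- \<delta>..0} (\<lambda>s. F (u s)))" for u t
  have cFu: "continuous_on X (\<lambda>s. F (apply_bcontfun u s))" for X and u :: "real \<Rightarrow>\<^sub>C 'a"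
    by (intro continuous_on_compose2[OF cF] continuous_on_apply_bcontfun) auto
  have Tin: "T (apply_bcontfun u) \<in> bcontfun" for u
  proof -
    define J where "J s = x0 + (integral {- \<delta>..s} (\<lambda>s. F (apply_bcontfun u s)) - integral {- \<delta>..0} (\<lambda>s. F (apply_bcontfun u s)))" for s
    have cJ: "continuous_on {- \<delta>..\<delta>} J"
      unfolding J_def
      by (intro continuous_intros indefinite_integral_continuous_1 integrable_continuous_interval cFu)
    have TJ: "T (apply_bcontfun u) = (\<lambda>t. J (cl t))" by (auto simp: T_def J_def)
    have "continuous_on UNIV (\<lambda>t. J (cl t))"
      by (rule continuous_on_compose2[OF cJ]) (use cl in \<open>auto simp: cl_def intro!: continuous_intros\<close>)
    moreover have "bounded (range (\<lambda>t. J (cl t)))"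
      by (rule bounded_subset[OF compact_imp_bounded[OF compact_continuous_image[OF cJ compact_Icc]]])
         (use cl in auto)
    ultimately show ?thesis unfolding TJ by (simp add: bcontfun_def)
  qed
  have contr: "dist (Bcontfun (T (apply_bcontfun u))) (Bcontfun (T (apply_bcontfun v))) \<le> (1 / 2) * dist u v"
    for u v :: "real \<Rightarrow>\<^sub>C 'a"
  proof (rule dist_bound)
    fix t
    let ?g = "\<lambda>s. F (apply_bcontfun u s) - F (apply_bcontfun v s)"
    have cg: "continuous_on UNIV ?g" by (intro continuous_intros cFu)
    have bg: "norm (?g s) \<le> L * dist u v" for s
    proof -
      have "norm (?g s) \<le> L * dist (apply_bcontfun u s) (apply_bcontfun v s)" using L(2) by (simp add: dist_norm)
      also have "\<dots> \<le> L * dist u v" by (intro mult_left_mono dist_bounded L)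
      finally show ?thesis .
    qed
    have split: "integral {a..b} ?g = integral {a..b} (\<lambda>s. F (apply_bcontfun u s)) - integral {a..b} (\<lambda>s. F (apply_bcontfun v s))"
      for a b by (rule integral_diff) (intro integrable_continuous_interval cFu)+
    have "dist (T (apply_bcontfun u) t) (T (apply_bcontfun v) t)
       = norm (integral {- \<delta>..cl t} ?g - integral {- \<delta>..0} ?g)"
      unfolding split by (simp add: T_def dist_norm algebra_simps)
    also have "\<dots> \<le> L * dist u v * \<delta>"
      by (rule integral_from_zero_bound[OF _ cl cg bg]) (use \<delta> in simp)
    also have "\<dots> = (\<delta> * L) * dist u v" by simp
    also have "\<dots> \<le> (1 / 2) * dist u v" by (intro mult_right_mono \<delta>) simp
    finally show "dist (apply_bcontfun (Bcontfun (T (apply_bcontfun u))) t) (apply_bcontfun (Bcontfun (T (apply_bcontfun v))) t)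
       \<le> (1 / 2) * dist u v"
      by (simp add: Bcontfun_inverse Tin)
  qed
  have "\<exists>!u. Bcontfun (T (apply_bcontfun u)) = u"
    by (rule banach_fix_type[of "1/2"]) (use contr in auto)
  then obtain u where "Bcontfun (T (apply_bcontfun u)) = u" by blast
  then have fu: "T (apply_bcontfun u) t = apply_bcontfun u t" for t
    by (metis Bcontfun_inverse Tin)
  show ?thesis
  proof (rule that[of "apply_bcontfun u"])
    show "continuous_on UNIV (apply_bcontfun u)" by (rule continuous_on_apply_bcontfun)
    fix t assume "t \<in> {- \<delta>..\<delta>}"
    then have "cl t = t" by (auto simp: cl_def)
    then show "apply_bcontfun u t = x0 + (integral {- \<delta>..t} (\<lambda>s. F (apply_bcontfun u s)) - integral {- \<delta>..0} (\<lambda>s. F (apply_bcontfun u s)))"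
      using fu[of t] by (simp add: T_def)
  qed
qed

lemma Picard_Lindeloef:
  fixes F :: "'a::euclidean_space \<Rightarrow> 'a"
  assumes "open S" "x0 \<in> S" "Ck_on 1 S F"
  obtains \<delta> u where "\<delta> > 0" "u 0 = x0"
    "\<And>t. t \<in> {- \<delta><..<\<delta>} \<Longrightarrow> u t \<in> S"
    "\<And>t. t \<in> {- \<delta><..<\<delta>} \<Longrightarrow> (u has_vector_derivative F (u t)) (at t)"
proof -
  obtain r L where rL: "r > 0" "L \<ge> 0" "cball x0 r \<subseteq> S"
    "\<And>x y. x \<in> cball x0 r \<Longrightarrow> y \<in> cball x0 r \<Longrightarrow> norm (F x - F y) \<le> L * norm (x - y)"
    using Ck_on_1_lipschitz[OF assms] by metis
  \<comment> \<open>Composing with the nearest-point retraction onto the ball makes the field globally Lipschitz and bounded.\<close>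
  define \<pi> where "\<pi> = closest_point (cball x0 r)"
  define E where "E x = F (\<pi> x)" for x
  have ne: "cball x0 r \<noteq> {}" using rL(1) by simp
  have \<pi>_in: "\<pi> x \<in> cball x0 r" for x
    unfolding \<pi>_def by (rule closest_point_in_set[OF closed_cball ne])
  have \<pi>_id: "\<pi> x = x" if "x \<in> cball x0 r" for x
    unfolding \<pi>_def by (rule closest_point_self[OF that])
  have E_lip: "norm (E x - E y) \<le> L * norm (x - y)" for x y
  proof -
    have "norm (E x - E y) \<le> L * norm (\<pi> x - \<pi> y)" unfolding E_def by (intro rL \<pi>_in)
    also have "\<dots> \<le> L * norm (x - y)"
      using closest_point_lipschitz[OF convex_cball closed_cball ne, of x y] rL(2)
      by (intro mult_left_mono) (simp_all add: \<pi>_def dist_norm)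
    finally show ?thesis .
  qed
  define M where "M = norm (F x0) + L * r + 1"
  have E_bd: "norm (E x) \<le> M" for x
  proof -
    have "norm (F (\<pi> x) - F x0) \<le> L * norm (\<pi> x - x0)" using rL \<pi>_in by auto
    also have "\<dots> \<le> L * r" using \<pi>_in[of x] rL(2) by (intro mult_left_mono) (auto simp: dist_norm norm_minus_commute)
    finally show ?thesis unfolding M_def E_def using norm_triangle_sub[of "F (\<pi> x)" "F x0"] by linarith
  qed
  have M: "M > 0" unfolding M_def using rL(1,2) by (smt (verit) mult_nonneg_nonneg norm_ge_zero)
  \<comment> \<open>The first bound yields the contraction, with L + 1 in the denominator because
    \<open>L\<close> may be zero. The second keeps the solution within distance \<open>r\<close> of
    \<open>x0\<close>, where the retraction is the identity and \<open>E\<close> agrees with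
    \<open>F\<close>.\<close>
  define \<delta> where "\<delta> = min (1 / (2 * (L + 1))) (r / M)"
  have \<delta>: "\<delta> > 0" unfolding \<delta>_def using rL M by simp
  have "\<delta> * L \<le> 1 / (2 * (L + 1)) * L" using rL(2) by (intro mult_right_mono) (auto simp: \<delta>_def)
  also have "\<dots> \<le> 1 / 2" using rL(2) by (simp add: field_simps)
  finally have \<delta>L: "\<delta> * L \<le> 1 / 2" .
  have \<delta>M: "M * \<delta> \<le> r" using M by (simp add: \<delta>_def min_def field_simps)
  obtain u where u: "continuous_on UNIV u"
    "\<And>t. t \<in> {- \<delta>..\<delta>} \<Longrightarrow> u t = x0 + (integral {- \<delta>..t} (\<lambda>s. E (u s)) - integral {- \<delta>..0} (\<lambda>s. E (u s)))"
    using Picard_fixed_point[OF rL(2) E_lip \<delta> \<delta>L] by metis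
  have cE: "continuous_on UNIV E"
  proof (rule continuous_on_subset[OF lipschitz_on_continuous_on[of L UNIV E]])
    show "L-lipschitz_on UNIV E" using rL(2) E_lip by (auto simp: lipschitz_on_def dist_norm)
  qed simp
  have cEu: "continuous_on UNIV (\<lambda>s. E (u s))"
    using continuous_on_compose2[OF cE u(1)] by simp
  have in_ball: "u t \<in> cball x0 r" if "t \<in> {- \<delta>..\<delta>}" for t
  proof -
    have "norm (integral {- \<delta>..t} (\<lambda>s. E (u s)) - integral {- \<delta>..0} (\<lambda>s. E (u s))) \<le> M * \<delta>"
      by (rule integral_from_zero_bound[OF _ _ _ cEu E_bd]) (use that \<delta> in auto)
    then show ?thesis unfolding u(2)[OF that] using \<delta>M by (simp add: dist_norm norm_minus_commute)
  qed
  show ?thesis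
  proof (rule that[OF \<delta>])
    show "u 0 = x0" using u(2)[of 0] \<delta> by simp
    fix t assume t: "t \<in> {- \<delta><..<\<delta>}"
    then have t': "t \<in> {- \<delta>..\<delta>}" by auto
    show "u t \<in> S" using in_ball[OF t'] rL(3) by blast
    have "((\<lambda>t. integral {- \<delta>..t} (\<lambda>s. E (u s))) has_vector_derivative E (u t)) (at t within {- \<delta>..\<delta>})"
      by (rule integral_has_vector_derivative[OF continuous_on_subset[OF cEu] t']) simp
    then have "((\<lambda>t. integral {- \<delta>..t} (\<lambda>s. E (u s))) has_vector_derivative E (u t)) (at t)"
      using t by (simp add: at_within_Icc_at)
    then have "((\<lambda>t. x0 + (integral {- \<delta>..t} (\<lambda>s. E (u s)) - integral {- \<delta>..0} (\<lambda>s. E (u s))))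
        has_vector_derivative E (u t)) (at t)"
      by (auto intro!: derivative_eq_intros)
    then have "(u has_vector_derivative E (u t)) (at t)"
      by (rule has_vector_derivative_transform_within_open[OF _ open_greaterThanLessThan t])
         (use u(2) in auto)
    then show "(u has_vector_derivative F (u t)) (at t)"
      by (simp add: E_def \<pi>_id[OF in_ball[OF t']])
  qed
qed

text \<open>On a ball of times of radius \<open>e\<close> with L e at most 1/2, the maximum of the
  norm of the difference is at most half of itself by the mean value inequality, hence zero.\<close>

lemma ode_unique_local:
  fixes F :: "'a::euclidean_space \<Rightarrow> 'a"
  assumes "open S" "Ck_on 1 S F" "open I" "t0 \<in> I" "u t0 \<in> S" "v t0 = u t0"
    "\<And>t. t \<in> I \<Longrightarrow> (u has_vector_derivative F (u t)) (at t)"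
    "\<And>t. t \<in> I \<Longrightarrow> (v has_vector_derivative F (v t)) (at t)"
  obtains e where "e > 0" "\<And>t. \<bar>t - t0\<bar> < e \<Longrightarrow> u t = v t"
proof -
  obtain r L where rL: "r > 0" "L \<ge> 0" "cball (u t0) r \<subseteq> S"
    "\<And>x y. x \<in> cball (u t0) r \<Longrightarrow> y \<in> cball (u t0) r \<Longrightarrow> norm (F x - F y) \<le> L * norm (x - y)"
    using Ck_on_1_lipschitz[OF assms(1,5,2)] by metis
  have cu: "isCont u t" and cv: "isCont v t" if "t \<in> I" for t
    using assms(7,8)[OF that] has_vector_derivative_continuous by auto
  obtain d1 where d1: "d1 > 0" "\<And>t. dist t t0 < d1 \<Longrightarrow> dist (u t) (u t0) < r"
    using cu[OF assms(4)] rL(1) unfolding continuous_at_eps_delta by blast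
  obtain d2 where d2: "d2 > 0" "\<And>t. dist t t0 < d2 \<Longrightarrow> dist (v t) (v t0) < r"
    using cv[OF assms(4)] rL(1) unfolding continuous_at_eps_delta by blast
  obtain d3 where d3: "d3 > 0" "ball t0 d3 \<subseteq> I" using assms(3,4) open_contains_ball by blast
  \<comment> \<open>The final halving gives strict inequalities with \<open>d1\<close>,
    \<open>d2\<close>, \<open>d3\<close> and also the factor 1/2 in \<open>Le\<close>.\<close>
  define e where "e = min (min d1 (min d2 d3)) (1 / (L + 1)) / 2"
  have e: "e > 0" "e < d1" "e < d2" "e < d3" using d1(1) d2(1) d3(1) rL(2) by (auto simp: e_def)
  have "e \<le> 1 / (L + 1) / 2" unfolding e_def by (intro divide_right_mono) auto
  then have "L * e \<le> L * (1 / (L + 1) / 2)" using rL(2) by (rule mult_left_mono)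
  also have "\<dots> \<le> 1 / 2" using rL(2) by (simp add: field_simps)
  finally have Le: "L * e \<le> 1 / 2" .
  have K: "t \<in> I \<and> u t \<in> cball (u t0) r \<and> v t \<in> cball (u t0) r" if "t \<in> cball t0 e" for t
    using that e d3(2) d1(2)[of t] d2(2)[of t] assms(6) by (auto simp: dist_commute subset_iff)
  define w where "w t = u t - v t" for t
  have dw: "(w has_derivative (\<lambda>h. h *\<^sub>R (F (u t) - F (v t)))) (at t)" if "t \<in> I" for t
    using has_vector_derivative_diff[OF assms(7,8)[OF that]]
    unfolding has_vector_derivative_def w_def[abs_def] by simp
  have "continuous_on (cball t0 e) w"
    using K cu cv by (auto simp: w_def intro!: continuous_at_imp_continuous_on continuous_intros)
  then have "continuous_on (cball t0 e) (\<lambda>t. norm (w t))" by (intro continuous_intros)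
  then obtain s where s: "s \<in> cball t0 e" "\<And>t. t \<in> cball t0 e \<Longrightarrow> norm (w t) \<le> norm (w s)"
    using continuous_attains_sup[of "cball t0 e" "\<lambda>t. norm (w t)"] e(1) compact_cball by (metis cball_eq_empty not_less_iff_gr_or_eq)
  have "norm (w s - w t0) \<le> (L * norm (w s)) * norm (s - t0)"
  proof (rule differentiable_bound[OF convex_cball[of t0 e]])
    fix t assume t: "t \<in> cball t0 e"
    show "(w has_derivative (\<lambda>h. h *\<^sub>R (F (u t) - F (v t)))) (at t within cball t0 e)"
      using dw K[OF t] has_derivative_at_withinI by blast
    have "norm (F (u t) - F (v t)) \<le> L * norm (w t)" unfolding w_def using K[OF t] rL(4) by blast
    also have "\<dots> \<le> L * norm (w s)" using s(2)[OF t] rL(2) by (rule mult_left_mono)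
    finally show "onorm (\<lambda>h. h *\<^sub>R (F (u t) - F (v t))) \<le> L * norm (w s)"
      by (intro onorm_le) (simp add: mult.commute mult_left_mono)
  qed (use s e in auto)
  also have "\<dots> \<le> (L * norm (w s)) * e"
    using s(1) rL(2) by (intro mult_left_mono) (auto simp: dist_norm norm_minus_commute)
  also have "\<dots> = (L * e) * norm (w s)" by simp
  also have "\<dots> \<le> (1 / 2) * norm (w s)" by (intro mult_right_mono Le) simp
  finally have "norm (w s) \<le> 0" using assms(6) by (simp add: w_def)
  then have "w t = 0" if "t \<in> cball t0 e" for t using s(2)[OF that] by simp
  then show ?thesis
    by (intro that[of e]) (use e in \<open>auto simp: w_def dist_norm abs_minus_commute\<close>)
qed

section \<open>The Hamiltonian flow\<close>

context sub_riemannian_manifold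
begin

section \<open>The Hamiltonian in coordinates and Hamilton's equations under a change of
  chart\<close>

definition Bc :: "('a, 'n) chart \<Rightarrow> 'n \<Rightarrow> 'n \<Rightarrow> real ^ 'n \<Rightarrow> real" where
  "Bc c i j = \<beta>_comp A H ip c i j \<circ> cinv c"

definition dB :: "('a, 'n) chart \<Rightarrow> 'n \<Rightarrow> 'n \<Rightarrow> real ^ 'n \<Rightarrow> real ^ 'n \<Rightarrow> real" where
  "dB c i j y v = frechet_derivative (Bc c i j) (at y) v"

definition ham :: "('a, 'n) chart \<Rightarrow> real ^ 'n \<Rightarrow> real ^ 'n \<Rightarrow> real" where
  "ham c y \<eta> = (\<Sum>i\<in>UNIV. \<Sum>j\<in>UNIV. Bc c i j y * \<eta> $ i * \<eta> $ j) / 2"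

definition ham_pos :: "('a, 'n) chart \<Rightarrow> real ^ 'n \<Rightarrow> real ^ 'n \<Rightarrow> real ^ 'n" where
  "ham_pos c y \<eta> = (\<chi> i. \<Sum>j\<in>UNIV. Bc c i j y * \<eta> $ j)"

text \<open>The gradient in the position variable, without sign; the minus of Hamilton's second
  equation appears where it is used.\<close>

definition ham_mom :: "('a, 'n) chart \<Rightarrow> real ^ 'n \<Rightarrow> real ^ 'n \<Rightarrow> real ^ 'n" where
  "ham_mom c y \<eta> = (\<chi> l. (\<Sum>i\<in>UNIV. \<Sum>j\<in>UNIV. dB c i j y (axis l 1) * \<eta> $ i * \<eta> $ j) / 2)"

lemma Bc_sym: "Bc c i j y = Bc c j i y"
  by (simp add: Bc_def \<beta>_comp_sym)

lemma smooth_Bc: "c \<in> A \<Longrightarrow> smooth_on (cmap c ` cdom c) (Bc c i j)"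
  unfolding Bc_def by (rule smooth_\<beta>_comp)

lemma smooth_dB: "c \<in> A \<Longrightarrow> smooth_on (cmap c ` cdom c) (\<lambda>y. dB c i j y v)"
  unfolding dB_def by (rule smooth_on_frechet_derivative[OF smooth_Bc])

lemma Bc_has_derivative: "c \<in> A \<Longrightarrow> y \<in> cmap c ` cdom c \<Longrightarrow> (Bc c i j has_derivative dB c i j y) (at y)"
  using smooth_on_has_derivative[OF smooth_Bc] unfolding dB_def[abs_def] by simp

lemma dB_axis_sum:
  "c \<in> A \<Longrightarrow> y \<in> cmap c ` cdom c \<Longrightarrow> dB c i j y v = (\<Sum>l\<in>UNIV. v $ l * dB c i j y (axis l 1))"
  unfolding dB_def by (rule frechet_derivative_axis_sum[OF smooth_on_differentiable[OF smooth_Bc]])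

lemma ham_in_chart:
  assumes "c \<in> A" "q \<in> cdom c"
  shows "hamiltonian H ip q p = ham c (cmap c q) (ccomp A c q p)"
  using assms
  by (simp add: hamiltonian_def ip_cometric[OF cometric_in] covec_cometric ham_def Bc_def cinv_cmap)

lemma hamiltonian_in_chart_eq:
  assumes "c \<in> A" "y \<in> cmap c ` cdom c"
  shows "hamiltonian_in_chart A H ip c y \<eta> = ham c y \<eta>"
proof -
  have q: "cinv c y \<in> cdom c" using cinv_in[OF assms] .
  show ?thesis
    unfolding hamiltonian_in_chart_def cform_def[symmetric]
    using ham_in_chart[OF assms(1) q] ccomp_cform[OF assms(1) q] cmap_cinv[OF assms] by simp
qed

text \<open>Position and momentum both depend on a parameter in an arbitrary space. Freezing one of
  them gives the partial derivatives in Hamilton's equations; moving both is needed for the change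
  of chart.\<close>

lemma ham_has_derivative:
  assumes c: "c \<in> A" and y: "f z \<in> cmap c ` cdom c"
    and f: "(f has_derivative f') (at z)" and N: "(N has_derivative N') (at z)"
  shows "((\<lambda>z. ham c (f z) (N z)) has_derivative
    (\<lambda>u. ham_mom c (f z) (N z) \<bullet> f' u + ham_pos c (f z) (N z) \<bullet> N' u)) (at z)"
proof -
  have 1: "((\<lambda>z. Bc c i j (f z)) has_derivative (\<lambda>u. dB c i j (f z) (f' u))) (at z)" for i j
    using diff_chain_at[OF f Bc_has_derivative[OF c y]] by (simp add: o_def)
  have 2: "((\<lambda>z. N z $ i) has_derivative (\<lambda>u. N' u $ i)) (at z)" for i
    by (rule bounded_linear.has_derivative[OF bounded_linear_vec_nth N])
  have 3: "((\<lambda>z. Bc c i j (f z) * N z $ i * N z $ j) has_derivative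
      (\<lambda>u. dB c i j (f z) (f' u) * N z $ i * N z $ j + Bc c i j (f z) * N' u $ i * N z $ j
        + Bc c i j (f z) * N z $ i * N' u $ j)) (at z)" for i j
    by (rule derivative_eq_intros 1 2 refl)+ (auto simp: algebra_simps)
  have 4: "((\<lambda>z. ham c (f z) (N z)) has_derivative
      (\<lambda>u. (\<Sum>i\<in>UNIV. \<Sum>j\<in>UNIV. dB c i j (f z) (f' u) * N z $ i * N z $ j + Bc c i j (f z) * N' u $ i * N z $ j
        + Bc c i j (f z) * N z $ i * N' u $ j) / 2)) (at z)"
    unfolding ham_def
    by (rule bounded_linear.has_derivative[OF bounded_linear_divide]) (intro has_derivative_sum 3)
  have "(\<Sum>i\<in>UNIV. \<Sum>j\<in>UNIV. dB c i j (f z) (f' u) * N z $ i * N z $ j + Bc c i j (f z) * N' u $ i * N z $ j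
        + Bc c i j (f z) * N z $ i * N' u $ j) / 2
     = ham_mom c (f z) (N z) \<bullet> f' u + ham_pos c (f z) (N z) \<bullet> N' u" for u
  proof -
    \<comment> \<open>Symmetry of \<beta> identifies the two terms with a differentiated momentum,
      which absorbs the factor 1/2.\<close>
    have a: "(\<Sum>i\<in>UNIV. \<Sum>j\<in>UNIV. Bc c i j (f z) * N z $ i * N' u $ j)
        = (\<Sum>i\<in>UNIV. \<Sum>j\<in>UNIV. Bc c i j (f z) * N' u $ i * N z $ j)"
      by (subst sum.swap, intro sum.cong refl) (subst Bc_sym, simp)
    have b: "(\<Sum>i\<in>UNIV. \<Sum>j\<in>UNIV. Bc c i j (f z) * N' u $ i * N z $ j) = ham_pos c (f z) (N z) \<bullet> N' u"
      by (simp add: ham_pos_def inner_vec_def sum_distrib_left sum_distrib_right mult_ac)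
    have "(\<Sum>i\<in>UNIV. \<Sum>j\<in>UNIV. dB c i j (f z) (f' u) * N z $ i * N z $ j)
       = (\<Sum>i\<in>UNIV. \<Sum>j\<in>UNIV. \<Sum>l\<in>UNIV. dB c i j (f z) (axis l 1) * N z $ i * N z $ j * f' u $ l)"
      by (simp add: dB_axis_sum[OF c y, of _ _ "f' u"] sum_distrib_left sum_distrib_right mult_ac)
    also have "\<dots> = (\<Sum>i\<in>UNIV. \<Sum>l\<in>UNIV. \<Sum>j\<in>UNIV. dB c i j (f z) (axis l 1) * N z $ i * N z $ j * f' u $ l)"
      by (intro sum.cong refl sum.swap)
    also have "\<dots> = (\<Sum>l\<in>UNIV. \<Sum>i\<in>UNIV. \<Sum>j\<in>UNIV. dB c i j (f z) (axis l 1) * N z $ i * N z $ j * f' u $ l)"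
      by (rule sum.swap)
    also have "\<dots> / 2 = ham_mom c (f z) (N z) \<bullet> f' u"
      by (simp add: ham_mom_def inner_vec_def sum_distrib_right sum_divide_distrib)
    finally have "(\<Sum>i\<in>UNIV. \<Sum>j\<in>UNIV. dB c i j (f z) (f' u) * N z $ i * N z $ j) / 2 = ham_mom c (f z) (N z) \<bullet> f' u" .
    then show ?thesis by (simp add: sum.distrib a b add_divide_distrib)
  qed
  then show ?thesis using 4 by (simp only:)
qed

definition solves_at :: "('a, 'n) chart \<Rightarrow> (real \<Rightarrow> 'a \<times> 'n covec) \<Rightarrow> real \<Rightarrow> bool" where
  "solves_at c \<gamma> t \<longleftrightarrow>
    (let y = cmap c (fst (\<gamma> t)); \<eta> = ccomp A c (fst (\<gamma> t)) (snd (\<gamma> t)) in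
      ((\<lambda>s. cmap c (fst (\<gamma> s))) has_vector_derivative ham_pos c y \<eta>) (at t) \<and>
      ((\<lambda>s. ccomp A c (fst (\<gamma> s)) (snd (\<gamma> s))) has_vector_derivative - ham_mom c y \<eta>) (at t))"

lemma hamilton_solution_iff:
  "hamilton_solution A H ip I \<gamma> \<longleftrightarrow> continuous_on I (\<lambda>s. fst (\<gamma> s)) \<and>
    (\<forall>t\<in>I. \<forall>c\<in>A. fst (\<gamma> t) \<in> cdom c \<longrightarrow> solves_at c \<gamma> t)"
proof -
  have p: "(\<chi> i. frechet_derivative (\<lambda>\<eta>'. hamiltonian_in_chart A H ip c y \<eta>') (at \<eta>) (axis i 1)) = ham_pos c y \<eta>"
    if "c \<in> A" "y \<in> cmap c ` cdom c" for c y \<eta>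
  proof -
    have "((\<lambda>\<eta>'. hamiltonian_in_chart A H ip c y \<eta>') has_derivative (\<lambda>u. ham_pos c y \<eta> \<bullet> u)) (at \<eta>)"
      using ham_has_derivative[of c "\<lambda>_. y" \<eta>, OF that has_derivative_const has_derivative_ident]
      by (simp add: hamiltonian_in_chart_eq[OF that])
    from frechet_derivative_at[OF this, symmetric] show ?thesis
      by (simp add: inner_axis vec_eq_iff)
  qed
  have d: "(\<chi> i. - frechet_derivative (\<lambda>y'. hamiltonian_in_chart A H ip c y' \<eta>) (at y) (axis i 1)) = - ham_mom c y \<eta>"
    if "c \<in> A" "y \<in> cmap c ` cdom c" for c y \<eta>
  proof -
    have "((\<lambda>y'. ham c y' \<eta>) has_derivative (\<lambda>u. ham_mom c y \<eta> \<bullet> u)) (at y)"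
      using ham_has_derivative[of c "\<lambda>y. y" y, OF that has_derivative_ident has_derivative_const[of \<eta>]] by simp
    then have "((\<lambda>y'. hamiltonian_in_chart A H ip c y' \<eta>) has_derivative (\<lambda>u. ham_mom c y \<eta> \<bullet> u)) (at y)"
      by (rule has_derivative_transform_within_open[OF _ open_cmap_cdom[OF that(1)] that(2)])
         (simp add: hamiltonian_in_chart_eq[OF that(1)])
    from frechet_derivative_at[OF this, symmetric] show ?thesis
      by (simp add: inner_axis vec_eq_iff)
  qed
  show ?thesis
    unfolding hamilton_solution_def solves_at_def Let_def
    by (simp add: p d cong: conj_cong)
qed

text \<open>The position equation transforms because the velocity \<beta>(p) is a tangent vector.
  With \<psi> the coordinate change from \<open>c'\<close> to \<open>c\<close>, the momenta satisfy
  \<eta>' = \<eta> \<circ> D\<psi> along the curve, and the product rule adds a term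
  \<eta>(D^2\<psi>). The position gradient of the Hamiltonian at fixed \<eta>' contains the same
  term, as computed in \<open>mom\<close>, and the two match.\<close>

lemma solves_at_change_chart:
  assumes c: "c \<in> A" "c' \<in> A" and q: "fst (\<gamma> t) \<in> cdom c" "fst (\<gamma> t) \<in> cdom c'"
    and I: "open I" "t \<in> I" and dom: "\<And>s. s \<in> I \<Longrightarrow> fst (\<gamma> s) \<in> cdom c" "\<And>s. s \<in> I \<Longrightarrow> fst (\<gamma> s) \<in> cdom c'"
    and sol: "solves_at c \<gamma> t"
  shows "solves_at c' \<gamma> t"
proof -
  define x where "x = fst (\<gamma> t)"
  define p where "p = snd (\<gamma> t)"
  define y where "y s = cmap c (fst (\<gamma> s))" for s
  define y' where "y' s = cmap c' (fst (\<gamma> s))" for s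
  define \<eta> where "\<eta> s = ccomp A c (fst (\<gamma> s)) (snd (\<gamma> s))" for s
  define \<eta>' where "\<eta>' s = ccomp A c' (fst (\<gamma> s)) (snd (\<gamma> s))" for s
  define v where "v = ham_pos c (y t) (\<eta> t)"
  define w where "w = ham_pos c' (y' t) (\<eta>' t)"
  define W where "W = cmap c' ` (cdom c' \<inter> cdom c)"
  have oW: "open W" unfolding W_def by (rule open_overlap) fact+
  have yt: "y' t \<in> W" using q by (auto simp: W_def y'_def)
  have sol': "(y has_vector_derivative v) (at t)" "(\<eta> has_vector_derivative - ham_mom c (y t) (\<eta> t)) (at t)"
    using sol by (simp_all add: solves_at_def Let_def y_def[abs_def] \<eta>_def[abs_def] v_def)
  have v: "v = tcomp A c x (cometric H ip x p)" and w: "w = tcomp A c' x (cometric H ip x p)"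
    using q c by (simp_all add: vec_eq_iff tcomp_cometric x_def p_def v_def w_def ham_pos_def y_def y'_def
        \<eta>_def \<eta>'_def Bc_def cinv_cmap)
  have wv: "dtrans c c' x v = w" and vw: "dtrans c' c x w = v"
    unfolding v w using dtrans_tcomp c q by (simp_all add: x_def)
  have y'_deriv: "(y' has_vector_derivative w) (at t)"
  proof -
    have "((cmap c' \<circ> cinv c) has_derivative dtrans c c' x) (at (y t))"
      using has_derivative_transition c q by (simp add: x_def y_def)
    from diff_chain_at[OF sol'(1)[unfolded has_vector_derivative_def] this]
    have "((\<lambda>s. (cmap c' \<circ> cinv c) (y s)) has_derivative (\<lambda>h. dtrans c c' x (h *\<^sub>R v))) (at t)"
      by (simp add: o_def)
    then have "((\<lambda>s. (cmap c' \<circ> cinv c) (y s)) has_vector_derivative w) (at t)"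
      using linear_cmul[OF linear_dtrans[of c c' x]] c q
      by (simp add: has_vector_derivative_def wv[unfolded x_def] x_def)
    then show ?thesis
      by (rule has_vector_derivative_transform_within_open[OF _ I])
         (use dom c in \<open>simp add: y_def y'_def cinv_cmap\<close>)
  qed
  define \<psi> where "\<psi> = cmap c \<circ> cinv c'"
  have sm_\<psi>: "smooth_on W \<psi>" unfolding W_def \<psi>_def by (rule smooth_on_transition) fact+
  have \<psi>: "\<psi> z \<in> cmap c ` (cdom c \<inter> cdom c')" if "z \<in> W" for z
    using that c by (auto simp: W_def \<psi>_def cinv_cmap)
  have d\<psi>: "frechet_derivative \<psi> (at (cmap c' r)) u = dtrans c' c r u" for r u
    by (simp add: \<psi>_def dtrans_def)
  \<comment> \<open>The components in \<open>c\<close> of the covector field whose components in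
    \<open>c'\<close> are frozen at \<eta>'(t). The Hamiltonian has the same value on this field in
    both charts, and differentiating that identity compares the two position gradients.\<close>
  define N where "N z = ccomp A c (cinv c' z) (cform A c' (cinv c' z) (\<eta>' t))" for z
  have N_inner: "N z \<bullet> u = \<eta>' t \<bullet> dtrans c c' (cinv c' z) u" if "z \<in> W" for z u
  proof -
    have r: "cinv c' z \<in> cdom c" "cinv c' z \<in> cdom c'" using that c by (auto simp: W_def cinv_cmap)
    show ?thesis unfolding N_def
      using ccomp_dtrans[OF c r, of "cform A c' (cinv c' z) (\<eta>' t)" u] ccomp_cform[OF c(2) r(2)] by simp
  qed
  have N_t: "N (y' t) = \<eta> t"
    using c q by (simp add: N_def y'_def cinv_cmap \<eta>'_def \<eta>_def cform_ccomp)
  have sm_N: "smooth_on W N"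
  proof -
    have "smooth_on W (\<lambda>z. \<Sum>j\<in>UNIV. (frechet_derivative (cmap c' \<circ> cinv c) (at (\<psi> z)) (axis j 1) \<bullet> \<eta>' t) *\<^sub>R (axis j 1 :: real ^ 'n))"
      using \<psi> c
      by (intro smooth_on_sum smooth_on_scaleR smooth_on_const smooth_on_bounded_linear_comp[OF _ bounded_linear_inner_left]
          smooth_on_compose[OF oW open_overlap[of c c'] _ sm_\<psi>] smooth_on_frechet_derivative[OF smooth_on_transition] oW) auto
    then show ?thesis
    proof (rule smooth_on_cong[OF oW, rotated])
      fix z assume z: "z \<in> W"
      have "\<psi> z = cmap c (cinv c' z)" by (simp add: \<psi>_def)
      then have "N z \<bullet> axis j 1 = frechet_derivative (cmap c' \<circ> cinv c) (at (\<psi> z)) (axis j 1) \<bullet> \<eta>' t" for j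
        unfolding N_inner[OF z] by (simp add: dtrans_def inner_commute)
      then show "(\<Sum>j\<in>UNIV. (frechet_derivative (cmap c' \<circ> cinv c) (at (\<psi> z)) (axis j 1) \<bullet> \<eta>' t) *\<^sub>R axis j 1) = N z"
        using vec_axis_sum[of "N z"] by (simp add: inner_axis)
    qed
  qed
  have mom: "ham_mom c' (y' t) (\<eta>' t) \<bullet> u = ham_mom c (y t) (\<eta> t) \<bullet> dtrans c' c x u
      - \<eta> t \<bullet> frechet_derivative (\<lambda>z. frechet_derivative \<psi> (at z) u) (at (y' t)) w" for u
  proof -
    have \<psi>_t: "\<psi> (y' t) = y t" using c q by (simp add: \<psi>_def y'_def y_def cinv_cmap)
    have h1: "((\<lambda>z. ham c' z (\<eta>' t)) has_derivative (\<lambda>u. ham_mom c' (y' t) (\<eta>' t) \<bullet> u)) (at (y' t))"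
      using ham_has_derivative[of c' "\<lambda>y. y" "y' t", OF c(2) _ has_derivative_ident has_derivative_const[of "\<eta>' t"]]
        q by (simp add: y'_def)
    have h2: "((\<lambda>z. ham c (\<psi> z) (N z)) has_derivative
       (\<lambda>u. ham_mom c (y t) (\<eta> t) \<bullet> frechet_derivative \<psi> (at (y' t)) u
          + ham_pos c (y t) (\<eta> t) \<bullet> frechet_derivative N (at (y' t)) u)) (at (y' t))"
      using ham_has_derivative[of c \<psi> "y' t", OF c(1) _ smooth_on_has_derivative[OF sm_\<psi> yt]
          smooth_on_has_derivative[OF sm_N yt]] \<psi>[OF yt] by (auto simp: \<psi>_t N_t)
    have "ham c (\<psi> z) (N z) = ham c' z (\<eta>' t)" if "z \<in> W" for z
    proof -
      have r: "cinv c' z \<in> cdom c" "cinv c' z \<in> cdom c'" "cmap c' (cinv c' z) = z"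
        using that c by (auto simp: W_def cinv_cmap)
      show ?thesis
        using ham_in_chart[OF c(1) r(1), of "cform A c' (cinv c' z) (\<eta>' t)"]
          ham_in_chart[OF c(2) r(2), of "cform A c' (cinv c' z) (\<eta>' t)"] r
        by (simp add: \<psi>_def N_def ccomp_cform[OF c(2) r(2)])
    qed
    then have "((\<lambda>z. ham c' z (\<eta>' t)) has_derivative
       (\<lambda>u. ham_mom c (y t) (\<eta> t) \<bullet> frechet_derivative \<psi> (at (y' t)) u
          + ham_pos c (y t) (\<eta> t) \<bullet> frechet_derivative N (at (y' t)) u)) (at (y' t))"
      by (rule has_derivative_transform_within_open[OF h2 oW yt])
    then have "(\<lambda>u. ham_mom c' (y' t) (\<eta>' t) \<bullet> u) = (\<lambda>u. ham_mom c (y t) (\<eta> t) \<bullet> frechet_derivative \<psi> (at (y' t)) u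
          + ham_pos c (y t) (\<eta> t) \<bullet> frechet_derivative N (at (y' t)) u)"
      by (rule has_derivative_unique[OF h1])
    then have 1: "ham_mom c' (y' t) (\<eta>' t) \<bullet> u = ham_mom c (y t) (\<eta> t) \<bullet> frechet_derivative \<psi> (at (y' t)) u
          + v \<bullet> frechet_derivative N (at (y' t)) u" unfolding v_def by (rule fun_cong)
    \<comment> \<open>The function \<open>z \<mapsto> N z \<bullet> D\<psi>(z) w\<close> is constant; differentiating it trades \<open>DN\<close> for \<open>D\<^sup>2\<psi>\<close>.\<close>
    have sm_d: "smooth_on W (\<lambda>z. frechet_derivative \<psi> (at z) w)" by (rule smooth_on_frechet_derivative[OF sm_\<psi>])
    have "((\<lambda>z. N z \<bullet> frechet_derivative \<psi> (at z) w) has_derivative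
       (\<lambda>u. N (y' t) \<bullet> frechet_derivative (\<lambda>z. frechet_derivative \<psi> (at z) w) (at (y' t)) u
          + frechet_derivative N (at (y' t)) u \<bullet> frechet_derivative \<psi> (at (y' t)) w)) (at (y' t))"
      by (rule has_derivative_inner[OF smooth_on_has_derivative[OF sm_N yt] smooth_on_has_derivative[OF sm_d yt]])
    moreover have "((\<lambda>z. N z \<bullet> frechet_derivative \<psi> (at z) w) has_derivative (\<lambda>u. 0)) (at (y' t))"
    proof (rule has_derivative_transform_within_open[OF has_derivative_const[of "\<eta>' t \<bullet> w"] oW yt])
      fix z assume z: "z \<in> W"
      then obtain r where r: "r \<in> cdom c'" "r \<in> cdom c" "z = cmap c' r" by (auto simp: W_def)
      show "\<eta>' t \<bullet> w = N z \<bullet> frechet_derivative \<psi> (at z) w"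
        unfolding N_inner[OF z] using r c by (simp add: d\<psi> cinv_cmap dtrans_inverse)
    qed
    ultimately have "(\<lambda>u. N (y' t) \<bullet> frechet_derivative (\<lambda>z. frechet_derivative \<psi> (at z) w) (at (y' t)) u
          + frechet_derivative N (at (y' t)) u \<bullet> frechet_derivative \<psi> (at (y' t)) w) = (\<lambda>u. 0)"
      by (rule has_derivative_unique)
    then have "N (y' t) \<bullet> frechet_derivative (\<lambda>z. frechet_derivative \<psi> (at z) w) (at (y' t)) u
          + frechet_derivative N (at (y' t)) u \<bullet> frechet_derivative \<psi> (at (y' t)) w = 0" by (rule fun_cong)
    then have 2: "v \<bullet> frechet_derivative N (at (y' t)) u
       = - (\<eta> t \<bullet> frechet_derivative (\<lambda>z. frechet_derivative \<psi> (at z) u) (at (y' t)) w)"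
      using symmetric_second_derivative[OF oW yt sm_\<psi>, of w u] vw
      by (simp add: N_t[unfolded y'_def] inner_commute y'_def d\<psi> x_def)
    show ?thesis using 1 2 by (simp add: y'_def d\<psi> x_def)
  qed
  have \<eta>'_deriv: "(\<eta>' has_vector_derivative - ham_mom c' (y' t) (\<eta>' t)) (at t)"
  proof -
    have comp: "((\<lambda>s. \<eta>' s \<bullet> u) has_real_derivative - (ham_mom c' (y' t) (\<eta>' t) \<bullet> u)) (at t)" for u
    proof -
      let ?\<Psi> = "\<lambda>z. frechet_derivative \<psi> (at z) u"
      have "(?\<Psi> has_derivative frechet_derivative ?\<Psi> (at (y' t))) (at (y' t))"
        by (rule smooth_on_has_derivative[OF smooth_on_frechet_derivative[OF sm_\<psi>] yt])
      from diff_chain_at[OF y'_deriv[unfolded has_vector_derivative_def] this]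
      have D: "((\<lambda>s. ?\<Psi> (y' s)) has_derivative (\<lambda>h. frechet_derivative ?\<Psi> (at (y' t)) (h *\<^sub>R w))) (at t)"
        by (simp add: o_def)
      have l: "frechet_derivative ?\<Psi> (at (y' t)) (h *\<^sub>R w) = h *\<^sub>R frechet_derivative ?\<Psi> (at (y' t)) w" for h
        by (rule linear_cmul[OF linear_frechet_derivative[OF smooth_on_differentiable[OF smooth_on_frechet_derivative[OF sm_\<psi>] yt]]])
      have "((\<lambda>s. \<eta> s \<bullet> ?\<Psi> (y' s)) has_derivative
          (\<lambda>h. \<eta> t \<bullet> (h *\<^sub>R frechet_derivative ?\<Psi> (at (y' t)) w) + (h *\<^sub>R - ham_mom c (y t) (\<eta> t)) \<bullet> ?\<Psi> (y' t))) (at t)"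
        using has_derivative_inner[OF sol'(2)[unfolded has_vector_derivative_def] D] by (simp add: l)
      moreover have "\<eta> t \<bullet> (h *\<^sub>R frechet_derivative ?\<Psi> (at (y' t)) w) + (h *\<^sub>R - ham_mom c (y t) (\<eta> t)) \<bullet> ?\<Psi> (y' t)
         = - (ham_mom c' (y' t) (\<eta>' t) \<bullet> u) * h" for h
        unfolding mom by (simp add: y'_def d\<psi> x_def algebra_simps)
      ultimately have "((\<lambda>s. \<eta> s \<bullet> ?\<Psi> (y' s)) has_real_derivative - (ham_mom c' (y' t) (\<eta>' t) \<bullet> u)) (at t)"
        by (simp only: has_field_derivative_def)
      then show ?thesis
      proof (rule has_field_derivative_transform_within_open[OF _ I])
        fix s assume s: "s \<in> I"
        show "\<eta> s \<bullet> ?\<Psi> (y' s) = \<eta>' s \<bullet> u"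
          using ccomp_dtrans[OF c dom[OF s], of _ "dtrans c' c (fst (\<gamma> s)) u"] dtrans_inverse[OF c(2,1) dom(2,1)[OF s]]
          by (simp add: \<eta>_def \<eta>'_def y'_def d\<psi>)
      qed
    qed
    have "((\<lambda>s. \<Sum>i\<in>UNIV. (\<eta>' s \<bullet> axis i 1) *\<^sub>R (axis i 1 :: real ^ 'n)) has_vector_derivative
        (\<Sum>i\<in>UNIV. (- (ham_mom c' (y' t) (\<eta>' t) \<bullet> axis i 1)) *\<^sub>R (axis i 1 :: real ^ 'n))) (at t)"
      by (intro has_vector_derivative_sum bounded_linear.has_vector_derivative[OF bounded_linear_scaleR_left]
          comp[unfolded has_real_derivative_iff_has_vector_derivative])
    moreover have "(\<Sum>i\<in>UNIV. (- (z \<bullet> axis i 1)) *\<^sub>R (axis i 1 :: real ^ 'n)) = - z" for z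
      using vec_axis_sum[of z] by (simp add: inner_axis sum_negf)
    moreover have "(\<Sum>i\<in>UNIV. (z \<bullet> axis i 1) *\<^sub>R (axis i 1 :: real ^ 'n)) = z" for z
      using vec_axis_sum[of z] by (simp add: inner_axis)
    ultimately show ?thesis by simp
  qed
  show ?thesis
    using y'_deriv \<eta>'_deriv by (simp add: solves_at_def Let_def y'_def[abs_def] \<eta>'_def[abs_def] w_def)
qed

end

context sub_riemannian_manifold
begin

section \<open>Local existence and uniqueness of Hamiltonian curves\<close>

definition ham_field :: "('a, 'n) chart \<Rightarrow> (real ^ 'n) \<times> (real ^ 'n) \<Rightarrow> (real ^ 'n) \<times> (real ^ 'n)" where
  "ham_field c w = (ham_pos c (fst w) (snd w), - ham_mom c (fst w) (snd w))"

definition lift :: "('a, 'n) chart \<Rightarrow> (real \<Rightarrow> 'a \<times> 'n covec) \<Rightarrow> real \<Rightarrow> (real ^ 'n) \<times> (real ^ 'n)" where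
  "lift c \<gamma> s = (cmap c (fst (\<gamma> s)), ccomp A c (fst (\<gamma> s)) (snd (\<gamma> s)))"

lemma solves_at_lift:
  "solves_at c \<gamma> t \<longleftrightarrow> (lift c \<gamma> has_vector_derivative ham_field c (lift c \<gamma> t)) (at t)"
proof
  assume "solves_at c \<gamma> t"
  then show "(lift c \<gamma> has_vector_derivative ham_field c (lift c \<gamma> t)) (at t)"
    unfolding solves_at_def Let_def lift_def[abs_def] ham_field_def
    by (simp add: has_vector_derivative_Pair)
next
  assume a: "(lift c \<gamma> has_vector_derivative ham_field c (lift c \<gamma> t)) (at t)"
  show "solves_at c \<gamma> t"
    using bounded_linear.has_vector_derivative[OF bounded_linear_fst a]
      bounded_linear.has_vector_derivative[OF bounded_linear_snd a]
    unfolding solves_at_def Let_def lift_def[abs_def] ham_field_def by simp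
qed

lemma smooth_ham_field:
  assumes "c \<in> A"
  shows "open ((cmap c ` cdom c) \<times> (UNIV :: (real ^ 'n) set))" (is "open ?S")
    and "smooth_on ((cmap c ` cdom c) \<times> UNIV) (ham_field c)"
proof -
  show oS: "open ?S" by (intro open_Times open_cmap_cdom assms open_UNIV)
  have sc: "smooth_on ?S (\<lambda>w. snd w $ i)" for i
    by (intro smooth_on_bounded_linear_comp[OF oS bounded_linear_vec_nth] smooth_on_bounded_linear bounded_linear_snd)
  have sf: "smooth_on ?S (\<lambda>w. f (fst w))" if "smooth_on (cmap c ` cdom c) f" for f :: "real ^ 'n \<Rightarrow> real"
    by (rule smooth_on_compose[OF oS open_cmap_cdom[OF assms] _ smooth_on_bounded_linear[OF bounded_linear_fst] that]) auto
  have pos: "smooth_on ?S (\<lambda>w. ham_pos c (fst w) (snd w) $ i)" for i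
    unfolding ham_pos_def
    by (simp, intro smooth_on_sum smooth_on_mult sc sf smooth_Bc assms oS)
  have mom: "smooth_on ?S (\<lambda>w. - ham_mom c (fst w) (snd w) $ i)" for i
    unfolding ham_mom_def
    by (simp, intro smooth_on_minus smooth_on_divide smooth_on_const smooth_on_sum smooth_on_mult sc sf smooth_dB assms oS) simp
  have s1: "smooth_on ?S (\<lambda>w. (\<Sum>i\<in>UNIV. ham_pos c (fst w) (snd w) $ i *\<^sub>R (axis i 1 :: real ^ 'n, 0 :: real ^ 'n))
      + (\<Sum>i\<in>UNIV. (- ham_mom c (fst w) (snd w) $ i) *\<^sub>R (0 :: real ^ 'n, axis i 1 :: real ^ 'n)))"
    by (intro smooth_on_add smooth_on_sum smooth_on_scaleR pos mom smooth_on_const oS)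
  have e1: "(\<Sum>i\<in>UNIV. x $ i *\<^sub>R (axis i 1 :: real ^ 'n, 0 :: real ^ 'n)) = (x, 0)" for x
    using vec_axis_sum[of x] by (simp add: prod_eq_iff fst_sum snd_sum)
  have e2: "(\<Sum>i\<in>UNIV. (- x $ i) *\<^sub>R (0 :: real ^ 'n, axis i 1 :: real ^ 'n)) = (0, - x)" for x
    using vec_axis_sum[of "- x"] by (simp add: prod_eq_iff fst_sum snd_sum)
  from s1 show "smooth_on ?S (ham_field c)"
    unfolding ham_field_def[abs_def] by (simp only: e1 e2 add_Pair add_0_left add_0_right)
qed

lemma Ck_ham_field: "c \<in> A \<Longrightarrow> Ck_on 1 ((cmap c ` cdom c) \<times> UNIV) (ham_field c)"
  using smooth_ham_field(2) unfolding smooth_on_def by blast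

text \<open>The system is solved in coordinates of one chart and carried back to the cotangent
  bundle. In any other chart met by the curve the equations hold by
  \<open>solves_at_change_chart\<close>.\<close>

lemma hamilton_solution_exists:
  assumes c: "c \<in> A" "x \<in> cdom c"
  obtains \<delta> \<gamma> where "\<delta> > 0" "\<gamma> 0 = (x, p)" "hamilton_solution A H ip {- \<delta><..<\<delta>} \<gamma>"
    "\<And>t. t \<in> {- \<delta><..<\<delta>} \<Longrightarrow> fst (\<gamma> t) \<in> cdom c"
proof -
  have "(cmap c x, ccomp A c x p) \<in> (cmap c ` cdom c) \<times> UNIV" using c by simp
  from Picard_Lindeloef[OF smooth_ham_field(1)[OF c(1)] this Ck_ham_field[OF c(1)]]
  obtain \<delta> u where u: "\<delta> > 0" "u 0 = (cmap c x, ccomp A c x p)"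
    "\<And>t. t \<in> {- \<delta><..<\<delta>} \<Longrightarrow> u t \<in> (cmap c ` cdom c) \<times> UNIV"
    "\<And>t. t \<in> {- \<delta><..<\<delta>} \<Longrightarrow> (u has_vector_derivative ham_field c (u t)) (at t)" by metis
  have uD: "fst (u t) \<in> cmap c ` cdom c" if "t \<in> {- \<delta><..<\<delta>}" for t
    using u(3)[OF that] by (simp add: mem_Times_iff)
  define \<gamma> where "\<gamma> t = (cinv c (fst (u t)), cform A c (cinv c (fst (u t))) (snd (u t)))" for t
  have dom: "fst (\<gamma> t) \<in> cdom c" if "t \<in> {- \<delta><..<\<delta>}" for t
    using u(3)[OF that] cinv_in[OF c(1)] by (auto simp: \<gamma>_def)
  have lift: "lift c \<gamma> t = u t" if "t \<in> {- \<delta><..<\<delta>}" for t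
  proof -
    have "fst (u t) \<in> cmap c ` cdom c" using u(3)[OF that] by auto
    then show ?thesis
      using cmap_cinv[OF c(1)] ccomp_cform[OF c(1) cinv_in[OF c(1)]]
      by (simp add: lift_def \<gamma>_def prod_eq_iff)
  qed
  have sol: "solves_at c \<gamma> t" if "t \<in> {- \<delta><..<\<delta>}" for t
    unfolding solves_at_lift lift[OF that]
    by (rule has_vector_derivative_transform_within_open[OF u(4)[OF that] open_greaterThanLessThan that])
       (simp add: lift)
  have cu: "continuous_on {- \<delta><..<\<delta>} u"
    using u(4) has_vector_derivative_continuous by (intro continuous_at_imp_continuous_on) blast
  have cont: "continuous_on {- \<delta><..<\<delta>} (\<lambda>s. fst (\<gamma> s))"
    unfolding \<gamma>_def fst_conv
    by (rule continuous_on_compose2[OF continuous_on_cinv[OF c(1)] continuous_on_fst[OF cu]]) (use uD in blast)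
  show ?thesis
  proof (rule that[OF u(1) _ _ dom])
    show "\<gamma> 0 = (x, p)" using c by (simp add: \<gamma>_def u(2) cinv_cmap cform_ccomp)
    show "hamilton_solution A H ip {- \<delta><..<\<delta>} \<gamma>"
      unfolding hamilton_solution_iff
    proof (intro conjI ballI impI cont)
      fix t c' assume t: "t \<in> {- \<delta><..<\<delta>}" and c': "c' \<in> A" "fst (\<gamma> t) \<in> cdom c'"
      \<comment> \<open>The open set of times at which the curve lies in both charts, the
        neighbourhood required for the change of chart.\<close>
      have "open ({- \<delta><..<\<delta>} \<inter> (\<lambda>s. fst (\<gamma> s)) -` cdom c')"
        by (rule continuous_open_preimage[OF cont open_greaterThanLessThan open_cdom[OF c'(1)]])
      then show "solves_at c' \<gamma> t"
        by (rule solves_at_change_chart[where \<gamma> = \<gamma> and t = t, OF c(1) c'(1) dom[OF t] c'(2)]) (use t c' dom sol in auto)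
    qed
  qed
qed

text \<open>A connectedness argument. Only the base curve is continuous as a raw function, so
  closedness of the coincidence set is not immediate: its complement \<open>T\<close> is shown to be
  open by Hausdorff separation where the base points differ, and by continuity of the lifts to a
  common chart where only the covectors differ. Openness of \<open>S\<close> is local uniqueness for
  the lifted equation.\<close>

lemma hamilton_solution_unique:
  assumes "hamilton_solution A H ip I \<gamma>" "hamilton_solution A H ip I \<gamma>'"
    and I: "open I" "connected I" "t0 \<in> I" "\<gamma> t0 = \<gamma>' t0" "t \<in> I"
  shows "\<gamma> t = \<gamma>' t"
proof -
  have cont: "continuous_on I (\<lambda>s. fst (\<gamma> s))" "continuous_on I (\<lambda>s. fst (\<gamma>' s))"
    and sol: "\<And>t c. t \<in> I \<Longrightarrow> c \<in> A \<Longrightarrow> fst (\<gamma> t) \<in> cdom c \<Longrightarrow> solves_at c \<gamma> t"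
      "\<And>t c. t \<in> I \<Longrightarrow> c \<in> A \<Longrightarrow> fst (\<gamma>' t) \<in> cdom c \<Longrightarrow> solves_at c \<gamma>' t"
    using assms(1,2) by (auto simp: hamilton_solution_iff)
  define J where "J c = {s \<in> I. fst (\<gamma> s) \<in> cdom c \<and> fst (\<gamma>' s) \<in> cdom c}" for c :: "('a, 'n) chart"
  have oJ: "open (J c)" if "c \<in> A" for c
  proof -
    have "J c = (I \<inter> (\<lambda>s. fst (\<gamma> s)) -` cdom c) \<inter> (I \<inter> (\<lambda>s. fst (\<gamma>' s)) -` cdom c)"
      by (auto simp: J_def)
    then show ?thesis
      using continuous_open_preimage[OF cont(1) I(1) open_cdom[OF that]]
        continuous_open_preimage[OF cont(2) I(1) open_cdom[OF that]] by (simp only: open_Int)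
  qed
  have lift_eq: "\<gamma> s = \<gamma>' s" if "c \<in> A" "s \<in> J c" "lift c \<gamma> s = lift c \<gamma>' s" for c s
  proof -
    have e: "fst (\<gamma> s) = fst (\<gamma>' s)" using that cinv_cmap[OF that(1)] unfolding J_def lift_def by (metis (mono_tags, lifting) mem_Collect_eq prod.inject)
    have d: "fst (\<gamma> s) \<in> cdom c" "fst (\<gamma>' s) \<in> cdom c" using that(2) by (auto simp: J_def)
    have "snd (\<gamma> s) = cform A c (fst (\<gamma> s)) (ccomp A c (fst (\<gamma> s)) (snd (\<gamma> s)))"
      by (rule cform_ccomp[OF that(1) d(1), symmetric])
    also have "\<dots> = cform A c (fst (\<gamma>' s)) (ccomp A c (fst (\<gamma>' s)) (snd (\<gamma>' s)))"
      using that(3) e by (simp add: lift_def)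
    also have "\<dots> = snd (\<gamma>' s)" by (rule cform_ccomp[OF that(1) d(2)])
    finally have "snd (\<gamma> s) = snd (\<gamma>' s)" .
    with e show ?thesis by (rule prod_eqI)
  qed
  define S where "S = {s \<in> I. \<gamma> s = \<gamma>' s}"
  define T where "T = {s \<in> I. \<gamma> s \<noteq> \<gamma>' s}"
  have "open S"
  proof (subst open_subopen, intro ballI)
    fix s assume "s \<in> S"
    then have s: "s \<in> I" "\<gamma> s = \<gamma>' s" by (auto simp: S_def)
    obtain c where c: "c \<in> A" "fst (\<gamma> s) \<in> cdom c" using chart_around by blast
    have sJ: "s \<in> J c" using s c by (simp add: J_def)
    have lu: "lift c \<gamma> s \<in> (cmap c ` cdom c) \<times> UNIV" "lift c \<gamma>' s = lift c \<gamma> s" using c s by (auto simp: lift_def)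
    have d: "(lift c \<gamma> has_vector_derivative ham_field c (lift c \<gamma> r)) (at r)"
       "(lift c \<gamma>' has_vector_derivative ham_field c (lift c \<gamma>' r)) (at r)" if "r \<in> J c" for r
      using sol[of r c] that c(1) by (auto simp: J_def solves_at_lift)
    obtain e where e: "e > 0" "\<And>r. \<bar>r - s\<bar> < e \<Longrightarrow> lift c \<gamma> r = lift c \<gamma>' r"
      using ode_unique_local[OF smooth_ham_field(1)[OF c(1)] Ck_ham_field[OF c(1)] oJ[OF c(1)] sJ lu d] by metis
    have "ball s e \<inter> J c \<subseteq> S"
      using lift_eq[OF c(1)] e(2) by (auto simp: S_def J_def dist_real_def abs_minus_commute)
    then show "\<exists>U. open U \<and> s \<in> U \<and> U \<subseteq> S"
      using oJ[OF c(1)] sJ e(1) by (intro exI[of _ "ball s e \<inter> J c"]) auto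
  qed
  moreover have "open T"
  proof (subst open_subopen, intro ballI)
    fix s assume "s \<in> T"
    then have s: "s \<in> I" "\<gamma> s \<noteq> \<gamma>' s" by (auto simp: T_def)
    show "\<exists>U. open U \<and> s \<in> U \<and> U \<subseteq> T"
    proof (cases "fst (\<gamma> s) = fst (\<gamma>' s)")
      case False
      obtain U U' where U: "open U" "open U'" "fst (\<gamma> s) \<in> U" "fst (\<gamma>' s) \<in> U'" "U \<inter> U' = {}"
        using hausdorff[OF False] by blast
      have "open ((I \<inter> (\<lambda>s. fst (\<gamma> s)) -` U) \<inter> (I \<inter> (\<lambda>s. fst (\<gamma>' s)) -` U'))"
        by (intro open_Int continuous_open_preimage cont I U)
      moreover have "(I \<inter> (\<lambda>s. fst (\<gamma> s)) -` U) \<inter> (I \<inter> (\<lambda>s. fst (\<gamma>' s)) -` U') \<subseteq> T"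
      proof
        fix r assume r: "r \<in> (I \<inter> (\<lambda>s. fst (\<gamma> s)) -` U) \<inter> (I \<inter> (\<lambda>s. fst (\<gamma>' s)) -` U')"
        then have "fst (\<gamma> r) \<noteq> fst (\<gamma>' r)" using U(5) by auto
        then show "r \<in> T" using r by (auto simp: T_def)
      qed
      ultimately show ?thesis using s(1) U(3,4) by blast
    next
      case True
      obtain c where c: "c \<in> A" "fst (\<gamma> s) \<in> cdom c" using chart_around by blast
      have sJ: "s \<in> J c" using s c True by (simp add: J_def)
      have ne: "lift c \<gamma> s - lift c \<gamma>' s \<noteq> 0" using lift_eq[OF c(1) sJ] s(2) by auto
      have "isCont (lift c \<gamma>) s" "isCont (lift c \<gamma>') s"
        using sol[of s c] s(1) c True has_vector_derivative_continuous by (auto simp: solves_at_lift)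
      then have "isCont (\<lambda>r. lift c \<gamma> r - lift c \<gamma>' r) s" by (intro continuous_intros)
      from continuous_at_avoid[OF this ne] obtain e where e: "e > 0"
        "\<And>r. dist s r < e \<Longrightarrow> lift c \<gamma> r - lift c \<gamma>' r \<noteq> 0" by blast
      have "ball s e \<inter> I \<subseteq> T"
      proof
        fix r assume r: "r \<in> ball s e \<inter> I"
        then have "lift c \<gamma> r \<noteq> lift c \<gamma>' r" using e(2)[of r] by auto
        then have "\<gamma> r \<noteq> \<gamma>' r" by (auto simp: lift_def)
        then show "r \<in> T" using r by (simp add: T_def)
      qed
      then show ?thesis using I(1) s(1) e(1) by (intro exI[of _ "ball s e \<inter> I"]) auto
    qed
  qed
  moreover have "I \<subseteq> S \<union> T" "S \<inter> T \<inter> I = {}" by (auto simp: S_def T_def)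
  ultimately have "S \<inter> I = {} \<or> T \<inter> I = {}" using connectedD[OF I(2), of S T] by blast
  moreover have "t0 \<in> S \<inter> I" using I by (auto simp: S_def)
  ultimately show ?thesis using I(5) by (auto simp: T_def)
qed

lemma hamilton_solution_subset:
  "hamilton_solution A H ip I \<gamma> \<Longrightarrow> J \<subseteq> I \<Longrightarrow> hamilton_solution A H ip J \<gamma>"
  unfolding hamilton_solution_iff using continuous_on_subset by blast

text \<open>The description in \<open>hamilton_flow\<close> ranges over solutions on arbitrary
  intervals around 0; any competitor is compared with \<gamma> on the intersection of the two
  intervals.\<close>

lemma hamilton_flow_eq:
  assumes "hamilton_solution A H ip {- \<delta><..<\<delta>} \<gamma>" "\<gamma> 0 = w" "t \<in> {- \<delta><..<\<delta>}"
  shows "hamilton_flow A H ip t w = \<gamma> t"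
  unfolding hamilton_flow_def
proof (rule the_equality)
  show "\<exists>a b \<gamma>'. a < 0 \<and> 0 < b \<and> a < t \<and> t < b \<and> hamilton_solution A H ip {a<..<b} \<gamma>' \<and> \<gamma>' 0 = w \<and> \<gamma>' t = \<gamma> t"
    using assms by (intro exI[of _ "- \<delta>"] exI[of _ \<delta>] exI[of _ \<gamma>]) auto
next
  fix z assume "\<exists>a b \<gamma>'. a < 0 \<and> 0 < b \<and> a < t \<and> t < b \<and> hamilton_solution A H ip {a<..<b} \<gamma>' \<and> \<gamma>' 0 = w \<and> \<gamma>' t = z"
  then obtain a b \<gamma>' where g: "a < 0" "0 < b" "a < t" "t < b" "hamilton_solution A H ip {a<..<b} \<gamma>'" "\<gamma>' 0 = w" "\<gamma>' t = z"
    by blast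
  let ?I = "{max a (- \<delta>)<..<min b \<delta>}"
  have "\<gamma>' t = \<gamma> t"
  proof (rule hamilton_solution_unique[of ?I \<gamma>' \<gamma> 0])
    show "hamilton_solution A H ip ?I \<gamma>'" by (rule hamilton_solution_subset[OF g(5)]) auto
    show "hamilton_solution A H ip ?I \<gamma>" by (rule hamilton_solution_subset[OF assms(1)]) auto
  qed (use g assms(2,3) in auto)
  then show "z = \<gamma> t" using g by simp
qed

text \<open>The first derivative must be identified on a whole interval, not only at 0, before it
  can be differentiated again. The second sum in the result is the gradient of \<open>F\<close>
  paired with the acceleration, expressed through Hamilton's equations.\<close>

lemma second_derivative_along_flow:
  fixes p :: "'n covec"
  assumes f: "smooth_fun_on A UNIV f" and c: "c \<in> A" "x \<in> cdom c"
  defines "y \<equiv> cmap c x" and "\<eta> \<equiv> ccomp A c x p" and "F \<equiv> f \<circ> cinv c"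
  defines "v \<equiv> ham_pos c y \<eta>"
  shows "(deriv ^^ 2) (\<lambda>t. f (fst (hamilton_flow A H ip t (x, p)))) 0 =
    (\<Sum>i\<in>UNIV. frechet_derivative (\<lambda>z. frechet_derivative F (at z) (axis i 1)) (at y) v * v $ i) +
    (\<Sum>i\<in>UNIV. frechet_derivative F (at y) (axis i 1) *
       (\<Sum>j\<in>UNIV. dB c i j y v * \<eta> $ j - Bc c i j y * ham_mom c y \<eta> $ j))"
proof -
  obtain \<delta> \<gamma> where g: "\<delta> > 0" "\<gamma> 0 = (x, p)" "hamilton_solution A H ip {- \<delta><..<\<delta>} \<gamma>"
    "\<And>t. t \<in> {- \<delta><..<\<delta>} \<Longrightarrow> fst (\<gamma> t) \<in> cdom c" using hamilton_solution_exists[OF c] by metis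
  let ?I = "{- \<delta><..<\<delta>}"
  define Y where "Y t = cmap c (fst (\<gamma> t))" for t
  define N where "N t = ccomp A c (fst (\<gamma> t)) (snd (\<gamma> t))" for t
  have Y0: "Y 0 = y" and N0: "N 0 = \<eta>" using g(2) by (simp_all add: Y_def N_def y_def \<eta>_def)
  have YD: "Y t \<in> cmap c ` cdom c" if "t \<in> ?I" for t using g(4)[OF that] by (simp add: Y_def)
  have dY: "(Y has_vector_derivative ham_pos c (Y t) (N t)) (at t)"
    and dN: "(N has_vector_derivative - ham_mom c (Y t) (N t)) (at t)" if "t \<in> ?I" for t
    using g(3,4) that c(1) by (auto simp: hamilton_solution_iff solves_at_def Let_def Y_def[abs_def] N_def[abs_def])
  have sF: "smooth_on (cmap c ` cdom c) F" using f c(1) by (simp add: smooth_fun_on_def F_def)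
  have chain: "((\<lambda>s. h (Y s)) has_real_derivative frechet_derivative h (at (Y t)) (ham_pos c (Y t) (N t))) (at t)"
    if t: "t \<in> ?I" and h: "smooth_on (cmap c ` cdom c) h" for h :: "real ^ 'n \<Rightarrow> real" and t
  proof -
    have "((\<lambda>s. h (Y s)) has_derivative (\<lambda>d. frechet_derivative h (at (Y t)) (d *\<^sub>R ham_pos c (Y t) (N t)))) (at t)"
      using diff_chain_at[OF dY[OF t, unfolded has_vector_derivative_def] smooth_on_has_derivative[OF h YD[OF t]]]
      by (simp add: o_def)
    then show ?thesis
      using linear_cmul[OF linear_frechet_derivative[OF smooth_on_differentiable[OF h YD[OF t]]]]
      by (simp add: has_field_derivative_def mult_commute_abs)
  qed
  define g1 where "g1 t = (\<Sum>i\<in>UNIV. frechet_derivative F (at (Y t)) (axis i 1) * (\<Sum>j\<in>UNIV. Bc c i j (Y t) * N t $ j))" for t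
  let ?g = "\<lambda>t. f (fst (hamilton_flow A H ip t (x, p)))"
  have "?g t = F (Y t)" if "t \<in> ?I" for t
    using hamilton_flow_eq[OF g(3,2) that] cinv_cmap[OF c(1) g(4)[OF that]] by (simp add: F_def Y_def)
  then have "(?g has_real_derivative g1 t) (at t)" if t: "t \<in> ?I" for t
  proof -
    have "frechet_derivative F (at (Y t)) (ham_pos c (Y t) (N t)) = g1 t"
      unfolding frechet_derivative_axis_sum[OF smooth_on_differentiable[OF sF YD[OF t]], of "ham_pos c (Y t) (N t)"]
      by (simp add: g1_def ham_pos_def mult.commute)
    then have "((\<lambda>s. F (Y s)) has_real_derivative g1 t) (at t)" using chain[OF t sF] by simp
    then show ?thesis
      by (rule has_field_derivative_transform_within_open[OF _ open_greaterThanLessThan t])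
         (use \<open>\<And>t. t \<in> ?I \<Longrightarrow> ?g t = F (Y t)\<close> in auto)
  qed
  then have d1: "deriv ?g t = g1 t" if "t \<in> ?I" for t using DERIV_imp_deriv that by blast
  have 0: "0 \<in> ?I" using g(1) by simp
  have dNi: "((\<lambda>t. N t $ j) has_real_derivative - ham_mom c y \<eta> $ j) (at 0)" for j
    using bounded_linear.has_vector_derivative[OF bounded_linear_vec_nth[of j] dN[OF 0]]
    by (simp add: Y0 N0 has_real_derivative_iff_has_vector_derivative)
  have dBi: "((\<lambda>t. Bc c i j (Y t)) has_real_derivative dB c i j y v) (at 0)" for i j
    using chain[OF 0 smooth_Bc[OF c(1)]] by (simp add: Y0 N0 v_def dB_def)
  have dFi: "((\<lambda>t. frechet_derivative F (at (Y t)) (axis i 1)) has_real_derivative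
      frechet_derivative (\<lambda>z. frechet_derivative F (at z) (axis i 1)) (at y) v) (at 0)" for i
    using chain[OF 0 smooth_on_frechet_derivative[OF sF]] by (simp add: Y0 N0 v_def)
  have dS: "((\<lambda>t. \<Sum>j\<in>UNIV. Bc c i j (Y t) * N t $ j) has_real_derivative
      (\<Sum>j\<in>UNIV. dB c i j y v * \<eta> $ j - Bc c i j y * ham_mom c y \<eta> $ j)) (at 0)" for i
  proof (rule DERIV_sum)
    fix j
    show "((\<lambda>t. Bc c i j (Y t) * N t $ j) has_real_derivative
      (dB c i j y v * \<eta> $ j - Bc c i j y * ham_mom c y \<eta> $ j)) (at 0)"
      using DERIV_mult[OF dBi[of i j] dNi[of j]] by (simp add: Y0 N0 algebra_simps)
  qed
  have "(g1 has_real_derivative (\<Sum>i\<in>UNIV. frechet_derivative (\<lambda>z. frechet_derivative F (at z) (axis i 1)) (at y) v * v $ i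
     + frechet_derivative F (at y) (axis i 1) *
       (\<Sum>j\<in>UNIV. dB c i j y v * \<eta> $ j - Bc c i j y * ham_mom c y \<eta> $ j))) (at 0)"
    unfolding g1_def[abs_def]
  proof (rule DERIV_sum)
    fix i
    have vi: "(\<Sum>j\<in>UNIV. Bc c i j y * \<eta> $ j) = v $ i" by (simp add: v_def ham_pos_def)
    show "((\<lambda>t. frechet_derivative F (at (Y t)) (axis i 1) * (\<Sum>j\<in>UNIV. Bc c i j (Y t) * N t $ j)) has_real_derivative
      frechet_derivative (\<lambda>z. frechet_derivative F (at z) (axis i 1)) (at y) v * v $ i
     + frechet_derivative F (at y) (axis i 1) *
       (\<Sum>j\<in>UNIV. dB c i j y v * \<eta> $ j - Bc c i j y * ham_mom c y \<eta> $ j)) (at 0)"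
      by (rule DERIV_cong[OF DERIV_mult[OF dFi[of i] dS[of i]]], simp only: Y0 N0 vi, simp only: mult.commute)
  qed
  then have "(deriv ?g has_real_derivative (\<Sum>i\<in>UNIV. frechet_derivative (\<lambda>z. frechet_derivative F (at z) (axis i 1)) (at y) v * v $ i
     + frechet_derivative F (at y) (axis i 1) *
       (\<Sum>j\<in>UNIV. dB c i j y v * \<eta> $ j - Bc c i j y * ham_mom c y \<eta> $ j))) (at 0)"
    by (rule has_field_derivative_transform_within_open[OF _ open_greaterThanLessThan 0]) (simp add: d1)
  then show ?thesis
    by (simp add: DERIV_imp_deriv sum.distrib numeral_2_eq_2)
qed

end

section \<open>The rotation invariant measure on the unit sphere\<close>

lemma nn_integral_lborel_translate:
  fixes f :: "'a::euclidean_space \<Rightarrow> ennreal"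
  assumes "f \<in> borel_measurable borel"
  shows "(\<integral>\<^sup>+x. f (c + x) \<partial>lborel) = (\<integral>\<^sup>+x. f x \<partial>lborel)"
proof -
  have "(\<integral>\<^sup>+x. f x \<partial>lborel) = (\<integral>\<^sup>+x. f x \<partial>distr lborel borel ((+) c))" by (simp add: lborel_distr_plus)
  also have "\<dots> = (\<integral>\<^sup>+x. f (c + x) \<partial>lborel)" using assms by (subst nn_integral_distr) auto
  finally show ?thesis by simp
qed

text \<open>By translation invariance and Fubini, the image of Lebesgue measure under \<open>T\<close> is a multiple of
  Lebesgue measure.\<close>

lemma linear_image_measure_compare:
  fixes T :: "'a::euclidean_space \<Rightarrow> 'a"
  assumes T: "linear T" "surj T" and mT[measurable]: "T \<in> borel_measurable borel"
    and W[measurable]: "W \<in> sets borel" and B[measurable]: "B \<in> sets borel"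
  shows "emeasure lborel (T -` W) * emeasure lborel B = emeasure lborel W * emeasure lborel {x. - T x \<in> B}"
proof -
  \<comment> \<open>A right inverse of \<open>T\<close>: translating by \<open>S y\<close> in the
    domain amounts to translating by \<open>y\<close> after \<open>T\<close>, so the invariance of
    Lebesgue measure can be used on both sides.\<close>
  define S where "S = inv T"
  have TS: "T (S y + x) = y + T x" for x y
    using surj_f_inv_f[OF T(2), of y] by (simp add: S_def linear_add[OF T(1)])
  have m1[measurable]: "T -` W \<in> sets borel" and m2[measurable]: "{x. - T x \<in> B} \<in> sets borel"
    using measurable_sets[OF mT W] measurable_sets[OF borel_measurable_uminus[OF mT] B] by (simp_all add: vimage_def)
  have "emeasure lborel (T -` W) * emeasure lborel B
      = (\<integral>\<^sup>+y. (\<integral>\<^sup>+x. indicator W (T x) \<partial>lborel) * indicator B y \<partial>lborel)"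
    by (subst nn_integral_cmult) (auto simp: nn_integral_indicator indicator_vimage[symmetric] vimage_def
        simp flip: nn_integral_indicator intro!: arg_cong2[where f = "(*)"] nn_integral_cong split: split_indicator)
  also have "\<dots> = (\<integral>\<^sup>+y. (\<integral>\<^sup>+x. indicator W (T x) * indicator B y \<partial>lborel) \<partial>lborel)"
    by (subst nn_integral_multc) auto
  also have "\<dots> = (\<integral>\<^sup>+y. (\<integral>\<^sup>+x. indicator W (y + T x) * indicator B y \<partial>lborel) \<partial>lborel)"
  proof (rule nn_integral_cong)
    fix y
    show "(\<integral>\<^sup>+x. indicator W (T x) * indicator B y \<partial>lborel) = (\<integral>\<^sup>+x. indicator W (y + T x) * indicator B y \<partial>lborel)"
      using nn_integral_lborel_translate[of "\<lambda>x. indicator W (T x) * indicator B y" "S y"] by (simp add: TS)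
  qed
  also have "\<dots> = (\<integral>\<^sup>+x. (\<integral>\<^sup>+y. indicator W (y + T x) * indicator B y \<partial>lborel) \<partial>lborel)"
    by (rule lborel_pair.Fubini') measurable
  also have "\<dots> = (\<integral>\<^sup>+x. (\<integral>\<^sup>+y. indicator W y * indicator B (y - T x) \<partial>lborel) \<partial>lborel)"
  proof (rule nn_integral_cong)
    fix x
    show "(\<integral>\<^sup>+y. indicator W (y + T x) * indicator B y \<partial>lborel) = (\<integral>\<^sup>+y. indicator W y * indicator B (y - T x) \<partial>lborel)"
      using nn_integral_lborel_translate[of "\<lambda>y. indicator W y * indicator B (y - T x)" "T x"]
      by (simp add: add.commute)
  qed
  also have "\<dots> = (\<integral>\<^sup>+y. (\<integral>\<^sup>+x. indicator W y * indicator B (y - T x) \<partial>lborel) \<partial>lborel)"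
    by (rule lborel_pair.Fubini'[symmetric]) measurable
  also have "\<dots> = (\<integral>\<^sup>+y. (\<integral>\<^sup>+x. indicator W y * indicator B (- T x) \<partial>lborel) \<partial>lborel)"
  proof (rule nn_integral_cong)
    fix y
    show "(\<integral>\<^sup>+x. indicator W y * indicator B (y - T x) \<partial>lborel) = (\<integral>\<^sup>+x. indicator W y * indicator B (- T x) \<partial>lborel)"
      using nn_integral_lborel_translate[of "\<lambda>x. indicator W y * indicator B (y - T x)" "S y"] by (simp add: TS)
  qed
  also have "\<dots> = (\<integral>\<^sup>+y. indicator W y * (\<integral>\<^sup>+x. indicator {x. - T x \<in> B} x \<partial>lborel) \<partial>lborel)"
    by (subst nn_integral_cmult[symmetric]) (auto intro!: nn_integral_cong split: split_indicator)
  also have "\<dots> = emeasure lborel W * emeasure lborel {x. - T x \<in> B}"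
    by (subst nn_integral_multc) auto
  finally show ?thesis .
qed

context vertical_sub_riemannian
begin

section \<open>The ball of \<open>G\<close>, its projection to the sphere and the invariant
  measure\<close>

lemma bilinear_G: "bilinear (G q)"
  unfolding bilinear_def using linear_G_left linear_G_right by blast

lemma bounded_bilinear_G: "bounded_bilinear (G q)"
  using bilinear_G bilinear_conv_bounded_bilinear by blast

lemma continuous_on_G: "continuous_on S (\<lambda>v. G q v v)"
  by (rule bounded_bilinear.continuous_on[OF bounded_bilinear_G continuous_on_id continuous_on_id])

lemma continuous_on_proj: "continuous_on S (proj q)"
  using linear_continuous_on[OF linear_proj[unfolded linear_conv_bounded_linear]] by blast

text \<open>The minimum of \<open>G\<close> on the compact Euclidean sphere is positive; by
  homogeneity it is the required constant.\<close>

lemma G_coercive: "\<exists>k>0. \<forall>v. k * (norm v)\<^sup>2 \<le> G q v v"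
proof -
  have "\<exists>x\<in>sphere 0 1. \<forall>y\<in>sphere 0 1. G q x x \<le> G q y y"
  proof (rule continuous_attains_inf[OF compact_sphere _ continuous_on_G])
    have "axis undefined 1 \<in> sphere (0 :: real ^ 'n) 1" by (simp add: norm_axis_1)
    then show "sphere (0 :: real ^ 'n) 1 \<noteq> {}" by blast
  qed
  then obtain x where x: "norm x = 1" "\<And>y. norm y = 1 \<Longrightarrow> G q x x \<le> G q y y" by auto
  have "G q x x * (norm v)\<^sup>2 \<le> G q v v" for v
  proof (cases "v = 0")
    case False
    have "G q x x \<le> G q (v /\<^sub>R norm v) (v /\<^sub>R norm v)" using x(2) False by simp
    also have "\<dots> = G q v v / (norm v)\<^sup>2"
      by (simp add: linear_cmul[OF linear_G_left] linear_cmul[OF linear_G_right] power2_eq_square divide_inverse)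
    finally show ?thesis using False by (simp add: field_simps)
  qed (simp add: linear_0[OF linear_G_left])
  moreover have "G q x x > 0" using x(1) by (intro G_pos) auto
  ultimately show ?thesis by blast
qed

lemma bounded_G_ball: "bounded {v. G q v v \<le> 1}"
proof -
  obtain k where k: "k > 0" "\<And>v. k * (norm v)\<^sup>2 \<le> G q v v" using G_coercive by blast
  have "norm v \<le> sqrt (1 / k)" if "G q v v \<le> 1" for v
  proof (rule real_le_rsqrt)
    show "(norm v)\<^sup>2 \<le> 1 / k" using k(2)[of v] that k(1) by (simp add: field_simps)
  qed
  then show ?thesis by (auto simp: bounded_iff)
qed

lemma unit_sphere_G: "X \<in> unit_sphere H ip q \<longleftrightarrow> X \<in> H q \<and> G q X X = 1"
  by (auto simp: unit_sphere_def G_extends)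

text \<open>The open unit ball of \<open>G\<close> without the kernel of the projection, so that the
  projection can be normalised on it. It is open, bounded, symmetric and invariant under isometries
  compatible with the splitting.\<close>

definition punctured_ball :: "'a \<Rightarrow> (real ^ 'n) set" where
  "punctured_ball q = {v. G q v v < 1 \<and> proj q v \<noteq> 0}"

definition normalised_proj :: "'a \<Rightarrow> real ^ 'n \<Rightarrow> real ^ 'n" where
  "normalised_proj q v = (1 / sqrt (G q (proj q v) (proj q v))) *\<^sub>R proj q v"

lemma open_punctured_ball: "open (punctured_ball q)"
  unfolding punctured_ball_def
  by (intro open_Collect_conj open_Collect_less open_Collect_neq continuous_on_G continuous_on_proj continuous_on_const)

lemma bounded_punctured_ball: "bounded (punctured_ball q)"
  by (rule bounded_subset[OF bounded_G_ball[of q]]) (auto simp: punctured_ball_def)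

lemma punctured_ball_nonempty: "punctured_ball q \<noteq> {}"
proof -
  have "\<not> H q \<subseteq> {0}" using dim_H[of q] rank_pos by (simp flip: dim_eq_0)
  then obtain h where h: "h \<in> H q" "h \<noteq> 0" by blast
  \<comment> \<open>This factor gives the scaled horizontal vector the squared length 1/2, safely
    below 1.\<close>
  let ?s = "1 / sqrt (2 * G q h h)"
  have g: "G q h h > 0" using G_pos h by blast
  have "G q (?s *\<^sub>R h) (?s *\<^sub>R h) = ?s\<^sup>2 * G q h h"
    by (simp add: linear_cmul[OF linear_G_left] linear_cmul[OF linear_G_right] power2_eq_square)
  also have "\<dots> = 1 / 2" using g by (simp add: power_divide field_simps)
  finally have "?s *\<^sub>R h \<in> punctured_ball q"
    using g h by (simp add: punctured_ball_def proj_H subspace_scale[OF subspace_H])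
  then show ?thesis by blast
qed

lemma punctured_ball_measure:
  "punctured_ball q \<in> sets borel" "punctured_ball q \<in> lmeasurable" "measure lebesgue (punctured_ball q) > 0"
proof -
  show "punctured_ball q \<in> sets borel" using open_punctured_ball by (rule borel_open)
  show l: "punctured_ball q \<in> lmeasurable"
    by (rule lmeasurable_open[OF bounded_punctured_ball open_punctured_ball])
  have "measure lebesgue (punctured_ball q) \<noteq> 0"
    using open_not_negligible[OF open_punctured_ball punctured_ball_nonempty] negligible_iff_measure0[OF l] by blast
  then show "measure lebesgue (punctured_ball q) > 0" by (simp add: less_le)
qed

lemma punctured_ball_emeasure: "emeasure lborel (punctured_ball q) \<noteq> 0" "emeasure lborel (punctured_ball q) \<noteq> \<infinity>"
proof -
  have "emeasure lborel (punctured_ball q) = ennreal (measure lebesgue (punctured_ball q))"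
    using emeasure_eq_measure2[OF punctured_ball_measure(2), of q] punctured_ball_measure(1)[of q]
    by (simp add: emeasure_completion)
  then show "emeasure lborel (punctured_ball q) \<noteq> 0" "emeasure lborel (punctured_ball q) \<noteq> \<infinity>"
    using punctured_ball_measure(3)[of q] by auto
qed

lemma normalised_proj_in:
  assumes "v \<in> punctured_ball q"
  shows "normalised_proj q v \<in> unit_sphere H ip q"
proof -
  let ?s = "1 / sqrt (G q (proj q v) (proj q v))"
  have g: "G q (proj q v) (proj q v) > 0" using assms by (intro G_pos) (simp add: punctured_ball_def)
  have "G q (normalised_proj q v) (normalised_proj q v) = ?s * ?s * G q (proj q v) (proj q v)"
    by (simp add: normalised_proj_def linear_cmul[OF linear_G_left] linear_cmul[OF linear_G_right])
  also have "\<dots> = 1" using g by simp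
  finally show ?thesis
    unfolding unit_sphere_G
    by (simp add: normalised_proj_def subspace_scale[OF subspace_H proj_in])
qed

lemma continuous_on_normalised_proj: "continuous_on (punctured_ball q) (normalised_proj q)"
  unfolding normalised_proj_def
  by (intro continuous_intros continuous_on_proj continuous_on_compose2[OF continuous_on_G continuous_on_proj])
     (auto simp: punctured_ball_def dest: G_pos[of _ q])

text \<open>A linear bijection multiplies Lebesgue measure by a constant. An invariant set of
  positive finite measure shows that the constant is 1, with no determinant computed.\<close>

lemma isometry_preserves_measure:
  assumes T: "linear T" "\<And>v. G q (T v) (T v) = G q v v" "\<And>v. proj q (T v) = 0 \<longleftrightarrow> proj q v = 0"
    and W: "W \<in> sets borel"
  shows "emeasure lborel (T -` W) = emeasure lborel W"
proof -
  let ?B = "punctured_ball q"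
  have "inj T"
  proof (rule linear_inj_on_iff_eq_0[OF T(1) subspace_UNIV, THEN iffD2, rule_format])
    fix v assume "T v = 0"
    then have "G q v v = 0" using T(2)[of v] by (simp add: linear_0[OF linear_G_left])
    then show "v = 0" using G_pos[of v q] by auto
  qed
  then have surj: "surj T" using linear_injective_imp_surjective[OF T(1)] by simp
  have cT: "T \<in> borel_measurable borel"
    by (intro borel_measurable_continuous_onI linear_continuous_on) (use T(1) in \<open>simp add: linear_conv_bounded_linear\<close>)
  have minus: "- v \<in> ?B \<longleftrightarrow> v \<in> ?B" for v
    by (simp add: punctured_ball_def linear_neg[OF linear_G_left] linear_neg[OF linear_G_right] linear_neg[OF linear_proj])
  \<comment> \<open>The comparison lemma is applied with the punctured ball as test set: it is
    invariant under \<open>T\<close> and under the sign, so its measure cancels from both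
    sides.\<close>
  have "T -` ?B = ?B" using T(2,3) by (auto simp: punctured_ball_def)
  then have "emeasure lborel ?B * emeasure lborel (T -` W) = emeasure lborel ?B * emeasure lborel W"
    using linear_image_measure_compare[OF T(1) surj cT W punctured_ball_measure(1), of q] minus
    by (simp add: vimage_def mult.commute)
  then show ?thesis using punctured_ball_emeasure[of q] by (simp add: ennreal_mult_cancel_left)
qed

text \<open>\<open>R\<close> is known to be isometric on \<open>H q\<close> only. Composing it with
  the projection and adding the identity on the vertical part gives a \<open>G\<close>-isometry of
  the whole tangent space with the same action on \<open>H q\<close>.\<close>

lemma isometry_extension:
  assumes "linear R" "R ` H q = H q" "\<And>u v. u \<in> H q \<Longrightarrow> v \<in> H q \<Longrightarrow> ip q (R u) (R v) = ip q u v"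
  defines "T \<equiv> \<lambda>v. R (proj q v) + (v - proj q v)"
  shows "linear T" "G q (T v) (T v) = G q v v" "proj q (T v) = R (proj q v)"
proof -
  have RH: "R (proj q v) \<in> H q" for v using assms(2) proj_in by blast
  have GR: "G q (R (proj q v)) (R (proj q v)) = G q (proj q v) (proj q v)" for v
    using assms(3)[OF proj_in proj_in] by (simp add: G_extends[OF RH RH] G_extends[OF proj_in proj_in])
  show "linear T"
    unfolding T_def
    by (intro linear_compose_add linear_compose_sub linear_ident linear_proj linear_compose[OF linear_proj assms(1), unfolded o_def])
  show "proj q (T v) = R (proj q v)"
    unfolding T_def by (simp add: linear_add[OF linear_proj] proj_H[OF RH] proj_V[OF diff_proj_V])
  have orth: "G q u (v - proj q v) = 0" "G q (v - proj q v) u = 0" if "u \<in> H q" for u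
    using diff_proj_V[of v q] that G_sym[of q _ u] by (auto simp: V_orthogonal)
  have *: "G q (u + (v - proj q v)) (u + (v - proj q v)) = G q u u + G q (v - proj q v) (v - proj q v)" if "u \<in> H q" for u
    using orth[OF that] by (simp add: linear_add[OF linear_G_left] linear_add[OF linear_G_right])
  show "G q (T v) (T v) = G q v v"
    using *[OF RH[of v]] *[OF proj_in[of q v]] GR[of v] by (simp add: T_def)
qed

text \<open>The image under \<open>normalised_proj\<close> of normalised Lebesgue measure on the
  punctured ball. A fibre isometry \<open>R\<close> extends to a linear \<open>T\<close> preserving
  Lebesgue measure, and \<open>normalised_proj\<close> intertwines \<open>T\<close> with
  \<open>R\<close>.\<close>

lemma rotation_invariant_measure_exists:
  "\<exists>\<mu>. space \<mu> = unit_sphere H ip q \<and>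
        sets \<mu> = sets (restrict_space borel (unit_sphere H ip q)) \<and>
        emeasure \<mu> (space \<mu>) = 1 \<and> rotation_invariant H ip q \<mu>"
proof -
  let ?S = "unit_sphere H ip q" and ?B = "punctured_ball q"
  \<comment> \<open>The qualified name denotes the normalised restriction of a measure to a set, as
    opposed to the measure on the sphere called \<open>uniform_measure\<close>.\<close>
  define M where "M = restrict_space (Nonnegative_Lebesgue_Integration.uniform_measure lborel ?B) ?B"
  define \<mu> where "\<mu> = distr M (restrict_space borel ?S) (normalised_proj q)"
  have Bb: "?B \<in> sets borel" by (rule punctured_ball_measure)
  note B0 = punctured_ball_emeasure[of q]
  have spM: "space M = ?B" and seM: "sets M = sets (restrict_space borel ?B)"
    by (auto simp: M_def space_restrict_space sets_restrict_space)
  have emM: "emeasure M E = emeasure lborel E / emeasure lborel ?B" if "E \<in> sets borel" "E \<subseteq> ?B" for E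
    using that Bb
    by (simp add: M_def emeasure_restrict_space emeasure_uniform_measure Int_absorb1)
  have mN: "normalised_proj q \<in> measurable M (restrict_space borel ?S)"
  proof (rule measurable_restrict_space2)
    show "normalised_proj q \<in> space M \<rightarrow> ?S" using normalised_proj_in by (auto simp: spM)
    show "normalised_proj q \<in> borel_measurable M"
      using borel_measurable_continuous_on_restrict[OF continuous_on_normalised_proj]
      by (simp add: measurable_cong_sets[OF seM refl])
  qed
  have sp: "space \<mu> = ?S" and se: "sets \<mu> = sets (restrict_space borel ?S)"
    by (auto simp: \<mu>_def space_restrict_space)
  have pre: "normalised_proj q -` E \<inter> ?B \<in> sets borel" if "E \<in> sets \<mu>" for E
  proof -
    have "normalised_proj q -` E \<inter> ?B \<in> sets (restrict_space borel ?B)"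
      using measurable_sets[OF mN] that by (simp add: se spM seM)
    then show ?thesis using Bb by (auto simp: sets_restrict_space)
  qed
  have em: "emeasure \<mu> E = emeasure lborel (normalised_proj q -` E \<inter> ?B) / emeasure lborel ?B" if "E \<in> sets \<mu>" for E
    using that pre[OF that] by (simp add: \<mu>_def emeasure_distr[OF mN] spM emM)
  have one: "emeasure \<mu> (space \<mu>) = 1"
  proof -
    have "normalised_proj q -` ?S \<inter> ?B = ?B" using normalised_proj_in by auto
    then show ?thesis using em[OF sets.top] B0 ennreal_divide_self[of "emeasure lborel ?B"] by (simp add: sp less_top)
  qed
  have "rotation_invariant H ip q \<mu>"
    unfolding rotation_invariant_def
  proof (intro allI impI)
    fix R assume R: "linear R \<and> R ` H q = H q \<and> (\<forall>u\<in>H q. \<forall>v\<in>H q. ip q (R u) (R v) = ip q u v)"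
    define T where "T v = R (proj q v) + (v - proj q v)" for v
    have T: "linear T" "\<And>v. G q (T v) (T v) = G q v v" "\<And>v. proj q (T v) = R (proj q v)"
      using isometry_extension[of R q] R unfolding T_def[abs_def] by auto
    have RH: "R (proj q v) \<in> H q" for v using R proj_in by blast
    have GR: "G q (R (proj q v)) (R (proj q v)) = G q (proj q v) (proj q v)" for v
      using R proj_in[of q v] by (simp add: G_extends[OF RH RH] G_extends[OF proj_in proj_in])
    have T0: "proj q (T v) = 0 \<longleftrightarrow> proj q v = 0" for v
      unfolding T(3)
    proof
      assume "R (proj q v) = 0"
      then have "G q (proj q v) (proj q v) = 0" using GR[of v] by (simp add: linear_0[OF linear_G_left])
      then show "proj q v = 0" using G_pos[of "proj q v" q] by auto
    qed (use R linear_0[of R] in auto)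
    have NT: "normalised_proj q (T v) = R (normalised_proj q v)" for v
      unfolding normalised_proj_def T(3) GR using R by (simp add: linear_cmul)
    have RS: "R \<in> ?S \<rightarrow> ?S" using R by (auto simp: unit_sphere_def)
    have mR: "R \<in> measurable \<mu> \<mu>"
    proof -
      have "R \<in> measurable (restrict_space borel ?S) (restrict_space borel ?S)"
        using R RS by (intro measurable_restrict_space2 borel_measurable_continuous_on_restrict linear_continuous_on)
          (auto simp: space_restrict_space linear_conv_bounded_linear)
      then show ?thesis by (simp add: measurable_cong_sets[OF se se])
    qed
    show "distr \<mu> \<mu> R = \<mu>"
    proof (rule measure_eqI)
      fix E assume "E \<in> sets (distr \<mu> \<mu> R)"
      then have E: "E \<in> sets \<mu>" by simp
      have RE: "R -` E \<inter> space \<mu> \<in> sets \<mu>" using measurable_sets[OF mR E] .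
      \<comment> \<open>The intertwining relation in terms of preimages; that \<open>T\<close>
        preserves the ball and the vanishing of the projection makes both sides live in the
        punctured ball.\<close>
      have "normalised_proj q -` (R -` E \<inter> space \<mu>) \<inter> ?B = T -` (normalised_proj q -` E \<inter> ?B)"
        using normalised_proj_in NT T(2) T0 by (auto simp: sp punctured_ball_def)
      then have "emeasure lborel (normalised_proj q -` (R -` E \<inter> space \<mu>) \<inter> ?B)
          = emeasure lborel (normalised_proj q -` E \<inter> ?B)"
        using isometry_preserves_measure[OF T(1,2) T0 pre[OF E]] by simp
      then show "emeasure (distr \<mu> \<mu> R) E = emeasure \<mu> E"
        by (simp add: emeasure_distr[OF mR E] em[OF RE] em[OF E])
    qed simp
  qed
  then show ?thesis using sp se one by blast
qed

text \<open>The later integrals are computed from these four properties alone, so they have the same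
  value whichever measure the choice selects.\<close>

lemma uniform_measure_spec:
  "space (uniform_measure H ip q) = unit_sphere H ip q"
  "sets (uniform_measure H ip q) = sets (restrict_space borel (unit_sphere H ip q))"
  "emeasure (uniform_measure H ip q) (space (uniform_measure H ip q)) = 1"
  "rotation_invariant H ip q (uniform_measure H ip q)"
  using someI_ex[OF rotation_invariant_measure_exists[of q]] unfolding uniform_measure_def by blast+

text \<open>The orthogonal frame is normalised at a single point. Square roots are harmless here,
  since no regularity in \<open>q\<close> is claimed.\<close>

lemma orthonormal_basis_exists:
  "\<exists>e. (\<forall>a<m. e a \<in> H q) \<and> (\<forall>a<m. \<forall>b<m. G q (e a) (e b) = (if a = b then 1 else 0)) \<and>
    (\<forall>v\<in>H q. (\<Sum>a<m. G q v (e a) *\<^sub>R e a) = v) \<and>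
    (\<forall>p. cometric H ip q p = (\<Sum>a<m. blinfun_apply p (e a) *\<^sub>R e a))"
proof -
  obtain U Y where fr: "orthogonal_frame U Y" "q \<in> U" using orthogonal_frame_exists by blast
  define n where "n a = sqrt (ip q (Y a q) (Y a q))" for a
  define e where "e a = (1 / n a) *\<^sub>R Y a q" for a
  have n: "n a > 0" "n a * n a = ip q (Y a q) (Y a q)" if "a < m" for a
    using frame_ip_pos[OF fr that] by (auto simp: n_def)
  note lin = linear_cmul[OF linear_G_left] linear_cmul[OF linear_G_right]
  have YH: "Y a q \<in> H q" if "a < m" for a by (rule frame_in[OF fr that])
  show ?thesis
  proof (intro exI[of _ e] conjI allI impI ballI)
    show "e a \<in> H q" if "a < m" for a
      unfolding e_def by (intro subspace_scale[OF subspace_H] YH that)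
    show "G q (e a) (e b) = (if a = b then 1 else 0)" if "a < m" "b < m" for a b
      using fr that n[OF that(1)] by (auto simp: e_def lin G_extends[OF YH YH] orthogonal_frame_def)
    show "(\<Sum>a<m. G q v (e a) *\<^sub>R e a) = v" if "v \<in> H q" for v
    proof -
      have "(\<Sum>a<m. G q v (e a) *\<^sub>R e a) = (\<Sum>a<m. (ip q v (Y a q) / ip q (Y a q) (Y a q)) *\<^sub>R Y a q)"
        using n(2) by (intro sum.cong refl) (auto simp: e_def lin G_extends[OF that YH] simp flip: n(2))
      then show ?thesis using frame_expansion[OF fr that] by simp
    qed
    show "cometric H ip q p = (\<Sum>a<m. blinfun_apply p (e a) *\<^sub>R e a)" for p
      unfolding cometric_frame[OF fr]
      by (intro sum.cong refl) (auto simp: e_def blinfun.scaleR_right simp flip: n(2))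
  qed
qed

text \<open>\<open>R\<close> is the \<open>G\<close>-reflection that sends \<open>w\<close> to its
  negative; it preserves the fibre because \<open>w\<close> is horizontal, and it is onto because it
  is an involution.\<close>

lemma reflection_isometry:
  assumes w: "w \<in> H q" "w \<noteq> 0"
  defines "R \<equiv> \<lambda>v. v - (2 * G q v w / G q w w) *\<^sub>R w"
  shows "linear R" "R ` H q = H q" "\<And>u v. u \<in> H q \<Longrightarrow> v \<in> H q \<Longrightarrow> ip q (R u) (R v) = ip q u v"
proof -
  have g: "G q w w > 0" using G_pos w by blast
  show "linear R"
    unfolding R_def
    by (rule linearI)
       (simp_all add: linear_add[OF linear_G_left] linear_cmul[OF linear_G_left] algebra_simps add_divide_distrib)
  have RH: "R v \<in> H q" if "v \<in> H q" for v
    unfolding R_def using that w by (intro subspace_diff[OF subspace_H] subspace_scale[OF subspace_H])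
  note lin = linear_cmul[OF linear_G_left] linear_cmul[OF linear_G_right]
    linear_diff[OF linear_G_left] linear_diff[OF linear_G_right]
  have RR: "R (R v) = v" for v
    using g by (simp add: R_def lin field_simps flip: scaleR_add_left scaleR_diff_left)
  show "R ` H q = H q"
  proof (intro equalityI subsetI)
    show "x \<in> H q" if "x \<in> R ` H q" for x using that RH by auto
    show "x \<in> R ` H q" if "x \<in> H q" for x using RH[OF that] by (intro image_eqI[of _ _ "R x"]) (simp_all add: RR)
  qed
  show "ip q (R u) (R v) = ip q u v" if "u \<in> H q" "v \<in> H q" for u v
  proof -
    have "G q (R u) (R v) = G q u v"
      using g G_sym[of q w v] G_sym[of q w u] by (simp add: R_def lin field_simps)
    then show ?thesis using G_extends[OF RH RH, OF that] G_extends[OF that] by simp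
  qed
qed

lemma continuous_measurable_uniform:
  fixes h :: "real ^ 'n \<Rightarrow> real"
  assumes "continuous_on UNIV h"
  shows "h \<in> borel_measurable (uniform_measure H ip q)" "integrable (uniform_measure H ip q) h"
proof -
  let ?S = "unit_sphere H ip q" and ?U = "uniform_measure H ip q"
  show m: "h \<in> borel_measurable ?U"
    using borel_measurable_continuous_on_restrict[OF continuous_on_subset[OF assms, of ?S]]
    by (simp add: measurable_cong_sets[OF uniform_measure_spec(2) refl])
  interpret finite_measure ?U by (rule finite_measureI) (simp only: uniform_measure_spec(3), simp)
  \<comment> \<open>Passing to the closure turns the bounded ball into a compact set containing the
    sphere, on which \<open>h\<close> is bounded.\<close>
  have "bounded (h ` closure {v. G q v v \<le> 1})"
    using bounded_G_ball assms
    by (intro compact_imp_bounded compact_continuous_image) (auto intro: continuous_on_subset)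
  then obtain K where K: "\<And>v. v \<in> closure {v. G q v v \<le> 1} \<Longrightarrow> norm (h v) \<le> K" by (auto simp: bounded_iff)
  then have "norm (h v) \<le> K" if "v \<in> space ?U" for v
  proof -
    have "v \<in> {v. G q v v \<le> 1}" using that by (simp add: uniform_measure_spec unit_sphere_G)
    then show ?thesis by (intro K subsetD[OF closure_subset])
  qed
  then show "integrable ?U h" using m by (intro integrable_const_bound[of _ K] AE_I2) auto
qed

lemma integral_reflection:
  fixes h :: "real ^ 'n \<Rightarrow> real"
  assumes "continuous_on UNIV h" "w \<in> H q" "w \<noteq> 0"
  shows "(\<integral>X. h (X - (2 * G q X w / G q w w) *\<^sub>R w) \<partial>uniform_measure H ip q) = (\<integral>X. h X \<partial>uniform_measure H ip q)"
proof -
  let ?S = "unit_sphere H ip q" and ?U = "uniform_measure H ip q"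
  let ?R = "\<lambda>v. v - (2 * G q v w / G q w w) *\<^sub>R w"
  note R = reflection_isometry[OF assms(2,3)]
  have "?R \<in> ?S \<rightarrow> ?S" using R(2,3) by (auto simp: unit_sphere_def)
  then have "?R \<in> measurable (restrict_space borel ?S) (restrict_space borel ?S)"
    using R(1) by (intro measurable_restrict_space2 borel_measurable_continuous_on_restrict linear_continuous_on)
      (auto simp: space_restrict_space linear_conv_bounded_linear)
  then have mR: "?R \<in> measurable ?U ?U"
    by (simp add: measurable_cong_sets[OF uniform_measure_spec(2) uniform_measure_spec(2)])
  have "distr ?U ?U ?R = ?U"
    using uniform_measure_spec(4)[unfolded rotation_invariant_def, rule_format, of ?R] R by blast
  then have "(\<integral>X. h X \<partial>?U) = (\<integral>X. h X \<partial>distr ?U ?U ?R)" by simp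
  also have "\<dots> = (\<integral>X. h (?R X) \<partial>?U)"
    by (rule integral_distr[OF mR continuous_measurable_uniform(1)[OF assms(1)]])
  finally show ?thesis by simp
qed

lemma second_moment:
  "(\<integral>X. blinfun_apply p X * blinfun_apply p' X \<partial>uniform_measure H ip q) =
    blinfun_apply p (cometric H ip q p') / real m"
  "integrable (uniform_measure H ip q) (\<lambda>X. blinfun_apply p X * blinfun_apply p' X)"
proof -
  let ?U = "uniform_measure H ip q"
  show "integrable ?U (\<lambda>X. blinfun_apply p X * blinfun_apply p' X)"
    by (intro continuous_measurable_uniform continuous_intros)
  obtain e where "(\<forall>a<m. e a \<in> H q) \<and> (\<forall>a<m. \<forall>b<m. G q (e a) (e b) = (if a = b then 1 else 0)) \<and>
    (\<forall>v\<in>H q. (\<Sum>a<m. G q v (e a) *\<^sub>R e a) = v) \<and>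
    (\<forall>p. cometric H ip q p = (\<Sum>a<m. blinfun_apply p (e a) *\<^sub>R e a))"
    using orthonormal_basis_exists[of q] by (rule exE)
  then have e: "\<And>a. a < m \<Longrightarrow> e a \<in> H q"
    "\<And>a b. a < m \<Longrightarrow> b < m \<Longrightarrow> G q (e a) (e b) = (if a = b then 1 else 0)"
    "\<And>v. v \<in> H q \<Longrightarrow> (\<Sum>a<m. G q v (e a) *\<^sub>R e a) = v"
    "\<And>p. cometric H ip q p = (\<Sum>a<m. blinfun_apply p (e a) *\<^sub>R e a)" by simp_all
  define x where "x a X = G q X (e a)" for a X
  have cx: "continuous_on UNIV (x a)" for a
    unfolding x_def using linear_G_left by (intro linear_continuous_on) (simp add: linear_conv_bounded_linear)
  have cxx: "continuous_on UNIV (\<lambda>X. x a X * x b X)" for a b by (intro continuous_intros cx)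
  have int: "integrable ?U (\<lambda>X. x a X * x b X)" for a b by (rule continuous_measurable_uniform[OF cxx])
  note lin = linear_cmul[OF linear_G_left] linear_cmul[OF linear_G_right]
    linear_diff[OF linear_G_left] linear_diff[OF linear_G_right]
  define I where "I a b = (\<integral>X. x a X * x b X \<partial>?U)" for a b
  have e0: "e a \<noteq> 0" if "a < m" for a using e(2)[OF that that] by (auto simp: linear_0[OF linear_G_left])
  \<comment> \<open>The reflection in \<open>e a\<close> changes the sign of the coordinate
    \<open>x a\<close> and fixes \<open>x b\<close>, so the mixed moment equals its
    negative.\<close>
  have off: "I a b = 0" if "a < m" "b < m" "a \<noteq> b" for a b
  proof -
    have "I a b = (\<integral>X. x a (X - (2 * G q X (e a) / G q (e a) (e a)) *\<^sub>R e a) * x b (X - (2 * G q X (e a) / G q (e a) (e a)) *\<^sub>R e a) \<partial>?U)"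
      unfolding I_def using integral_reflection[OF cxx e(1)[OF that(1)] e0[OF that(1)]] by simp
    also have "\<dots> = (\<integral>X. - (x a X * x b X) \<partial>?U)"
      using that by (simp add: x_def lin e(2))
    finally show ?thesis using int by (simp add: I_def)
  qed
  \<comment> \<open>The reflection along \<open>e a - e b\<close>, a vector of squared length 2,
    interchanges the coordinates \<open>x a\<close> and \<open>x b\<close>.\<close>
  have diag: "I a a = I b b" if "a < m" "b < m" "a \<noteq> b" for a b
  proof -
    let ?w = "e a - e b"
    have ww: "G q ?w ?w = 2" using that by (simp add: lin e(2))
    then have w: "?w \<in> H q" "?w \<noteq> 0"
      using e(1) that subspace_diff[OF subspace_H] by (auto simp: linear_0[OF linear_G_left])
    have "I a a = (\<integral>X. x a (X - (2 * G q X ?w / G q ?w ?w) *\<^sub>R ?w) * x a (X - (2 * G q X ?w / G q ?w ?w) *\<^sub>R ?w) \<partial>?U)"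
      unfolding I_def using integral_reflection[OF cxx w] by simp
    also have "\<dots> = (\<integral>X. x b X * x b X \<partial>?U)"
      unfolding ww using that by (simp add: x_def lin e(2) diff_divide_distrib)
    finally show ?thesis by (simp add: I_def)
  qed
  have pos: "0 < m" by (rule rank_pos)
  \<comment> \<open>On the unit sphere the squared coordinates add up to 1; with equal diagonal
    moments each of them is 1/m.\<close>
  have "(\<Sum>a<m. I a a) = (\<integral>X. (\<Sum>a<m. x a X * x a X) \<partial>?U)"
    unfolding I_def using int by (simp add: Bochner_Integration.integral_sum)
  also have "\<dots> = (\<integral>X. 1 \<partial>?U)"
  proof (rule Bochner_Integration.integral_cong[OF refl])
    fix X assume "X \<in> space ?U"
    then have X: "X \<in> H q" "G q X X = 1" by (auto simp: uniform_measure_spec unit_sphere_G)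
    have "G q X (\<Sum>a<m. G q X (e a) *\<^sub>R e a) = (\<Sum>a<m. x a X * x a X)"
      by (simp add: linear_sum[OF linear_G_right] lin x_def)
    then show "(\<Sum>a<m. x a X * x a X) = 1" using e(3)[OF X(1)] X(2) by simp
  qed
  also have "\<dots> = 1" using uniform_measure_spec(3)[of q] by (simp add: measure_def)
  finally have "(\<Sum>a<m. I a a) = 1" .
  have d0: "I a a = I 0 0" if "a < m" for a using diag[of a 0] pos that by (cases "a = 0") auto
  have "(\<Sum>a<m. I a a) = (\<Sum>a<m. I 0 0)" by (intro sum.cong refl d0) simp
  then have "real m * I 0 0 = 1" using \<open>(\<Sum>a<m. I a a) = 1\<close> by simp
  then have I0: "I 0 0 = 1 / real m" using pos by (simp add: field_simps)
  have I: "I a b = (if a = b then 1 / real m else 0)" if "a < m" "b < m" for a b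
    unfolding I0[symmetric] using off[OF that] d0[OF that(1)] by (cases "a = b") simp_all
  have "(\<integral>X. blinfun_apply p X * blinfun_apply p' X \<partial>?U)
      = (\<integral>X. (\<Sum>a<m. \<Sum>b<m. (x a X * x b X) * (blinfun_apply p (e a) * blinfun_apply p' (e b))) \<partial>?U)"
  proof (rule Bochner_Integration.integral_cong[OF refl])
    fix X assume "X \<in> space ?U"
    then have X: "X \<in> H q" by (auto simp: uniform_measure_spec unit_sphere_G)
    have *: "blinfun_apply p X = (\<Sum>a<m. x a X * blinfun_apply p (e a))" for p
      using arg_cong[OF e(3)[OF X], of "blinfun_apply p"] by (simp add: blinfun.sum_right blinfun.scaleR_right x_def)
    show "blinfun_apply p X * blinfun_apply p' X = (\<Sum>a<m. \<Sum>b<m. (x a X * x b X) * (blinfun_apply p (e a) * blinfun_apply p' (e b)))"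
      unfolding *[of p] *[of p'] sum_product by (simp add: mult_ac)
  qed
  also have "\<dots> = (\<Sum>a<m. \<Sum>b<m. I a b * (blinfun_apply p (e a) * blinfun_apply p' (e b)))"
    using int by (simp add: Bochner_Integration.integral_sum I_def)
  also have "\<dots> = (\<Sum>a<m. \<Sum>b<m. if a = b then 1 / real m * (blinfun_apply p (e a) * blinfun_apply p' (e a)) else 0)"
    using I by (intro sum.cong refl) auto
  also have "\<dots> = (\<Sum>a<m. blinfun_apply p (e a) * blinfun_apply p' (e a)) / real m"
    by (simp add: sum_divide_distrib)
  also have "(\<Sum>a<m. blinfun_apply p (e a) * blinfun_apply p' (e a)) = blinfun_apply p (cometric H ip q p')"
    by (simp add: e(4) blinfun.sum_right blinfun.scaleR_right mult.commute)
  finally show "(\<integral>X. blinfun_apply p X * blinfun_apply p' X \<partial>?U) = blinfun_apply p (cometric H ip q p') / real m" .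
qed

end

section \<open>The operator and the divergence in local coordinates\<close>

context sub_riemannian_manifold
begin

definition hess :: "('a, 'n) chart \<Rightarrow> ('a \<Rightarrow> real) \<Rightarrow> 'n \<Rightarrow> 'n \<Rightarrow> 'a \<Rightarrow> real" where
  "hess c f i l q =
    frechet_derivative (\<lambda>z. frechet_derivative (f \<circ> cinv c) (at z) (axis i 1)) (at (cmap c q)) (axis l 1)"

text \<open>The right-hand side of the system, that is, the first-order coefficient of the
  divergence of the horizontal gradient.\<close>

definition div_drift :: "('a, 'n) chart \<Rightarrow> ('a \<Rightarrow> real) \<Rightarrow> 'n \<Rightarrow> 'a \<Rightarrow> real" where
  "div_drift c \<tau> k q = (\<Sum>l\<in>UNIV. \<beta>_comp A H ip c l k q * (1 / \<tau> q * pdiff c l \<tau> q) + pdiff c l (\<beta>_comp A H ip c l k) q)"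

lemma smooth_fun_chart: "smooth_fun_on A UNIV f \<Longrightarrow> c \<in> A \<Longrightarrow> smooth_on (cmap c ` cdom c) (f \<circ> cinv c)"
  by (simp add: smooth_fun_on_def)

lemma pdiff_\<beta>_comp: "pdiff c l (\<beta>_comp A H ip c i j) q = dB c i j (cmap c q) (axis l 1)"
  by (simp add: pdiff_def dB_def Bc_def)

text \<open>The horizontal gradient is \<beta>(df): the defining property of the cometric with p =
  df is that of the gradient.\<close>

lemma grad_hor_comp:
  assumes f: "smooth_fun_on A UNIV f" and c: "c \<in> A" "q \<in> cdom c"
  shows "tcomp A c q (grad_hor A H ip f q) $ i = (\<Sum>j\<in>UNIV. \<beta>_comp A H ip c i j q * pdiff c j f q)"
proof -
  have D: "(f \<circ> cinv c) differentiable (at (cmap c q))"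
    using smooth_on_differentiable[OF smooth_fun_chart[OF f c(1)]] c(2) by blast
  have dd: "ddir A f q v = frechet_derivative (f \<circ> cinv c) (at (cmap c q)) (tcomp A c q v)" for v
    by (rule ddir_chart[OF c D])
  have "linear (ddir A f q)"
    unfolding dd[abs_def] using linear_compose[OF linear_tcomp[OF c] linear_frechet_derivative[OF D]]
    by (simp add: o_def)
  then have df: "blinfun_apply (Blinfun (ddir A f q)) = ddir A f q"
    by (simp add: bounded_linear_Blinfun_apply linear_conv_bounded_linear)
  have "grad_hor A H ip f q = cometric H ip q (Blinfun (ddir A f q))"
    unfolding grad_hor_def
    by (rule the_equality)
       (auto simp: cometric_in ip_cometric df intro!: cometric_eqI[symmetric])
  then have "tcomp A c q (grad_hor A H ip f q) $ i = (\<Sum>j\<in>UNIV. \<beta>_comp A H ip c i j q * ccomp A c q (Blinfun (ddir A f q)) $ j)"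
    using tcomp_cometric[OF c] by simp
  also have "\<dots> = (\<Sum>j\<in>UNIV. \<beta>_comp A H ip c i j q * pdiff c j f q)"
    by (simp add: ccomp_def df dd tbasis_tvec tcomp_tvec[OF c] pdiff_def)
  finally show ?thesis .
qed

text \<open>The Leibniz rule applied to the components \<beta>^{ij} \<partial>_j f. Terms in which
  \<open>f\<close> is differentiated twice form the principal part; the rest is collected by the
  derivative of \<open>f\<close> that it contains.\<close>

lemma div_grad_chart:
  assumes f: "smooth_fun_on A UNIV f" and c: "c \<in> A" "q \<in> cdom c"
  shows "(\<Sum>i\<in>UNIV. tcomp A c q (grad_hor A H ip f q) $ i / \<tau> q * pdiff c i \<tau> q
        + pdiff c i (\<lambda>q'. tcomp A c q' (grad_hor A H ip f q') $ i) q) =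
    (\<Sum>i\<in>UNIV. \<Sum>l\<in>UNIV. \<beta>_comp A H ip c l i q * hess c f i l q) + (\<Sum>k\<in>UNIV. pdiff c k f q * div_drift c \<tau> k q)"
proof -
  let ?y = "cmap c q"
  have y: "?y \<in> cmap c ` cdom c" using c by blast
  define F where "F = f \<circ> cinv c"
  have sF: "smooth_on (cmap c ` cdom c) F" unfolding F_def by (rule smooth_fun_chart[OF f c(1)])
  define dF where "dF j z = frechet_derivative F (at z) (axis j 1)" for j z
  have sdF: "smooth_on (cmap c ` cdom c) (dF j)" for j unfolding dF_def by (rule smooth_on_frechet_derivative[OF sF])
  have pF: "pdiff c j f q = dF j ?y" for j by (simp add: pdiff_def dF_def F_def)
  have hF: "hess c f i l q = frechet_derivative (dF i) (at ?y) (axis l 1)" for i l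
    by (simp add: hess_def dF_def[abs_def] F_def)
  have Bq: "\<beta>_comp A H ip c i j q = Bc c i j ?y" for i j using c by (simp add: Bc_def cinv_cmap)
  have "pdiff c i (\<lambda>q'. tcomp A c q' (grad_hor A H ip f q') $ i) q
     = (\<Sum>j\<in>UNIV. dB c i j ?y (axis i 1) * dF j ?y + Bc c i j ?y * hess c f j i q)" for i
  proof -
    have "((\<lambda>z. \<Sum>j\<in>UNIV. Bc c i j z * dF j z) has_derivative
       (\<lambda>v. \<Sum>j\<in>UNIV. Bc c i j ?y * frechet_derivative (dF j) (at ?y) v + dB c i j ?y v * dF j ?y)) (at ?y)"
      by (intro has_derivative_sum has_derivative_mult Bc_has_derivative c(1) y smooth_on_has_derivative[OF sdF])
    then have "(((\<lambda>q'. tcomp A c q' (grad_hor A H ip f q') $ i) \<circ> cinv c) has_derivative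
       (\<lambda>v. \<Sum>j\<in>UNIV. Bc c i j ?y * frechet_derivative (dF j) (at ?y) v + dB c i j ?y v * dF j ?y)) (at ?y)"
    proof (rule has_derivative_transform_within_open[OF _ open_cmap_cdom[OF c(1)] y])
      fix z assume z: "z \<in> cmap c ` cdom c"
      then show "(\<Sum>j\<in>UNIV. Bc c i j z * dF j z) = ((\<lambda>q'. tcomp A c q' (grad_hor A H ip f q') $ i) \<circ> cinv c) z"
        using grad_hor_comp[OF f c(1) cinv_in[OF c(1) z], of i] cmap_cinv[OF c(1) z]
        by (simp add: Bc_def dF_def F_def pdiff_def)
    qed
    from frechet_derivative_at[OF this, symmetric] show ?thesis
      by (simp add: pdiff_def hF add.commute)
  qed
  then have "(\<Sum>i\<in>UNIV. tcomp A c q (grad_hor A H ip f q) $ i / \<tau> q * pdiff c i \<tau> q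
        + pdiff c i (\<lambda>q'. tcomp A c q' (grad_hor A H ip f q') $ i) q)
    = (\<Sum>i\<in>UNIV. (\<Sum>j\<in>UNIV. Bc c i j ?y * dF j ?y) / \<tau> q * pdiff c i \<tau> q
        + (\<Sum>j\<in>UNIV. dB c i j ?y (axis i 1) * dF j ?y + Bc c i j ?y * hess c f j i q))"
    by (simp add: grad_hor_comp[OF f c] Bq pF)
  also have "\<dots> = (\<Sum>i\<in>UNIV. \<Sum>j\<in>UNIV. Bc c i j ?y * hess c f j i q)
     + (\<Sum>i\<in>UNIV. \<Sum>j\<in>UNIV. dF j ?y * (Bc c i j ?y * (1 / \<tau> q * pdiff c i \<tau> q) + dB c i j ?y (axis i 1)))"
    by (simp add: sum.distrib sum_divide_distrib sum_distrib_left sum_distrib_right algebra_simps)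
  also have "(\<Sum>i\<in>UNIV. \<Sum>j\<in>UNIV. Bc c i j ?y * hess c f j i q) = (\<Sum>i\<in>UNIV. \<Sum>l\<in>UNIV. \<beta>_comp A H ip c l i q * hess c f i l q)"
    by (subst sum.swap) (simp add: Bq)
  also have "(\<Sum>i\<in>UNIV. \<Sum>j\<in>UNIV. dF j ?y * (Bc c i j ?y * (1 / \<tau> q * pdiff c i \<tau> q) + dB c i j ?y (axis i 1)))
     = (\<Sum>k\<in>UNIV. pdiff c k f q * div_drift c \<tau> k q)"
    by (subst sum.swap) (simp add: div_drift_def pF Bq pdiff_\<beta>_comp sum_distrib_left)
  finally show ?thesis .
qed

end

context vertical_sub_riemannian
begin

text \<open>The left-hand side of the system. By \<open>L_vertical_chart\<close> it is
  \<open>m\<close> times the first-order coefficient of the operator.\<close>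

definition drift :: "('a, 'n) chart \<Rightarrow> 'n \<Rightarrow> 'a \<Rightarrow> real" where
  "drift c k q = (\<Sum>l\<in>UNIV. - (1/2) * \<beta>_comp A H ip c l k q *
        (\<Sum>i\<in>UNIV. \<Sum>j\<in>UNIV. gV_comp A H ip V c i j q * pdiff c l (\<beta>_comp A H ip c i j) q)
      + (\<Sum>j\<in>UNIV. P_comp A H ip G c l j q * pdiff c l (\<beta>_comp A H ip c j k) q))"

lemma has_second_moment:
  "has_bochner_integral (uniform_measure H ip q) (\<lambda>X. blinfun_apply p X * blinfun_apply p' X)
    (blinfun_apply p (cometric H ip q p') / real m)"
  using second_moment by (simp add: has_bochner_integral_iff)

text \<open>Each term of the second derivative along the flow is a constant times a product of two
  covectors evaluated at \<open>X\<close>, so \<open>second_moment\<close> integrates it term by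
  term.\<close>

lemma L_vertical_chart:
  assumes f: "smooth_fun_on A UNIV f" and c: "c \<in> A" "x \<in> cdom c"
  shows "L_vertical A H ip V f x = 1 / real m *
    ((\<Sum>i\<in>UNIV. \<Sum>l\<in>UNIV. \<beta>_comp A H ip c l i x * hess c f i l x) + (\<Sum>k\<in>UNIV. pdiff c k f x * drift c k x))"
proof -
  let ?U = "uniform_measure H ip x"
  let ?y = "cmap c x"
  have y: "?y \<in> cmap c ` cdom c" using c by blast
  \<comment> \<open>For horizontal \<open>X\<close>, \<xi>_i(X) is the velocity component dx^i(X);
    by the symmetry of g^V, \<zeta>_j(X) is the j-th component of the initial momentum
    g^V(X).\<close>
  define \<xi> where "\<xi> i = dcoord A c i x" for i
  define \<zeta> where "\<zeta> i = vertical_cometric H ip V x (tbasis A c i x)" for i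
  have sF: "smooth_on (cmap c ` cdom c) (f \<circ> cinv c)" by (rule smooth_fun_chart[OF f c(1)])
  have Bq: "\<beta>_comp A H ip c i j x = Bc c i j ?y" for i j using c by (simp add: Bc_def cinv_cmap)
  \<comment> \<open>The three kinds of moments: velocity with velocity gives \<beta>, velocity with
    momentum gives P, momentum with momentum gives g^V.\<close>
  have m1: "blinfun_apply (\<xi> l) (cometric H ip x (\<xi> i)) = \<beta>_comp A H ip c l i x" for l i
    by (simp add: \<xi>_def \<beta>_comp_def)
  have m2: "blinfun_apply (\<xi> l) (cometric H ip x (\<zeta> j)) = P_comp A H ip G c l j x" for l j
    by (simp add: \<xi>_def \<zeta>_def cometric_vertical_cometric P_comp_def proj_def)
  have m3: "blinfun_apply (\<zeta> a) (cometric H ip x (\<zeta> b)) = gV_comp A H ip V c a b x" for a b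
    by (simp add: \<zeta>_def cometric_vertical_cometric gV_comp_def vertical_cometric_apply proj_H[OF proj_in]
        ip_sym[OF proj_in[of x "tbasis A c a x"] proj_in])
  define E where "E X = (\<Sum>i\<in>UNIV. \<Sum>l\<in>UNIV. hess c f i l x * (blinfun_apply (\<xi> l) X * blinfun_apply (\<xi> i) X)) +
    (\<Sum>i\<in>UNIV. pdiff c i f x *
       (\<Sum>j\<in>UNIV. (\<Sum>l\<in>UNIV. dB c i j ?y (axis l 1) * (blinfun_apply (\<xi> l) X * blinfun_apply (\<zeta> j) X))
         - Bc c i j ?y * ((\<Sum>a\<in>UNIV. \<Sum>b\<in>UNIV. dB c a b ?y (axis j 1) * (blinfun_apply (\<zeta> a) X * blinfun_apply (\<zeta> b) X)) / 2)))" for X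
  have "L_vertical A H ip V f x = (\<integral>X. E X \<partial>?U)"
    unfolding L_vertical_def
  proof (rule Bochner_Integration.integral_cong[OF refl])
    fix X assume "X \<in> space ?U"
    then have X: "X \<in> H x" by (auto simp: uniform_measure_spec unit_sphere_def)
    let ?p = "vertical_cometric H ip V x X"
    have \<eta>: "ccomp A c x ?p $ j = blinfun_apply (\<zeta> j) X" for j
      by (simp add: ccomp_def \<zeta>_def vertical_cometric_sym[of x X])
    have v: "ham_pos c ?y (ccomp A c x ?p) $ i = blinfun_apply (\<xi> i) X" for i
    proof -
      have "ham_pos c ?y (ccomp A c x ?p) $ i = tcomp A c x (cometric H ip x ?p) $ i"
        by (simp add: tcomp_cometric[OF c] ham_pos_def Bq)
      then show ?thesis by (simp add: cometric_vertical_cometric proj_H[OF X] \<xi>_def dcoord_apply[OF c])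
    qed
    have hs: "frechet_derivative (\<lambda>z. frechet_derivative (f \<circ> cinv c) (at z) (axis i 1)) (at ?y) u
       = (\<Sum>l\<in>UNIV. u $ l * hess c f i l x)" for i u
      unfolding hess_def
      by (rule frechet_derivative_axis_sum[OF smooth_on_differentiable[OF smooth_on_frechet_derivative[OF sF] y]])
    show "(deriv ^^ 2) (\<lambda>t. f (fst (hamilton_flow A H ip t (x, ?p)))) 0 = E X"
      unfolding second_derivative_along_flow[OF f c] E_def
      by (simp add: hs dB_axis_sum[OF c(1) y, of _ _ "ham_pos c ?y _"] v \<eta> ham_mom_def pdiff_def
          sum_distrib_left sum_distrib_right mult_ac)
  qed
  \<comment> \<open>Values and integrability are propagated together, so linearity of the integral
    leaves no separate integrability goals.\<close>
  also have "has_bochner_integral ?U E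
    ((\<Sum>i\<in>UNIV. \<Sum>l\<in>UNIV. hess c f i l x * (\<beta>_comp A H ip c l i x / real m)) +
    (\<Sum>i\<in>UNIV. pdiff c i f x *
       (\<Sum>j\<in>UNIV. (\<Sum>l\<in>UNIV. dB c i j ?y (axis l 1) * (P_comp A H ip G c l j x / real m))
         - Bc c i j ?y * ((\<Sum>a\<in>UNIV. \<Sum>b\<in>UNIV. dB c a b ?y (axis j 1) * (gV_comp A H ip V c a b x / real m)) / 2))))"
    unfolding E_def m1[symmetric] m2[symmetric] m3[symmetric]
    by (intro has_bochner_integral_add has_bochner_integral_sum has_bochner_integral_diff has_bochner_integral_mult_right
        has_bochner_integral_divide has_second_moment)
  then have "(\<integral>X. E X \<partial>?U) = (\<Sum>i\<in>UNIV. \<Sum>l\<in>UNIV. hess c f i l x * (\<beta>_comp A H ip c l i x / real m)) +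
    (\<Sum>i\<in>UNIV. pdiff c i f x *
       (\<Sum>j\<in>UNIV. (\<Sum>l\<in>UNIV. dB c i j ?y (axis l 1) * (P_comp A H ip G c l j x / real m))
         - Bc c i j ?y * ((\<Sum>a\<in>UNIV. \<Sum>b\<in>UNIV. dB c a b ?y (axis j 1) * (gV_comp A H ip V c a b x / real m)) / 2)))"
    by (rule has_bochner_integral_integral_eq)
  also have "\<dots> = 1 / real m * ((\<Sum>i\<in>UNIV. \<Sum>l\<in>UNIV. \<beta>_comp A H ip c l i x * hess c f i l x)
     + (\<Sum>i\<in>UNIV. pdiff c i f x *
       (\<Sum>j\<in>UNIV. (\<Sum>l\<in>UNIV. dB c i j ?y (axis l 1) * P_comp A H ip G c l j x)
         - Bc c i j ?y * ((\<Sum>a\<in>UNIV. \<Sum>b\<in>UNIV. dB c a b ?y (axis j 1) * gV_comp A H ip V c a b x) / 2))))"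
    by (simp add: distrib_left sum_distrib_left sum_divide_distrib right_diff_distrib mult_ac)
  finally have fin: "L_vertical A H ip V f x = \<dots>" .
  have dr: "(\<Sum>j\<in>UNIV. (\<Sum>l\<in>UNIV. dB c i j ?y (axis l 1) * P_comp A H ip G c l j x)
         - Bc c i j ?y * ((\<Sum>a\<in>UNIV. \<Sum>b\<in>UNIV. dB c a b ?y (axis j 1) * gV_comp A H ip V c a b x) / 2)) = drift c i x" for i
  proof -
    \<comment> \<open>The flow produces derivatives of \<beta>^{ij} with the free index first, the
      system has it last.\<close>
    have sB: "dB c i j = dB c j i" for j
    proof -
      have "Bc c i j = Bc c j i" by (rule ext) (rule Bc_sym)
      then show ?thesis by (intro ext) (simp add: dB_def)
    qed
    have "(\<Sum>j\<in>UNIV. \<Sum>l\<in>UNIV. dB c i j ?y (axis l 1) * P_comp A H ip G c l j x)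
        = (\<Sum>l\<in>UNIV. \<Sum>j\<in>UNIV. P_comp A H ip G c l j x * dB c j i ?y (axis l 1))"
      by (subst sum.swap) (simp add: sB mult.commute)
    then show ?thesis
      by (simp add: drift_def sum.distrib sum_subtractf pdiff_\<beta>_comp Bq Bc_sym[of c i] sum_negf mult.commute)
  qed
  show ?thesis using fin unfolding dr .
qed

end

section \<open>Volume forms and the divergence\<close>

lemma top_form_row_linear:
  assumes "top_form F"
  shows "linear (\<lambda>v. F (\<chi> k. if k = i then v else M $ k))"
  using assms[unfolded top_form_def, THEN conjunct1] by simp

lemma top_form_alternating:
  assumes "top_form F" "i \<noteq> j" "M $ i = M $ j"
  shows "F M = 0"
  using assms(1)[unfolded top_form_def, THEN conjunct2, rule_format, of i j M] assms(2,3) by simp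

lemma top_form_zero_row:
  assumes "top_form F" "M $ i = 0"
  shows "F M = 0"
proof -
  have "M = (\<chi> k. if k = i then 0 else M $ k)" using assms(2) by (simp add: vec_eq_iff)
  then show ?thesis using linear_0[OF top_form_row_linear[OF assms(1), of i M]] by simp
qed

lemma top_form_add_row:
  assumes F: "top_form F" and "a \<noteq> b"
  shows "F (\<chi> k. if k = a then N $ a + c *\<^sub>R N $ b else N $ k) = F N"
proof -
  note l = top_form_row_linear[OF F, of a N]
  have "F (\<chi> k. if k = a then N $ b else N $ k) = 0"
    by (rule top_form_alternating[OF F assms(2)]) simp
  moreover have "(\<chi> k. if k = a then N $ a else N $ k) = N" by (simp add: vec_eq_iff)
  ultimately show ?thesis using linear_add[OF l, of "N $ a" "c *\<^sub>R N $ b"] linear_cmul[OF l, of c "N $ b"] by simp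
qed

text \<open>Polarisation: the form vanishes when both rows equal their sum, and expanding this
  leaves the two mixed terms.\<close>

lemma top_form_swap:
  assumes F: "top_form F" and "a \<noteq> b"
  shows "F (\<chi> k. N $ (Transposition.transpose a b k)) = - F N"
proof -
  define B where "B u v = F (\<chi> k. if k = a then u else if k = b then v else N $ k)" for u v
  have la: "linear (\<lambda>u. B u v)" for v
    using top_form_row_linear[OF F, of a "\<chi> k. if k = b then v else N $ k"] by (simp add: B_def cong: if_cong)
  have lb: "linear (\<lambda>v. B u v)" for u
  proof -
    have "(\<chi> k. if k = b then v else (\<chi> k. if k = a then u else N $ k) $ k)
        = (\<chi> k. if k = a then u else if k = b then v else N $ k)" for v
      using assms(2) by (simp add: vec_eq_iff)
    then show ?thesis
      using top_form_row_linear[OF F, of b "\<chi> k. if k = a then u else N $ k"] unfolding B_def by (simp cong: if_cong)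
  qed
  have alt: "B u u = 0" for u
    unfolding B_def by (rule top_form_alternating[OF F assms(2)]) simp
  have "B (N $ a + N $ b) (N $ a + N $ b) = B (N $ a) (N $ a) + B (N $ a) (N $ b) + (B (N $ b) (N $ a) + B (N $ b) (N $ b))"
    using linear_add[OF la] linear_add[OF lb] by simp
  then have "B (N $ b) (N $ a) = - B (N $ a) (N $ b)" by (simp add: alt)
  moreover have "(\<chi> k. if k = a then N $ a else if k = b then N $ b else N $ k) = N" by (simp add: vec_eq_iff)
  moreover have "(\<chi> k. if k = a then N $ b else if k = b then N $ a else N $ k) = (\<chi> k. N $ (Transposition.transpose a b k))"
    by (simp add: vec_eq_iff Transposition.transpose_def)
  ultimately show ?thesis unfolding B_def by simp
qed

text \<open>With this the row lemmas also apply to \<open>det\<close> and yield the determinants of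
  the elementary matrices below.\<close>

lemma top_form_det: "top_form (det :: real ^ 'n ^ 'n \<Rightarrow> real)"
  unfolding top_form_def
proof (intro conjI allI impI)
  fix M :: "real ^ 'n ^ 'n" and i
  show "linear (\<lambda>v. det (\<chi> k. if k = i then v else M $ k))"
    using det_row_add[of i "\<lambda>_. _" "\<lambda>_. _" "\<lambda>k. M $ k"] det_row_mul[of i _ "\<lambda>_. _" "\<lambda>k. M $ k"]
    by (intro linearI) (simp_all add: scalar_mult_eq_scaleR cong: if_cong)
next
  fix M :: "real ^ 'n ^ 'n" and i j assume "i \<noteq> j \<and> M $ i = M $ j"
  then show "det M = 0" by (intro det_identical_rows[of i j]) (auto simp: row_def vec_eq_iff)
qed

lemma top_form_scale_rows:
  assumes F: "top_form F"
  shows "F (\<chi> k. if k \<in> S then d k *\<^sub>R N $ k else N $ k) = prod d S * F N"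
proof (induction S rule: infinite_finite_induct)
  case (infinite S)
  then show ?case by simp
next
  case empty
  have "(\<chi> k. N $ k) = N" by (simp add: vec_eq_iff)
  then show ?case by simp
next
  case (insert x S)
  let ?M = "\<chi> k. if k \<in> S then d k *\<^sub>R N $ k else N $ k"
  have 1: "(\<chi> k. if k \<in> insert x S then d k *\<^sub>R N $ k else N $ k) = (\<chi> k. if k = x then d x *\<^sub>R N $ x else ?M $ k)"
    by (simp add: vec_eq_iff)
  have 2: "(\<chi> k. if k = x then N $ x else ?M $ k) = ?M" using insert by (simp add: vec_eq_iff)
  show ?case
    unfolding 1 using linear_cmul[OF top_form_row_linear[OF F, of x ?M], of "d x" "N $ x"] insert
    unfolding 2 by simp
qed

text \<open>Both sides are compatible with products of matrices, so it suffices to treat the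
  matrices produced by elimination: a zero row, a diagonal matrix, a swap of rows and the addition
  of a multiple of one row to another.\<close>

lemma top_form_matrix_mult:
  fixes M N :: "real ^ 'n ^ 'n"
  assumes F: "top_form F"
  shows "F (M ** N) = det M * F N"
proof -
  have "\<forall>N. F (M ** N) = det M * F N"
  proof (induction M rule: induct_matrix_elementary)
    case (1 A B)
    then show ?case by (simp add: det_mul flip: matrix_mul_assoc)
  next
    case (2 A i)
    then have "A $ i = 0" by (simp add: row_def vec_eq_iff)
    then have "(A ** N) $ i = 0" for N :: "real ^ 'n ^ 'n" by (simp add: matrix_matrix_mult_def vec_eq_iff)
    then show ?case using top_form_zero_row[OF F] top_form_zero_row[OF top_form_det] \<open>A $ i = 0\<close> by fastforce
  next
    case (3 A)
    show ?case
    proof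
      fix N :: "real ^ 'n ^ 'n"
      have "(\<Sum>k\<in>UNIV. A $ i $ k * N $ k $ j) = (\<Sum>k\<in>UNIV. if k = i then A $ i $ i * N $ i $ j else 0)" for i j
        using 3[of i] by (intro sum.cong refl) auto
      then have "A ** N = (\<chi> k. if k \<in> UNIV then A $ k $ k *\<^sub>R N $ k else N $ k)"
        by (simp add: matrix_matrix_mult_def vec_eq_iff)
      then show "F (A ** N) = det A * F N"
        using top_form_scale_rows[OF F, of UNIV "\<lambda>k. A $ k $ k" N] det_diagonal[of A] 3 by simp
    qed
  next
    case (4 a b)
    let ?S = "(\<chi> i j. mat 1 $ i $ Transposition.transpose a b j) :: real ^ 'n ^ 'n"
    have e: "?S ** N = (\<chi> k. N $ (Transposition.transpose a b k))" for N :: "real ^ 'n ^ 'n"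
    proof -
      have "(\<Sum>k\<in>UNIV. ?S $ i $ k * N $ k $ j) = (\<Sum>k\<in>UNIV. if k = Transposition.transpose a b i then N $ k $ j else 0)" for i j
        by (intro sum.cong refl) (auto simp: mat_def transpose_eq_iff)
      then show ?thesis by (simp add: matrix_matrix_mult_def vec_eq_iff)
    qed
    have "det ?S = - 1" using top_form_swap[OF top_form_det 4, of "mat 1"] e[of "mat 1"] by simp
    then show ?case using top_form_swap[OF F 4] e by simp
  next
    case (5 a b c)
    let ?S = "(\<chi> i j. if i = a \<and> j = b then c else of_bool (i = j)) :: real ^ 'n ^ 'n"
    have e: "?S ** N = (\<chi> k. if k = a then N $ a + c *\<^sub>R N $ b else N $ k)" for N :: "real ^ 'n ^ 'n"
    proof -
      have "(\<Sum>k\<in>UNIV. ?S $ i $ k * N $ k $ j) = (\<Sum>k\<in>UNIV. if k = i then N $ k $ j else 0)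
          + (\<Sum>k\<in>UNIV. if k = b then (if i = a then c * N $ k $ j else 0) else 0)" for i j
        unfolding sum.distrib[symmetric] using 5 by (intro sum.cong refl) auto
      then show ?thesis by (simp add: matrix_matrix_mult_def vec_eq_iff)
    qed
    have "det ?S = 1" using top_form_add_row[OF top_form_det 5, of "mat 1" c] e[of "mat 1"] by simp
    then show ?case using top_form_add_row[OF F 5] e by simp
  qed
  then show ?thesis by blast
qed

text \<open>Jacobi's formula at the identity matrix. A permutation other than the identity moves at
  least two indices, so after one factor has been differentiated an off-diagonal entry, equal to
  zero, remains in the product.\<close>

lemma has_derivative_det_at_identity:
  fixes M :: "'n::finite \<Rightarrow> 'n \<Rightarrow> 'a::real_normed_vector \<Rightarrow> real"
  assumes "\<And>i j. (M i j has_derivative M' i j) (at x)" "\<And>i j. M i j x = (if i = j then 1 else 0)"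
  shows "((\<lambda>y. det (\<chi> i j. M i j y)) has_derivative (\<lambda>v. \<Sum>i\<in>UNIV. M' i i v)) (at x)"
proof -
  let ?P = "{p. p permutes (UNIV :: 'n set)}"
  have "((\<lambda>y. det (\<chi> i j. M i j y)) has_derivative
     (\<lambda>v. \<Sum>p\<in>?P. of_int (sign p) * (\<Sum>i\<in>UNIV. M' i (p i) v * (\<Prod>j\<in>UNIV - {i}. M j (p j) x)))) (at x)"
    unfolding det_def vec_lambda_beta
    by (intro has_derivative_sum has_derivative_mult_right has_derivative_prod assms(1))
  moreover have "(\<Sum>p\<in>?P. of_int (sign p) * (\<Sum>i\<in>UNIV. M' i (p i) v * (\<Prod>j\<in>UNIV - {i}. M j (p j) x))) = (\<Sum>i\<in>UNIV. M' i i v)" for v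
  proof -
    have "(\<Prod>j\<in>UNIV - {i}. M j (p j) x) = 0" if p: "p permutes UNIV" "p \<noteq> id" for p i
    proof -
      obtain k where k: "p k \<noteq> k" using p(2) by (auto simp: fun_eq_iff)
      have "p (p k) \<noteq> p k" using k permutes_inj[OF p(1)] by (auto dest: injD)
      \<comment> \<open>Both \<open>k\<close> and \<open>p k\<close> are moved by \<open>p\<close>,
        and at least one of them differs from the differentiated index \<open>i\<close>.\<close>
      then obtain j where "j \<noteq> i" "p j \<noteq> j" using k by (cases "k = i") auto
      then show ?thesis by (intro prod_zero) (auto simp: assms(2) intro!: bexI[of _ j])
    qed
    then have "(\<Sum>p\<in>?P. of_int (sign p) * (\<Sum>i\<in>UNIV. M' i (p i) v * (\<Prod>j\<in>UNIV - {i}. M j (p j) x)))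
      = (\<Sum>p\<in>{id}. of_int (sign p) * (\<Sum>i\<in>UNIV. M' i (p i) v * (\<Prod>j\<in>UNIV - {i}. M j (p j) x)))"
      by (intro sum.mono_neutral_right) (auto simp: permutes_id finite_permutations simp del: prod_zero_iff)
    also have "\<dots> = (\<Sum>i\<in>UNIV. M' i i v)" by (simp add: assms(2) sign_id)
    finally show ?thesis .
  qed
  ultimately show ?thesis by simp
qed

lemma trace_conjugate:
  fixes P Q L :: "real ^ 'n \<Rightarrow> real ^ 'n"
  assumes "linear P" "linear Q" "linear L" "\<And>u. Q (P u) = u"
  shows "(\<Sum>i\<in>UNIV. P (L (Q (axis i 1))) $ i) = (\<Sum>i\<in>UNIV. L (axis i 1) $ i)"
proof -
  have "(\<Sum>i\<in>UNIV. P (L (Q (axis i 1))) $ i) = trace (matrix (P \<circ> (L \<circ> Q)))"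
    by (simp add: trace_def matrix_def)
  also have "\<dots> = trace (matrix P ** matrix (L \<circ> Q))"
    using matrix_compose[OF linear_compose[OF assms(2,3)] assms(1)] by simp
  also have "\<dots> = trace (matrix (L \<circ> Q) ** matrix P)" by (rule trace_mul_sym)
  also have "\<dots> = trace (matrix ((L \<circ> Q) \<circ> P))"
    using matrix_compose[OF assms(1) linear_compose[OF assms(2,3)]] by simp
  also have "\<dots> = (\<Sum>i\<in>UNIV. L (axis i 1) $ i)"
    by (simp add: trace_def matrix_def assms(4))
  finally show ?thesis .
qed

context smooth_manifold
begin

section \<open>Independence of the divergence of the chart\<close>

definition div_expr :: "('a \<Rightarrow> real ^ 'n ^ 'n \<Rightarrow> real) \<Rightarrow> ('a \<Rightarrow> real ^ 'n) \<Rightarrow> ('a, 'n) chart \<Rightarrow> 'a \<Rightarrow> real" where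
  "div_expr \<omega> X c q = (\<Sum>i\<in>UNIV. tcomp A c q (X q) $ i / vol_density A \<omega> c q * pdiff c i (vol_density A \<omega> c) q
               + pdiff c i (\<lambda>q'. tcomp A c q' (X q') $ i) q)"

text \<open>The arguments of the form are rows of a matrix, so the change of basis enters through
  the transposed Jacobian, which has the same determinant.\<close>

lemma vol_density_change:
  assumes "c \<in> A" "c' \<in> A" "q \<in> cdom c" "q \<in> cdom c'" "top_form (\<omega> q)"
  shows "vol_density A \<omega> c q = det (matrix (dtrans c c' q)) * vol_density A \<omega> c' q"
proof -
  have "tbasis A c i q = (\<Sum>j\<in>UNIV. dtrans c c' q (axis i 1) $ j *\<^sub>R tbasis A c' j q)" for i
  proof -
    have "tbasis A c i q = tvec A c' q (dtrans c c' q (axis i 1))"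
      unfolding tbasis_tvec using tvec_dtrans[OF assms(1-4)] by simp
    also have "\<dots> = tvec A c' q (\<Sum>j\<in>UNIV. dtrans c c' q (axis i 1) $ j *\<^sub>R axis j 1)"
      by (simp add: vec_axis_sum)
    finally show ?thesis
      using linear_tvec[OF assms(2,4)] by (simp add: linear_sum linear_cmul tbasis_tvec)
  qed
  then have "(\<chi> i. tbasis A c i q) = transpose (matrix (dtrans c c' q)) ** (\<chi> j. tbasis A c' j q)"
    by (simp add: vec_eq_iff matrix_matrix_mult_def transpose_def matrix_def)
  then show ?thesis unfolding vol_density_def by (simp add: top_form_matrix_mult[OF assms(5)])
qed

text \<open>The coordinate sums become a derivative of the density along \<open>X\<close> and a
  trace of the derivative of the local representative. In this form a change of chart concerns only
  a Jacobian determinant and a trace.\<close>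

lemma div_expr_eq:
  assumes c: "c \<in> A" "q \<in> cdom c"
    and \<tau>: "(vol_density A \<omega> c \<circ> cinv c) differentiable (at (cmap c q))"
    and X: "vf_in A c X differentiable (at (cmap c q))"
  shows "div_expr \<omega> X c q =
    frechet_derivative (vol_density A \<omega> c \<circ> cinv c) (at (cmap c q)) (tcomp A c q (X q)) / vol_density A \<omega> c q +
    (\<Sum>i\<in>UNIV. frechet_derivative (vf_in A c X) (at (cmap c q)) (axis i 1) $ i)"
proof -
  have "pdiff c i (\<lambda>q'. tcomp A c q' (X q') $ i) q = frechet_derivative (vf_in A c X) (at (cmap c q)) (axis i 1) $ i" for i
  proof -
    have "((\<lambda>y. vf_in A c X y $ i) has_derivative (\<lambda>v. frechet_derivative (vf_in A c X) (at (cmap c q)) v $ i)) (at (cmap c q))"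
      by (rule bounded_linear.has_derivative[OF bounded_linear_vec_nth differentiable_has_frechet_derivative[OF X]])
    from frechet_derivative_at[OF this, symmetric] show ?thesis
      by (simp add: pdiff_def o_def vf_in_def)
  qed
  then show ?thesis
    unfolding div_expr_def frechet_derivative_axis_sum[OF \<tau>, of "tcomp A c q (X q)"]
    by (simp add: sum.distrib pdiff_def sum_divide_distrib)
qed

text \<open>Let \<phi> be the coordinate change from \<open>c\<close> to \<open>c'\<close>. The
  logarithmic derivative of its Jacobian determinant along \<open>X\<close> is the trace of u
  \<mapsto> D^2\<phi>(Q u, X), which is also the amount by which the trace of the derivative of
  \<open>X\<close> grows on passing to \<open>c'\<close>. The two contributions compensate each
  other.\<close>

lemma div_expr_change_chart:
  assumes c: "c \<in> A" "c' \<in> A" and q: "q \<in> cdom c" "q \<in> cdom c'"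
    and \<omega>: "\<And>q. top_form (\<omega> q)" "vol_density A \<omega> c q \<noteq> 0" "vol_density A \<omega> c' q \<noteq> 0"
    and \<tau>: "(vol_density A \<omega> c \<circ> cinv c) differentiable (at (cmap c q))"
    and \<tau>': "(vol_density A \<omega> c' \<circ> cinv c') differentiable (at (cmap c' q))"
    and X: "vf_in A c X differentiable (at (cmap c q))"
  shows "div_expr \<omega> X c q = div_expr \<omega> X c' q"
proof -
  define y where "y = cmap c q"
  define y' where "y' = cmap c' q"
  define W where "W = cmap c ` (cdom c \<inter> cdom c')"
  define W' where "W' = cmap c' ` (cdom c' \<inter> cdom c)"
  define \<phi> where "\<phi> = cmap c' \<circ> cinv c"
  define \<psi> where "\<psi> = cmap c \<circ> cinv c'"
  define P where "P = dtrans c c' q"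
  define Q where "Q = dtrans c' c q"
  define D where "D w = (\<lambda>z. frechet_derivative \<phi> (at z) w)" for w
  define X0 where "X0 = tcomp A c q (X q)"
  define L where "L = frechet_derivative (vf_in A c X) (at y)"
  have oW: "open W" "open W'" unfolding W_def W'_def using open_overlap c by auto
  have yW: "y \<in> W" "y' \<in> W'" using q by (auto simp: y_def y'_def W_def W'_def)
  have sm: "smooth_on W \<phi>" unfolding W_def \<phi>_def by (rule smooth_on_transition) fact+
  have sD: "smooth_on W (D w)" for w unfolding D_def by (rule smooth_on_frechet_derivative[OF sm])
  have P: "P = frechet_derivative \<phi> (at y)" and Dy: "D w y = P w" for w
    by (simp_all add: P_def D_def \<phi>_def dtrans_def y_def)
  have lin: "linear P" "linear Q" unfolding P_def Q_def using linear_dtrans c q by auto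
  have lL: "linear L" unfolding L_def using linear_frechet_derivative X y_def by blast
  have PQ: "P (Q u) = u" and QP: "Q (P u) = u" for u
    unfolding P_def Q_def using dtrans_inverse c q by auto
  have X0: "vf_in A c X y = X0" using c q by (simp add: vf_in_def y_def X0_def cinv_cmap)
  have D_lin: "D w z = (\<Sum>j\<in>UNIV. w $ j *\<^sub>R D (axis j 1) z)" if "z \<in> W" for w z
  proof -
    have l: "linear (frechet_derivative \<phi> (at z))"
      by (rule linear_frechet_derivative[OF smooth_on_differentiable[OF sm that]])
    have "D w z = frechet_derivative \<phi> (at z) (\<Sum>j\<in>UNIV. w $ j *\<^sub>R axis j 1)" by (simp add: D_def vec_axis_sum)
    then show ?thesis using l by (simp add: linear_sum linear_cmul D_def)
  qed
  define S where "S w v = frechet_derivative (D w) (at y) v" for w v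
  have S_sym: "S w v = S v w" for v w
    unfolding S_def D_def by (rule symmetric_second_derivative[OF oW(1) yW(1) sm])
  have S_has: "(D w has_derivative S w) (at y)" for w
    unfolding S_def[abs_def] by (rule smooth_on_has_derivative[OF sD yW(1)])
  have S_lin: "linear (S w)" for w
    using has_derivative_linear[OF S_has] .
  have dens: "(vol_density A \<omega> c \<circ> cinv c) z = det (matrix (frechet_derivative \<phi> (at z))) * (vol_density A \<omega> c' \<circ> cinv c') (\<phi> z)"
    if "z \<in> W" for z
  proof -
    obtain r where r: "r \<in> cdom c" "r \<in> cdom c'" "z = cmap c r" using \<open>z \<in> W\<close> by (auto simp: W_def)
    then show ?thesis
      using vol_density_change[OF c r(1,2) \<omega>(1)] c by (simp add: \<phi>_def dtrans_def cinv_cmap)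
  qed
  define dJ where "dJ v = (\<Sum>i\<in>UNIV. S (Q (axis i 1)) v $ i) * det (matrix P)" for v
  have detPQ: "det (matrix Q) * det (matrix P) = 1"
  proof -
    have "matrix Q ** matrix P = mat 1"
      using matrix_compose[OF lin] by (simp add: o_def QP matrix_id_mat_1[unfolded id_def])
    then show ?thesis by (metis det_I det_mul)
  qed
  \<comment> \<open>Multiplying the Jacobian by the inverse \<open>Q\<close> of its value at
    \<open>y\<close> moves the computation to the identity matrix, where the derivative of the
    determinant is a trace.\<close>
  have "((\<lambda>z. det (\<chi> i j. D (Q (axis j 1)) z $ i)) has_derivative (\<lambda>v. \<Sum>i\<in>UNIV. S (Q (axis i 1)) v $ i)) (at y)"
    by (rule has_derivative_det_at_identity[where M' = "\<lambda>i j v. S (Q (axis j 1)) v $ i"])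
       (auto intro!: bounded_linear.has_derivative[OF bounded_linear_vec_nth] S_has simp: Dy PQ axis_def)
  from has_derivative_mult_left[OF this, of "det (matrix P)"]
  have "((\<lambda>z. det (\<chi> i j. D (Q (axis j 1)) z $ i) * det (matrix P)) has_derivative dJ) (at y)"
    by (simp add: dJ_def[abs_def])
  then have detJ: "((\<lambda>z. det (matrix (frechet_derivative \<phi> (at z)))) has_derivative dJ) (at y)"
  proof (rule has_derivative_transform_within_open[OF _ oW(1) yW(1)])
    fix z assume z: "z \<in> W"
    have lz: "linear (frechet_derivative \<phi> (at z))"
      by (rule linear_frechet_derivative[OF smooth_on_differentiable[OF sm z]])
    have "(\<chi> i j. D (Q (axis j 1)) z $ i) = matrix (frechet_derivative \<phi> (at z) \<circ> Q)"
      by (simp add: matrix_def D_def)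
    also have "\<dots> = matrix (frechet_derivative \<phi> (at z)) ** matrix Q" by (rule matrix_compose[OF lin(2) lz])
    finally have "det (\<chi> i j. D (Q (axis j 1)) z $ i) = det (matrix (frechet_derivative \<phi> (at z))) * det (matrix Q)"
      by (simp add: det_mul)
    then show "det (\<chi> i j. D (Q (axis j 1)) z $ i) * det (matrix P) = det (matrix (frechet_derivative \<phi> (at z)))"
      using detPQ by simp
  qed
  have \<phi>_has: "(\<phi> has_derivative P) (at y)" unfolding P by (rule smooth_on_has_derivative[OF sm yW(1)])
  have \<phi>y: "\<phi> y = y'" using c q by (simp add: \<phi>_def y_def y'_def cinv_cmap)
  let ?\<tau> = "vol_density A \<omega> c \<circ> cinv c" and ?\<tau>' = "vol_density A \<omega> c' \<circ> cinv c'"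
  have "(?\<tau>' has_derivative frechet_derivative ?\<tau>' (at y')) (at (\<phi> y))"
    unfolding \<phi>y y'_def by (rule differentiable_has_frechet_derivative[OF \<tau>'])
  from diff_chain_at[OF \<phi>_has this] have "((\<lambda>z. ?\<tau>' (\<phi> z)) has_derivative (\<lambda>v. frechet_derivative ?\<tau>' (at y') (P v))) (at y)"
    by (simp add: o_def)
  from has_derivative_mult[OF detJ this, folded P, unfolded \<phi>y]
  have "(?\<tau> has_derivative (\<lambda>v. det (matrix P) * frechet_derivative ?\<tau>' (at y') (P v) + dJ v * ?\<tau>' y')) (at y)"
    by (rule has_derivative_transform_within_open[OF _ oW(1) yW(1)])
       (rule dens[symmetric])
  from fun_cong[OF frechet_derivative_at[OF this], of X0]
  have "frechet_derivative ?\<tau> (at y) X0 = det (matrix P) * frechet_derivative ?\<tau>' (at y') (P X0) + dJ X0 * ?\<tau>' y'"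
    by (rule sym)
  moreover have "vol_density A \<omega> c q = det (matrix P) * vol_density A \<omega> c' q"
    unfolding P_def by (rule vol_density_change[OF c q \<omega>(1)])
  moreover have "?\<tau>' y' = vol_density A \<omega> c' q" using c q by (simp add: y'_def cinv_cmap)
  moreover have "det (matrix P) \<noteq> 0" using detPQ by auto
  ultimately have A: "frechet_derivative ?\<tau> (at y) X0 / vol_density A \<omega> c q
     = frechet_derivative ?\<tau>' (at y') (P X0) / vol_density A \<omega> c' q + (\<Sum>i\<in>UNIV. S (Q (axis i 1)) X0 $ i)"
    using \<omega>(3) by (simp add: dJ_def field_simps)
  \<comment> \<open>The representative of \<open>X\<close> in the new chart as a function of the old
    coordinates, expanded in fixed directions so that the product rule applies.\<close>
  define \<Theta> where "\<Theta> z = (\<Sum>j\<in>UNIV. vf_in A c X z $ j *\<^sub>R D (axis j 1) z)" for z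
  have "((\<lambda>z. vf_in A c X z $ j) has_derivative (\<lambda>v. L v $ j)) (at y)" for j
    unfolding L_def y_def
    by (rule bounded_linear.has_derivative[OF bounded_linear_vec_nth differentiable_has_frechet_derivative[OF X]])
  then have \<Theta>_has: "(\<Theta> has_derivative (\<lambda>v. \<Sum>j\<in>UNIV. X0 $ j *\<^sub>R S (axis j 1) v + L v $ j *\<^sub>R P (axis j 1))) (at y)"
    unfolding \<Theta>_def[abs_def] using X0 Dy
    by (auto intro!: has_derivative_sum derivative_eq_intros S_has)
  \<comment> \<open>Symmetry of the second derivative exchanges the two arguments of
    \<open>S\<close>, which gives the trace the form that occurs in \<open>dJ\<close>.\<close>
  have \<Theta>': "(\<Sum>j\<in>UNIV. X0 $ j *\<^sub>R S (axis j 1) v + L v $ j *\<^sub>R P (axis j 1)) = S v X0 + P (L v)" for v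
  proof -
    have "S v X0 = S v (\<Sum>j\<in>UNIV. X0 $ j *\<^sub>R axis j 1)" by (simp add: vec_axis_sum)
    also have "\<dots> = (\<Sum>j\<in>UNIV. X0 $ j *\<^sub>R S v (axis j 1))"
      using S_lin by (simp add: linear_sum linear_cmul)
    also have "\<dots> = (\<Sum>j\<in>UNIV. X0 $ j *\<^sub>R S (axis j 1) v)"
      by (intro sum.cong refl arg_cong2[where f = scaleR] S_sym)
    finally have 1: "S v X0 = (\<Sum>j\<in>UNIV. X0 $ j *\<^sub>R S (axis j 1) v)" .
    have "P (L v) = P (\<Sum>j\<in>UNIV. L v $ j *\<^sub>R axis j 1)" by (simp add: vec_axis_sum)
    also have "\<dots> = (\<Sum>j\<in>UNIV. L v $ j *\<^sub>R P (axis j 1))" using lin by (simp add: linear_sum linear_cmul)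
    finally show ?thesis using 1 by (simp add: sum.distrib)
  qed
  have "\<psi> y' = y" using c q by (simp add: \<psi>_def y_def y'_def cinv_cmap)
  then have "(\<Theta> has_derivative (\<lambda>v. S v X0 + P (L v))) (at (\<psi> y'))" using \<Theta>_has unfolding \<Theta>' by simp
  moreover have "(\<psi> has_derivative Q) (at y')"
    unfolding Q_def \<psi>_def y'_def by (rule has_derivative_transition) fact+
  ultimately have "((\<lambda>z. \<Theta> (\<psi> z)) has_derivative (\<lambda>u. S (Q u) X0 + P (L (Q u)))) (at y')"
    using diff_chain_at by (fastforce simp: o_def)
  then have X'_has: "(vf_in A c' X has_derivative (\<lambda>u. S (Q u) X0 + P (L (Q u)))) (at y')"
  proof (rule has_derivative_transform_within_open[OF _ oW(2) yW(2)])
    fix z assume "z \<in> W'"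
    then obtain r where r: "r \<in> cdom c" "r \<in> cdom c'" "z = cmap c' r" by (auto simp: W'_def)
    have \<psi>z: "\<psi> z = cmap c r" using r c by (simp add: \<psi>_def cinv_cmap)
    have "\<Theta> (cmap c r) = D (vf_in A c X (cmap c r)) (cmap c r)"
      unfolding \<Theta>_def using r by (subst D_lin[of "cmap c r"]) (auto simp: W_def)
    also have "\<dots> = dtrans c c' r (tcomp A c r (X r))"
      using r c by (simp add: D_def \<phi>_def dtrans_def vf_in_def cinv_cmap)
    also have "\<dots> = vf_in A c' X z" using r c dtrans_tcomp[OF c r(1,2)] by (simp add: vf_in_def cinv_cmap)
    finally show "\<Theta> (\<psi> z) = vf_in A c' X z" by (simp add: \<psi>z)
  qed
  have B: "(\<Sum>i\<in>UNIV. frechet_derivative (vf_in A c' X) (at y') (axis i 1) $ i)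
     = (\<Sum>i\<in>UNIV. S (Q (axis i 1)) X0 $ i) + (\<Sum>i\<in>UNIV. L (axis i 1) $ i)"
    unfolding frechet_derivative_at[OF X'_has, symmetric]
    using trace_conjugate[OF lin lL QP] by (simp add: sum.distrib)
  have C: "tcomp A c' q (X q) = P X0" unfolding P_def X0_def using dtrans_tcomp[OF c q] by simp
  have X': "vf_in A c' X differentiable (at (cmap c' q))" using X'_has unfolding y'_def by (rule differentiableI)
  show ?thesis
    unfolding div_expr_eq[OF c(1) q(1) \<tau> X] div_expr_eq[OF c(2) q(2) \<tau>' X']
    using A B C by (simp add: y_def y'_def L_def X0_def)
qed

text \<open>The value demanded by the description exists because all positively oriented charts
  around \<open>q\<close> give the same number, and \<open>c\<close> itself forces its
  uniqueness.\<close>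

lemma divergence_eq_div_expr:
  assumes ori: "orientation A ori" and \<omega>: "volume_form A ori \<omega>" and c: "c \<in> ori" "q \<in> cdom c"
    and X: "\<And>c. c \<in> A \<Longrightarrow> q \<in> cdom c \<Longrightarrow> vf_in A c X differentiable (at (cmap c q))"
  shows "divergence A ori \<omega> X q = div_expr \<omega> X c q"
proof -
  have sub: "ori \<subseteq> A" using ori by (simp add: orientation_def)
  have eq: "div_expr \<omega> X c q = div_expr \<omega> X c' q" if c': "c' \<in> ori" "q \<in> cdom c'" for c'
  proof (rule div_expr_change_chart)
    have d: "(vol_density A \<omega> c \<circ> cinv c) differentiable (at (cmap c q))" "vol_density A \<omega> c q \<noteq> 0" if "c \<in> ori" "q \<in> cdom c" for c
      using \<omega> that smooth_on_differentiable[of "cmap c ` cdom c" "vol_density A \<omega> c \<circ> cinv c" "cmap c q"]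
      by (fastforce simp: volume_form_def)+
    show "(vol_density A \<omega> c \<circ> cinv c) differentiable (at (cmap c q))" "vol_density A \<omega> c q \<noteq> 0" by (rule d[OF c])+
    show "(vol_density A \<omega> c' \<circ> cinv c') differentiable (at (cmap c' q))" "vol_density A \<omega> c' q \<noteq> 0" by (rule d[OF c'])+
    show "top_form (\<omega> q)" for q using \<omega> by (simp add: volume_form_def)
    show "c \<in> A" "c' \<in> A" using sub c c' by auto
    show "vf_in A c X differentiable (at (cmap c q))" by (rule X) (use sub c in auto)
  qed (use c c' in auto)
  show ?thesis
    unfolding divergence_def div_expr_def[symmetric]
  proof (rule the_equality)
    show "\<forall>c'\<in>ori. q \<in> cdom c' \<longrightarrow> div_expr \<omega> X c q = div_expr \<omega> X c' q" by (intro ballI impI eq)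
    show "r = div_expr \<omega> X c q" if "\<forall>c\<in>ori. q \<in> cdom c \<longrightarrow> r = div_expr \<omega> X c q" for r
      by (rule that[rule_format, OF c])
  qed
qed

end

section \<open>Functions with prescribed differential at a point\<close>

text \<open>For \<open>k\<close> = 0 the standard smooth function that is flat at 0. The powers of
  1/x make the family closed under differentiation up to linear combinations, so that smoothness
  follows by induction for all \<open>k\<close> at once.\<close>

definition flat_exp :: "nat \<Rightarrow> real \<Rightarrow> real" where
  "flat_exp k x = (if x > 0 then inverse x ^ k * exp (- inverse x) else 0)"

lemma flat_exp_tendsto_0: "(flat_exp k \<longlongrightarrow> 0) (at 0)"
proof (rule filterlim_split_at)
  show "(flat_exp k \<longlongrightarrow> 0) (at_left 0)"
    by (rule tendsto_eventually) (auto simp: eventually_at_filter flat_exp_def)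
  have "((\<lambda>y. y ^ k / exp y) \<longlongrightarrow> (0 :: real)) at_top" by (rule tendsto_power_div_exp_0)
  then have "((\<lambda>x. inverse x ^ k / exp (inverse x)) \<longlongrightarrow> (0 :: real)) (at_right 0)"
    by (rule filterlim_compose[OF _ filterlim_inverse_at_top_right])
  then show "(flat_exp k \<longlongrightarrow> 0) (at_right 0)"
    by (rule Lim_transform_eventually)
       (auto simp: eventually_at_filter flat_exp_def exp_minus divide_inverse)
qed

lemma flat_exp_has_derivative:
  "(flat_exp k has_real_derivative flat_exp (k + 2) x - real k * flat_exp (k + 1) x) (at x)"
proof -
  consider "x > 0" | "x = 0" | "x < 0" by linarith
  then show ?thesis
  proof cases
    case 1
    have p: "((\<lambda>x. inverse x ^ k) has_real_derivative - (real k * inverse x ^ (k + 1))) (at x)"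
      by (rule DERIV_cong[OF DERIV_power[OF DERIV_inverse]]) (use 1 in \<open>cases k; simp\<close>)+
    have e: "((\<lambda>x. exp (- inverse x)) has_real_derivative exp (- inverse x) * (inverse x)\<^sup>2) (at x)"
      using 1 by (auto intro!: derivative_eq_intros simp: power2_eq_square)
    have "((\<lambda>x. inverse x ^ k * exp (- inverse x)) has_real_derivative
        flat_exp (k + 2) x - real k * flat_exp (k + 1) x) (at x)"
      by (rule DERIV_cong[OF DERIV_mult[OF p e]]) (use 1 in \<open>simp add: flat_exp_def power2_eq_square algebra_simps\<close>)
    then show ?thesis
      by (rule has_field_derivative_transform_within_open[where S = "{0<..}"]) (use 1 in \<open>auto simp: flat_exp_def\<close>)
  next
    case 2
    \<comment> \<open>The difference quotient at 0 is the next member of the family, which tends to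
      0.\<close>
    have "((\<lambda>h. (flat_exp k (0 + h) - flat_exp k 0) / h) \<longlongrightarrow> 0) (at 0)"
      by (rule Lim_transform_eventually[OF flat_exp_tendsto_0[of "Suc k"]])
         (auto simp: eventually_at_filter flat_exp_def divide_inverse)
    then show ?thesis unfolding DERIV_def 2 by (simp add: flat_exp_def)
  next
    case 3
    have "((\<lambda>x. 0) has_real_derivative flat_exp (k + 2) x - real k * flat_exp (k + 1) x) (at x)"
      using 3 by (simp add: flat_exp_def)
    then show ?thesis
      by (rule has_field_derivative_transform_within_open[where S = "{..<0}"]) (use 3 in \<open>auto simp: flat_exp_def\<close>)
  qed
qed

lemma smooth_flat_exp: "smooth_on UNIV (flat_exp k)"
proof -
  have "Ck_on n UNIV (flat_exp k)" for n
  proof (induction n arbitrary: k)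
    case 0
    show ?case
      using flat_exp_has_derivative[THEN DERIV_isCont] by (auto intro: continuous_at_imp_continuous_on)
  next
    case (Suc n)
    have d: "(flat_exp k has_derivative (*) (flat_exp (k + 2) x - real k * flat_exp (k + 1) x)) (at x)" for x
      using flat_exp_has_derivative by (simp add: has_field_derivative_def)
    have "Ck_on n UNIV (\<lambda>x. (flat_exp (k + 2) x + (- real k) * flat_exp (k + 1) x) * v)" for v
      by (intro Ck_on_bilinear[OF open_UNIV bounded_bilinear_mult] Ck_on_add[OF open_UNIV] Ck_on_const Suc)
    then show ?case
      using d by (auto simp: frechet_derivative_at[OF d, symmetric] differentiable_def)
  qed
  then show ?thesis by (simp add: smooth_on_def)
qed

context smooth_manifold
begin

lemma pdiff_cong:
  assumes c: "c \<in> A" "q \<in> cdom c" and "(f \<circ> cinv c) differentiable (at (cmap c q))"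
    and "\<And>r. r \<in> cdom c \<Longrightarrow> f r = g r"
  shows "pdiff c l f q = pdiff c l g q"
proof -
  have "((g \<circ> cinv c) has_derivative frechet_derivative (f \<circ> cinv c) (at (cmap c q))) (at (cmap c q))"
    by (rule has_derivative_transform_within_open[OF differentiable_has_frechet_derivative[OF assms(3)] open_cmap_cdom[OF c(1)]])
       (use c assms(4) in \<open>auto simp: cinv_cmap\<close>)
  then show ?thesis unfolding pdiff_def using frechet_derivative_at by metis
qed

text \<open>A radial bump times the k-th coordinate centred at \<open>q\<close>. This coordinate
  vanishes at \<open>q\<close>, so only the derivative of the linear factor survives, and the
  constant \<open>a\<close> is the height of the bump at its centre.\<close>

lemma bump_with_differential:
  assumes c: "c \<in> A" "q \<in> cdom c"
  shows "\<exists>f a. smooth_fun_on A UNIV f \<and> a \<noteq> 0 \<and> (\<forall>j. pdiff c j f q = (if j = k then a else 0))"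
proof -
  define y0 where "y0 = cmap c q"
  have "y0 \<in> cmap c ` cdom c" using c by (simp add: y0_def)
  then obtain r where r: "r > 0" "cball y0 r \<subseteq> cmap c ` cdom c"
    using open_contains_cball open_cmap_cdom[OF c(1)] by blast
  \<comment> \<open>As a compact set in a Hausdorff space \<open>K\<close> is closed. Hence the
    extension by zero is smooth also at points outside the chart, which have neighbourhoods disjoint
    from \<open>K\<close>.\<close>
  define K where "K = cinv c ` cball y0 r"
  define b where "b y = flat_exp 0 (r\<^sup>2 - (y - y0) \<bullet> (y - y0))" for y
  define g where "g y = b y * (y - y0) $ k" for y
  define f where "f p = (if p \<in> cdom c then g (cmap c p) else 0)" for p
  have "compact K" unfolding K_def
    by (rule compact_continuous_image[OF continuous_on_subset[OF continuous_on_cinv[OF c(1)] r(2)] compact_cball])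
  then have oK: "open (- K)" using compact_imp_closed by blast
  have s1: "smooth_on UNIV (\<lambda>y. y - y0)"
    by (intro smooth_on_diff smooth_on_const smooth_on_bounded_linear bounded_linear_ident open_UNIV)
  have "smooth_on UNIV (\<lambda>y. (y - y0) \<bullet> (y - y0))"
    using s1 unfolding smooth_on_def by (simp add: Ck_on_bilinear[OF open_UNIV bounded_bilinear_inner])
  then have "smooth_on UNIV (\<lambda>y. r\<^sup>2 - (y - y0) \<bullet> (y - y0))"
    by (intro smooth_on_diff smooth_on_const open_UNIV)
  from smooth_on_compose[OF open_UNIV open_UNIV _ this smooth_flat_exp]
  have sb: "smooth_on UNIV b" unfolding b_def by simp
  have sg: "smooth_on UNIV g"
    unfolding g_def
    by (intro smooth_on_mult sb smooth_on_bounded_linear_comp[OF _ bounded_linear_vec_nth s1] open_UNIV)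
  have f0: "f p = 0" if "p \<notin> K" for p
  proof (cases "p \<in> cdom c")
    case True
    have "cmap c p \<notin> cball y0 r"
    proof
      assume "cmap c p \<in> cball y0 r"
      then have "cinv c (cmap c p) \<in> K" unfolding K_def by (rule imageI)
      then show False using that cinv_cmap[OF c(1) True] by simp
    qed
    then have "r < norm (cmap c p - y0)" by (simp add: dist_norm norm_minus_commute)
    then have "r\<^sup>2 \<le> (cmap c p - y0) \<bullet> (cmap c p - y0)"
      unfolding dot_square_norm using r(1) by (intro power_mono) auto
    then show ?thesis by (simp add: f_def g_def b_def flat_exp_def)
  qed (simp add: f_def)
  have sf: "smooth_fun_on A UNIV f"
    unfolding smooth_fun_on_def
  proof (intro ballI smooth_on_local)
    fix c' z assume c': "c' \<in> A" and "z \<in> cmap c' ` (UNIV \<inter> cdom c')"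
    then obtain p where p: "p \<in> cdom c'" "z = cmap c' p" by blast
    show "\<exists>T. open T \<and> z \<in> T \<and> smooth_on T (f \<circ> cinv c')"
    proof (cases "p \<in> cdom c")
      case True
      let ?T = "cmap c' ` (cdom c' \<inter> cdom c)"
      have oT: "open ?T" using open_overlap c' c by blast
      have "smooth_on ?T (\<lambda>z. g ((cmap c \<circ> cinv c') z))"
        by (rule smooth_on_compose[OF oT open_UNIV _ smooth_on_transition[OF c' c(1)] sg]) simp
      then have "smooth_on ?T (f \<circ> cinv c')"
        by (rule smooth_on_cong[OF oT, rotated]) (auto simp: f_def cinv_cmap[OF c'])
      then show ?thesis using oT True p by blast
    next
      case False
      let ?T = "cmap c' ` (- K \<inter> cdom c')"
      have oT: "open ?T" by (rule open_cmap_image[OF c' oK])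
      have "p \<notin> K"
      proof
        assume "p \<in> K"
        then obtain y where "y \<in> cball y0 r" "p = cinv c y" unfolding K_def by blast
        then have "p \<in> cdom c" using r(2) cinv_in[OF c(1)] by blast
        then show False using False by simp
      qed
      moreover have "smooth_on ?T (f \<circ> cinv c')"
        by (rule smooth_on_cong[OF oT _ smooth_on_const[of ?T 0]]) (auto simp: f0 cinv_cmap[OF c'])
      ultimately show ?thesis using oT p by blast
    qed
  qed
  have bd: "(b has_derivative frechet_derivative b (at y0)) (at y0)"
    using smooth_on_has_derivative[OF sb] by simp
  have nd: "((\<lambda>y. (y - y0) $ k) has_derivative (\<lambda>v. v $ k)) (at y0)"
    by (rule bounded_linear.has_derivative[OF bounded_linear_vec_nth]) (auto intro!: derivative_eq_intros)
  have "(g has_derivative (\<lambda>v. b y0 * v $ k)) (at y0)"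
    using has_derivative_mult[OF bd nd] unfolding g_def[abs_def] by simp
  then have "((f \<circ> cinv c) has_derivative (\<lambda>v. b y0 * v $ k)) (at y0)"
    by (rule has_derivative_transform_within_open[OF _ open_cmap_cdom[OF c(1)] \<open>y0 \<in> _\<close>])
       (auto simp: f_def cinv_cmap[OF c(1)])
  from frechet_derivative_at[OF this, symmetric]
  have "pdiff c j f q = (if j = k then b y0 else 0)" for j
    by (simp add: pdiff_def y0_def axis_def)
  moreover have "b y0 \<noteq> 0" using r(1) by (simp add: b_def flat_exp_def)
  ultimately show ?thesis using sf by blast
qed

end

section \<open>Equality of the operators\<close>

context sub_riemannian_manifold
begin

lemma grad_hor_differentiable:
  assumes f: "smooth_fun_on A UNIV f" and c: "c \<in> A" "q \<in> cdom c"
  shows "vf_in A c (grad_hor A H ip f) differentiable (at (cmap c q))"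
proof -
  let ?D = "cmap c ` cdom c"
  note oD = open_cmap_cdom[OF c(1)]
  have "smooth_on ?D (\<lambda>y. \<Sum>i\<in>UNIV. (\<Sum>j\<in>UNIV. Bc c i j y * frechet_derivative (f \<circ> cinv c) (at y) (axis j 1)) *\<^sub>R (axis i 1 :: real ^ 'n))"
    by (intro smooth_on_sum smooth_on_scaleR smooth_on_mult smooth_Bc smooth_on_frechet_derivative
        smooth_fun_chart f smooth_on_const c oD)
  then have "smooth_on ?D (vf_in A c (grad_hor A H ip f))"
  proof (rule smooth_on_cong[OF oD, rotated])
    fix y assume y: "y \<in> ?D"
    have "vf_in A c (grad_hor A H ip f) y $ i = (\<Sum>j\<in>UNIV. Bc c i j y * frechet_derivative (f \<circ> cinv c) (at y) (axis j 1))" for i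
      using grad_hor_comp[OF f c(1) cinv_in[OF c(1) y], of i] cmap_cinv[OF c(1) y]
      by (simp add: vf_in_def Bc_def pdiff_def)
    then show "(\<Sum>i\<in>UNIV. (\<Sum>j\<in>UNIV. Bc c i j y * frechet_derivative (f \<circ> cinv c) (at y) (axis j 1)) *\<^sub>R axis i 1)
       = vf_in A c (grad_hor A H ip f) y"
      using vec_axis_sum[of "vf_in A c (grad_hor A H ip f) y"] by simp
  qed
  then show ?thesis by (rule smooth_on_differentiable) (use c in blast)
qed

end

context vertical_sub_riemannian
begin

lemma L_eq_div_grad_iff:
  assumes ori: "orientation A ori" and \<omega>: "volume_form A ori \<omega>" and c: "c \<in> ori" "x \<in> cdom c"
    and f: "smooth_fun_on A UNIV f"
  shows "L_vertical A H ip V f x = 1 / real m * divergence A ori \<omega> (grad_hor A H ip f) x \<longleftrightarrow>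
    (\<Sum>k\<in>UNIV. pdiff c k f x * drift c k x) = (\<Sum>k\<in>UNIV. pdiff c k f x * div_drift c (vol_density A \<omega> c) k x)"
proof -
  have cA: "c \<in> A" using ori c by (auto simp: orientation_def)
  have "divergence A ori \<omega> (grad_hor A H ip f) x = div_expr \<omega> (grad_hor A H ip f) c x"
    by (rule divergence_eq_div_expr[OF ori \<omega> c grad_hor_differentiable[OF f]])
  also have "\<dots> = (\<Sum>i\<in>UNIV. \<Sum>l\<in>UNIV. \<beta>_comp A H ip c l i x * hess c f i l x)
      + (\<Sum>k\<in>UNIV. pdiff c k f x * div_drift c (vol_density A \<omega> c) k x)"
    unfolding div_expr_def by (rule div_grad_chart[OF f cA c(2)])
  finally show ?thesis using rank_pos by (simp add: L_vertical_chart[OF f cA c(2)])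
qed

text \<open>Both operators have values independent of charts, so one chart around each point decides
  the equality. This is what allows the sufficient condition to be imposed on a covering
  subfamily.\<close>

lemma L_is_div_grad_cover:
  assumes ori: "orientation A ori" and \<omega>: "volume_form A ori \<omega>"
    and C: "C \<subseteq> ori" "(\<Union>c\<in>C. cdom c) = UNIV"
      "\<And>c q k. c \<in> C \<Longrightarrow> q \<in> cdom c \<Longrightarrow> drift c k q = div_drift c (vol_density A \<omega> c) k q"
  shows "L_is_div_grad A ori H ip V m \<omega>"
  unfolding L_is_div_grad_def
proof (intro allI impI)
  fix f x assume f: "smooth_fun_on A UNIV f"
  obtain c where c: "c \<in> C" "x \<in> cdom c" using C(2) by blast
  then have "c \<in> ori" using C(1) by blast
  show "L_vertical A H ip V f x = 1 / real m * divergence A ori \<omega> (grad_hor A H ip f) x"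
    unfolding L_eq_div_grad_iff[OF ori \<omega> \<open>c \<in> ori\<close> c(2) f] using C(3)[OF c] by simp
qed

lemma L_is_div_grad_iff:
  assumes ori: "orientation A ori" and \<omega>: "volume_form A ori \<omega>"
  shows "L_is_div_grad A ori H ip V m \<omega> \<longleftrightarrow>
    (\<forall>c\<in>ori. \<forall>q\<in>cdom c. \<forall>k. drift c k q = div_drift c (vol_density A \<omega> c) k q)"
proof (intro iffI ballI allI)
  fix c q k assume L: "L_is_div_grad A ori H ip V m \<omega>" and c: "c \<in> ori" "q \<in> cdom c"
  have cA: "c \<in> A" using ori c by (auto simp: orientation_def)
  \<comment> \<open>With a single nonzero partial derivative, \<open>f\<close> reduces the equality
    of the two sums to their k-th coefficients.\<close>
  obtain f a where f: "smooth_fun_on A UNIV f" "a \<noteq> 0" "\<And>j. pdiff c j f q = (if j = k then a else 0)"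
    using bump_with_differential[OF cA c(2), of k] by blast
  have "(\<Sum>k\<in>UNIV. pdiff c k f q * drift c k q) = (\<Sum>k\<in>UNIV. pdiff c k f q * div_drift c (vol_density A \<omega> c) k q)"
    using L f(1) L_eq_div_grad_iff[OF ori \<omega> c f(1)] by (simp add: L_is_div_grad_def)
  then show "drift c k q = div_drift c (vol_density A \<omega> c) k q"
    using f(2) by (simp add: f(3) if_distrib[of "\<lambda>x. x * _"] cong: if_cong)
next
  assume C: "\<forall>c\<in>ori. \<forall>q\<in>cdom c. \<forall>k. drift c k q = div_drift c (vol_density A \<omega> c) k q"
  show "L_is_div_grad A ori H ip V m \<omega>"
    by (rule L_is_div_grad_cover[OF ori \<omega> order_refl]) (use ori C in \<open>simp_all add: orientation_def\<close>)
qed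

subsection \<open>Diagonal changes of coordinates\<close>

context
  fixes c :: "('a, 'n) chart" and d :: "'n \<Rightarrow> real" and c' :: "('a, 'n) chart"
  assumes c: "c \<in> A" and c': "c' \<in> A" and d: "\<And>i. d i > 0"
    and dom: "cdom c' = cdom c" and map: "\<And>q i. cmap c' q $ i = cmap c q $ i / d i"
begin

text \<open>Dividing the i-th coordinate by \<open>d i\<close> multiplies the i-th coordinate vector
  by \<open>d i\<close> and its dual covector by the inverse; the \<open>scaled_\<close> lemmas
  record the resulting weights.\<close>

lemma scaled_dtrans:
  assumes "q \<in> cdom c"
  shows "dtrans c' c q v = (\<chi> i. d i * v $ i)" "dtrans c c' q v = (\<chi> i. v $ i / d i)"
proof -
  have "linear (\<lambda>v. (\<chi> i. d i * v $ i) :: real ^ 'n)"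
    by (rule linearI) (simp_all add: vec_eq_iff algebra_simps)
  then have "((\<lambda>v. (\<chi> i. d i * v $ i) :: real ^ 'n) has_derivative (\<lambda>v. \<chi> i. d i * v $ i)) (at (cmap c' q))"
    by (intro bounded_linear_imp_has_derivative) (simp add: linear_conv_bounded_linear)
  then have "((cmap c \<circ> cinv c') has_derivative (\<lambda>v. \<chi> i. d i * v $ i)) (at (cmap c' q))"
  proof (rule has_derivative_transform_within_open[OF _ open_cmap_cdom[OF c']])
    show "cmap c' q \<in> cmap c' ` cdom c'" using assms dom by simp
    fix z assume "z \<in> cmap c' ` cdom c'"
    then obtain r where r: "r \<in> cdom c'" "z = cmap c' r" by blast
    have "d i \<noteq> 0" for i using d[of i] by simp
    then show "(\<chi> i. d i * z $ i) = (cmap c \<circ> cinv c') z"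
      using cinv_cmap[OF c' r(1)] by (simp add: r(2) vec_eq_iff map)
  qed
  then show 1: "dtrans c' c q v = (\<chi> i. d i * v $ i)" for v
    unfolding dtrans_def using frechet_derivative_at by metis
  have "dtrans c' c q (\<chi> i. v $ i / d i) = v"
    using d by (simp add: 1 vec_eq_iff less_imp_neq[symmetric] order.strict_iff_not)
  then show "dtrans c c' q v = (\<chi> i. v $ i / d i)"
    using dtrans_inverse[OF c' c, of q "\<chi> i. v $ i / d i"] assms dom by simp
qed

lemma scaled_pdiff:
  assumes q: "q \<in> cdom c" and f: "(f \<circ> cinv c) differentiable (at (cmap c q))"
  shows "pdiff c' l f q = d l * pdiff c l f q" "(f \<circ> cinv c') differentiable (at (cmap c' q))"
proof -
  have h: "((f \<circ> cinv c') has_derivative (\<lambda>v. frechet_derivative (f \<circ> cinv c) (at (cmap c q)) (dtrans c' c q v))) (at (cmap c' q))"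
    by (rule has_derivative_change_chart[OF c c' q _ differentiable_has_frechet_derivative[OF f]]) (use q dom in simp)
  then show "(f \<circ> cinv c') differentiable (at (cmap c' q))" by (rule differentiableI)
  have "dtrans c' c q (axis l 1) = d l *\<^sub>R axis l 1"
    by (simp add: scaled_dtrans[OF q] vec_eq_iff axis_def)
  then show "pdiff c' l f q = d l * pdiff c l f q"
    using linear_cmul[OF linear_frechet_derivative[OF f]]
    by (simp add: pdiff_def frechet_derivative_at[OF h, symmetric])
qed

text \<open>The change of coordinates is linear, so components are multiplied by constants and
  differentiation creates no further terms.\<close>

lemma scaled_pdiff_multiple:
  assumes q: "q \<in> cdom c" and f: "(f \<circ> cinv c) differentiable (at (cmap c q))"
    and g: "\<And>r. r \<in> cdom c \<Longrightarrow> g r = a * f r"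
  shows "pdiff c' l g q = a * (d l * pdiff c l f q)"
proof -
  have f': "(f \<circ> cinv c') differentiable (at (cmap c' q))" by (rule scaled_pdiff(2)[OF q f])
  have h: "(((\<lambda>r. a * f r) \<circ> cinv c') has_derivative (\<lambda>v. a * frechet_derivative (f \<circ> cinv c') (at (cmap c' q)) v)) (at (cmap c' q))"
    using has_derivative_mult_right[OF differentiable_has_frechet_derivative[OF f'], of a] by (simp add: o_def)
  have "pdiff c' l g q = pdiff c' l (\<lambda>r. a * f r) q"
    using pdiff_cong[OF c' _ differentiableI[OF h], of g l] q g dom by simp
  also have "\<dots> = a * pdiff c' l f q"
    by (simp add: pdiff_def frechet_derivative_at[OF h, symmetric])
  finally show ?thesis using scaled_pdiff(1)[OF q f] by simp
qed

lemma scaled_dcoord: "q \<in> cdom c \<Longrightarrow> dcoord A c' i q = (1 / d i) *\<^sub>R dcoord A c i q"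
  using dtrans_tcomp[OF c c', of q] dom
  by (intro blinfun_eqI) (simp add: dcoord_apply c c' blinfun.scaleR_left scaled_dtrans flip: dtrans_tcomp[OF c c', of q])

lemma scaled_tbasis: "q \<in> cdom c \<Longrightarrow> tbasis A c' i q = d i *\<^sub>R tbasis A c i q"
proof -
  assume q: "q \<in> cdom c"
  have "dtrans c' c q (axis i 1) = d i *\<^sub>R axis i 1"
    by (simp add: scaled_dtrans[OF q] vec_eq_iff axis_def)
  then show ?thesis
    using tvec_dtrans[OF c' c, of q "axis i 1"] q dom linear_cmul[OF linear_tvec[OF c q]]
    by (simp add: tbasis_tvec)
qed

lemma scaled_\<beta>_comp: "q \<in> cdom c \<Longrightarrow> \<beta>_comp A H ip c' i j q = (1 / (d i * d j)) * \<beta>_comp A H ip c i j q"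
  by (simp add: \<beta>_comp_def scaled_dcoord blinfun.scaleR_left blinfun.scaleR_right linear_cmul[OF linear_cometric])

lemma scaled_gV_comp: "q \<in> cdom c \<Longrightarrow> gV_comp A H ip V c' i j q = d i * d j * gV_comp A H ip V c i j q"
  by (simp add: gV_comp_def scaled_tbasis vertical_cometric_eq flat_apply linear_cmul[OF linear_proj]
      linear_cmul[OF linear_G_left] linear_cmul[OF linear_G_right])

lemma scaled_vol_density:
  "q \<in> cdom c \<Longrightarrow> top_form (\<omega> q) \<Longrightarrow> vol_density A \<omega> c' q = prod d UNIV * vol_density A \<omega> c q"
  using top_form_scale_rows[of "\<omega> q" UNIV d "\<chi> i. tbasis A c i q"]
  by (simp add: vol_density_def scaled_tbasis)

text \<open>In the product of \<open>gV_comp\<close> with the derivative of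
  \<open>\<beta>_comp\<close> the weights of i and j cancel, and in the logarithmic derivative of
  the density the product of all weights cancels. Only the factor \<open>d l\<close> of the
  differentiation is left on both sides.\<close>

lemma scaled_first_condition:
  assumes q: "q \<in> cdom c" and \<omega>: "\<And>q. top_form (\<omega> q)"
    and \<tau>: "(vol_density A \<omega> c \<circ> cinv c) differentiable (at (cmap c q))"
    and eq: "- (1/2) * (\<Sum>i\<in>UNIV. \<Sum>j\<in>UNIV. \<Sum>l\<in>UNIV. gV_comp A H ip V c' i j q * pdiff c' l (\<beta>_comp A H ip c' i j) q)
       = 1 / vol_density A \<omega> c' q * (\<Sum>l\<in>UNIV. pdiff c' l (vol_density A \<omega> c') q)"
  shows "(\<Sum>l\<in>UNIV. d l * (- (1/2) * (\<Sum>i\<in>UNIV. \<Sum>j\<in>UNIV. gV_comp A H ip V c i j q * pdiff c l (\<beta>_comp A H ip c i j) q)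
       - 1 / vol_density A \<omega> c q * pdiff c l (vol_density A \<omega> c) q)) = 0"
proof -
  have d0: "d i \<noteq> 0" for i using d[of i] by simp
  have \<beta>d: "(\<beta>_comp A H ip c i j \<circ> cinv c) differentiable (at (cmap c q))" for i j
    by (rule smooth_on_differentiable[OF smooth_\<beta>_comp[OF c]]) (use q in simp)
  have 1: "gV_comp A H ip V c' i j q * pdiff c' l (\<beta>_comp A H ip c' i j) q
      = d l * (gV_comp A H ip V c i j q * pdiff c l (\<beta>_comp A H ip c i j) q)" for i j l
    using scaled_pdiff_multiple[OF q \<beta>d scaled_\<beta>_comp, of l i j] d0[of i] d0[of j]
    by (simp add: scaled_gV_comp[OF q])
  have 2: "1 / vol_density A \<omega> c' q * pdiff c' l (vol_density A \<omega> c') q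
      = d l * (1 / vol_density A \<omega> c q * pdiff c l (vol_density A \<omega> c) q)" for l
    using scaled_pdiff_multiple[OF q \<tau> scaled_vol_density[OF _ \<omega>], of l] d0
    by (simp add: scaled_vol_density[OF q \<omega>])
  have "(\<Sum>i\<in>UNIV. \<Sum>j\<in>UNIV. \<Sum>l\<in>UNIV. d l * (gV_comp A H ip V c i j q * pdiff c l (\<beta>_comp A H ip c i j) q))
      = (\<Sum>i\<in>UNIV. \<Sum>l\<in>UNIV. \<Sum>j\<in>UNIV. d l * (gV_comp A H ip V c i j q * pdiff c l (\<beta>_comp A H ip c i j) q))"
    by (intro sum.cong refl sum.swap)
  also have "\<dots> = (\<Sum>l\<in>UNIV. \<Sum>i\<in>UNIV. \<Sum>j\<in>UNIV. d l * (gV_comp A H ip V c i j q * pdiff c l (\<beta>_comp A H ip c i j) q))"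
    by (rule sum.swap)
  finally have 3: "(\<Sum>i\<in>UNIV. \<Sum>j\<in>UNIV. \<Sum>l\<in>UNIV. d l * (gV_comp A H ip V c i j q * pdiff c l (\<beta>_comp A H ip c i j) q))
     = (\<Sum>l\<in>UNIV. d l * (\<Sum>i\<in>UNIV. \<Sum>j\<in>UNIV. gV_comp A H ip V c i j q * pdiff c l (\<beta>_comp A H ip c i j) q))"
    by (simp add: sum_distrib_left)
  have "- (1/2) * (\<Sum>l\<in>UNIV. d l * (\<Sum>i\<in>UNIV. \<Sum>j\<in>UNIV. gV_comp A H ip V c i j q * pdiff c l (\<beta>_comp A H ip c i j) q))
     = (\<Sum>l\<in>UNIV. d l * (1 / vol_density A \<omega> c q * pdiff c l (vol_density A \<omega> c) q))"
    using eq unfolding sum_distrib_left[of "1 / vol_density A \<omega> c' q"] 1 2 3 .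
  then have "(\<Sum>l\<in>UNIV. d l * (1 / vol_density A \<omega> c q * pdiff c l (vol_density A \<omega> c) q))
     = (\<Sum>l\<in>UNIV. d l * (- (1/2) * (\<Sum>i\<in>UNIV. \<Sum>j\<in>UNIV. gV_comp A H ip V c i j q * pdiff c l (\<beta>_comp A H ip c i j) q)))"
    by (simp only: sum_distrib_left mult.left_commute)
  then show ?thesis by (simp only: right_diff_distrib sum_subtractf)
qed

end

text \<open>Let \<open>a l\<close> be the difference of the two sides of the first equation before
  summation over l. Diagonal changes show that all positive weightings of \<open>a\<close> have sum
  zero, so \<open>a\<close> vanishes. Multiplying by \<beta>^{lk}, summing over l and adding the
  second equation gives equality of the drifts.\<close>

lemma sufficient_conditions:
  assumes ori: "orientation A ori" and \<omega>: "volume_form A ori \<omega>" and C: "linearly_closed_coordinates ori C"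
    and 1: "\<And>c q. c \<in> C \<Longrightarrow> q \<in> cdom c \<Longrightarrow>
      - (1/2) * (\<Sum>i\<in>UNIV. \<Sum>j\<in>UNIV. \<Sum>l\<in>UNIV. gV_comp A H ip V c i j q * pdiff c l (\<beta>_comp A H ip c i j) q)
        = 1 / vol_density A \<omega> c q * (\<Sum>l\<in>UNIV. pdiff c l (vol_density A \<omega> c) q)"
    and 2: "\<And>c q k. c \<in> C \<Longrightarrow> q \<in> cdom c \<Longrightarrow>
      (\<Sum>j\<in>UNIV. \<Sum>l\<in>UNIV. P_comp A H ip G c l j q * pdiff c l (\<beta>_comp A H ip c j k) q)
        = (\<Sum>l\<in>UNIV. pdiff c l (\<beta>_comp A H ip c l k) q)"
  shows "L_is_div_grad A ori H ip V m \<omega>"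
proof (rule L_is_div_grad_cover[OF ori \<omega>])
  show "C \<subseteq> ori" "(\<Union>c\<in>C. cdom c) = UNIV" using C by (auto simp: linearly_closed_coordinates_def)
  fix c q k assume c: "c \<in> C" "q \<in> cdom c"
  have co: "c \<in> ori" using c \<open>C \<subseteq> ori\<close> by blast
  have cA: "c \<in> A" if "c \<in> C" for c using that \<open>C \<subseteq> ori\<close> ori by (auto simp: orientation_def)
  define a where "a l = - (1/2) * (\<Sum>i\<in>UNIV. \<Sum>j\<in>UNIV. gV_comp A H ip V c i j q * pdiff c l (\<beta>_comp A H ip c i j) q)
       - 1 / vol_density A \<omega> c q * pdiff c l (vol_density A \<omega> c) q" for l
  have lin: "(\<Sum>l\<in>UNIV. d l * a l) = 0" if d: "\<And>i. d i > 0" for d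
  proof -
    define B :: "real ^ 'n ^ 'n" where "B = (\<chi> i j. if i = j then 1 / d i else 0)"
    have "det B = (\<Prod>i\<in>UNIV. 1 / d i)" using det_diagonal[of B] by (simp add: B_def)
    then have "det B > 0" using d by (simp add: prod_pos)
    then have c': "(cdom c, \<lambda>q. B *v cmap c q) \<in> C" (is "?c \<in> C")
      using C c by (simp add: linearly_closed_coordinates_def)
    have map: "cmap ?c p $ i = cmap c p $ i / d i" for p i
    proof -
      have "(\<Sum>j\<in>UNIV. B $ i $ j * cmap c p $ j) = (\<Sum>j\<in>UNIV. if j = i then cmap c p $ i / d i else 0)"
        by (intro sum.cong refl) (auto simp: B_def)
      then show ?thesis by (simp add: matrix_vector_mult_def)
    qed
    have "(vol_density A \<omega> c \<circ> cinv c) differentiable (at (cmap c q))"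
      using \<omega> co c smooth_on_differentiable[of "cmap c ` cdom c" "vol_density A \<omega> c \<circ> cinv c" "cmap c q"]
      by (auto simp: volume_form_def)
    then show ?thesis
      unfolding a_def
      using scaled_first_condition[OF cA[OF c(1)] cA[OF c'] d _ map c(2), of \<omega>] 1[OF c', of q] \<omega> c
      by (simp add: volume_form_def)
  qed
  have a0: "a l = 0" for l
  proof -
    \<comment> \<open>The weights have to be positive, so \<open>a l\<close> is obtained as the
      difference of two admissible weightings: all weights 1, and the same with weight 2 at
      \<open>l\<close>.\<close>
    have "(\<Sum>i\<in>UNIV. (1 + (if i = l then 1 else 0)) * a i) = 0" by (rule lin) auto
    moreover have "(\<Sum>i\<in>UNIV. 1 * a i) = 0" by (rule lin) simp
    ultimately show ?thesis
      by (simp add: distrib_right sum.distrib if_distrib[of "\<lambda>x. x * _"] cong: if_cong)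
  qed
  have *: "- (1/2) * \<beta>_comp A H ip c l k q * (\<Sum>i\<in>UNIV. \<Sum>j\<in>UNIV. gV_comp A H ip V c i j q * pdiff c l (\<beta>_comp A H ip c i j) q)
     = \<beta>_comp A H ip c l k q * (1 / vol_density A \<omega> c q * pdiff c l (vol_density A \<omega> c) q)" for l
  proof -
    have "- (1/2) * (\<Sum>i\<in>UNIV. \<Sum>j\<in>UNIV. gV_comp A H ip V c i j q * pdiff c l (\<beta>_comp A H ip c i j) q)
       = 1 / vol_density A \<omega> c q * pdiff c l (vol_density A \<omega> c) q"
      using a0[of l] unfolding a_def by simp
    from arg_cong[OF this, of "(*) (\<beta>_comp A H ip c l k q)"] show ?thesis by (simp only: mult_ac)
  qed
  show "drift c k q = div_drift c (vol_density A \<omega> c) k q"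
    unfolding drift_def div_drift_def sum.distrib * 2[OF c, symmetric] by (subst sum.swap) simp
qed

end

section \<open>The theorem\<close>

theorem theorem5p13:
  fixes A ori :: "('a::{t2_space,second_countable_topology}, 'n::finite) chart set"
    and H V :: "'a \<Rightarrow> (real ^ 'n) set"
    and ip G :: "'a \<Rightarrow> real ^ 'n \<Rightarrow> real ^ 'n \<Rightarrow> real"
    and m :: nat
  assumes "sub_riemannian A H ip m"
    and "Metric_space.mcomplete UNIV (cc_dist A H ip)"
    and "vertical_distribution A H V"
    and "riemannian_metric A G"
    and "\<And>q u v. u \<in> H q \<Longrightarrow> v \<in> H q \<Longrightarrow> G q u v = ip q u v"
    and "\<And>q. V q = {v. \<forall>u\<in>H q. G q u v = 0}"
    and "orientation A ori"
  defines "\<beta> \<equiv> \<beta>_comp A H ip" and "gV \<equiv> gV_comp A H ip V" and "P \<equiv> P_comp A H ip G"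
    and "\<tau> \<equiv> vol_density A"
  defines "coordinate_system \<equiv> \<lambda>\<omega>. \<forall>c\<in>ori. \<forall>q\<in>cdom c. \<forall>k.
      (\<Sum>l\<in>UNIV. - (1/2) * \<beta> c l k q * (\<Sum>i\<in>UNIV. \<Sum>j\<in>UNIV. gV c i j q * pdiff c l (\<beta> c i j) q)
          + (\<Sum>j\<in>UNIV. P c l j q * pdiff c l (\<beta> c j k) q))
      = (\<Sum>l\<in>UNIV. \<beta> c l k q * (1 / \<tau> \<omega> c q * pdiff c l (\<tau> \<omega> c) q) + pdiff c l (\<beta> c l k) q)"
  shows "((\<exists>\<omega>. volume_form A ori \<omega> \<and> L_is_div_grad A ori H ip V m \<omega>) \<longleftrightarrow>
            (\<exists>\<omega>. volume_form A ori \<omega> \<and> coordinate_system \<omega>)) \<and>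
         (\<forall>\<omega>. volume_form A ori \<omega> \<longrightarrow>
            (L_is_div_grad A ori H ip V m \<omega> \<longleftrightarrow> coordinate_system \<omega>)) \<and>
         (\<forall>\<omega> C. volume_form A ori \<omega> \<and> linearly_closed_coordinates ori C \<and>
            (\<forall>c\<in>C. \<forall>q\<in>cdom c.
               - (1/2) * (\<Sum>i\<in>UNIV. \<Sum>j\<in>UNIV. \<Sum>l\<in>UNIV. gV c i j q * pdiff c l (\<beta> c i j) q)
                 = 1 / \<tau> \<omega> c q * (\<Sum>l\<in>UNIV. pdiff c l (\<tau> \<omega> c) q)) \<and>
            (\<forall>c\<in>C. \<forall>q\<in>cdom c. \<forall>k.
               (\<Sum>j\<in>UNIV. \<Sum>l\<in>UNIV. P c l j q * pdiff c l (\<beta> c j k) q)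
                 = (\<Sum>l\<in>UNIV. pdiff c l (\<beta> c l k) q))
            \<longrightarrow> L_is_div_grad A ori H ip V m \<omega>)"
proof -
  interpret vertical_sub_riemannian A H ip m V G
    using assms(1,4-6)
    by unfold_locales (auto simp: sub_riemannian_def)
  have sys: "coordinate_system \<omega> \<longleftrightarrow>
      (\<forall>c\<in>ori. \<forall>q\<in>cdom c. \<forall>k. drift c k q = div_drift c (vol_density A \<omega> c) k q)" for \<omega>
    unfolding coordinate_system_def \<beta>_def gV_def P_def \<tau>_def drift_def div_drift_def ..
  have iff: "L_is_div_grad A ori H ip V m \<omega> \<longleftrightarrow> coordinate_system \<omega>" if "volume_form A ori \<omega>" for \<omega>
    unfolding sys by (rule L_is_div_grad_iff[OF assms(7) that])
  show ?thesis
  proof (intro conjI allI impI)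
    show "(\<exists>\<omega>. volume_form A ori \<omega> \<and> L_is_div_grad A ori H ip V m \<omega>) \<longleftrightarrow>
        (\<exists>\<omega>. volume_form A ori \<omega> \<and> coordinate_system \<omega>)"
      using iff by blast
  next
    fix \<omega> assume "volume_form A ori \<omega>"
    then show "L_is_div_grad A ori H ip V m \<omega> \<longleftrightarrow> coordinate_system \<omega>" by (rule iff)
  next
    fix \<omega> C assume a: "volume_form A ori \<omega> \<and> linearly_closed_coordinates ori C \<and>
            (\<forall>c\<in>C. \<forall>q\<in>cdom c.
               - (1/2) * (\<Sum>i\<in>UNIV. \<Sum>j\<in>UNIV. \<Sum>l\<in>UNIV. gV c i j q * pdiff c l (\<beta> c i j) q)
                 = 1 / \<tau> \<omega> c q * (\<Sum>l\<in>UNIV. pdiff c l (\<tau> \<omega> c) q)) \<and>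
            (\<forall>c\<in>C. \<forall>q\<in>cdom c. \<forall>k.
               (\<Sum>j\<in>UNIV. \<Sum>l\<in>UNIV. P c l j q * pdiff c l (\<beta> c j k) q)
                 = (\<Sum>l\<in>UNIV. pdiff c l (\<beta> c l k) q))"
    show "L_is_div_grad A ori H ip V m \<omega>"
      by (rule sufficient_conditions[OF assms(7), of \<omega> C])
         (use a[unfolded \<beta>_def gV_def P_def \<tau>_def] in blast)+
  qed
qed

end
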